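(* Let $X$ and $Y$ be strings over an alphabet of size $\sigma$ with $|X|=m$ and $|Y|=n$. The length of a longest common subsequence of $X$ and $Y$ can be computed in the UW-RAM in $O\!\left(\frac{nm}{w^2}\log\sigma+m+n\right)$ time using $O\!\left(\frac{\min(n,m)}{w}\log\sigma\right)$ words of memory in addition to the input.
   Context: The word-RAM with word size $w$: memory consists of $w$-bit words, addressed by $w$-bit addresses; constant-time instructions are load/store/jump (direct and indirect addressing), addition, subtraction, shifts and bitwise AND/OR/NOT. The Ultra-Wide word-RAM (UW-RAM) extends the word-RAM by an ALU operating on $w^2$-bit wide words, viewed as $w$ blocks $W_0,\dots,W_{w-1}$ of $w$ bits each. In constant time it can: apply addition, subtraction, left/right shifts and bitwise boolean operations to whole wide words; apply compress (gather the lowest bit of each block into the first block) and its inverse spread; read/write one block from/to memory, read/write $w$ contiguous memory words into/from all blocks, and perform content access (for all $j$ in parallel, $W_j\leftarrow\mathrm{MEM}[\mathrm{base}+W_j]$, or $\mathrm{MEM}[\mathrm{base}+V_j]\leftarrow W_j$), with concurrent reads and exclusive writes. Standing assumptions for this result: $w=\Theta(\max\{\log n,\log m\})$, the alphabet is $\{0,1,\dots,\sigma-1\}$ with $\lceil\log\sigma\rceil\le w-1$. A longest common subsequence of two strings is a common subsequence (a sequence obtainable from each string by deleting symbols) of maximum length. *)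

theory Defs
  imports Complex_Main "HOL-Library.Sublist" "HOL-Number_Theory.Cong"
begin

definition common_subseq :: "'a list \<Rightarrow> 'a list \<Rightarrow> 'a list \<Rightarrow> bool" where
  "common_subseq Z X Y \<longleftrightarrow> subseq Z X \<and> subseq Z Y"

definition longest_common_subseq :: "'a list \<Rightarrow> 'a list \<Rightarrow> 'a list \<Rightarrow> bool" where
  "longest_common_subseq Z X Y \<longleftrightarrow>
     common_subseq Z X Y \<and> (\<forall>Z'. common_subseq Z' X Y \<longrightarrow> length Z' \<le> length Z)"

text \<open>
  The word size \<open>w\<close> is a parameter of the semantics and not of the programs, so that one program
  can be run for every word size. Words are naturals below \<open>2 ^ w\<close>, wide words are naturals below
  \<open>2 ^ (w * w)\<close>; block \<open>0\<close> of a wide word is the least significant one. The operations with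
  parameter \<open>b\<close> are used for words (\<open>b = w\<close>) and for wide words (\<open>b = w * w\<close>).
\<close>

definition add_bits :: "nat \<Rightarrow> nat \<Rightarrow> nat \<Rightarrow> nat" where
  "add_bits b x y = take_bit b (x + y)"

text \<open>Subtraction modulo \<open>2 ^ b\<close>; the truncation of \<open>-\<close> on naturals never occurs for
  \<open>y < 2 ^ b\<close>.\<close>

definition sub_bits :: "nat \<Rightarrow> nat \<Rightarrow> nat \<Rightarrow> nat" where
  "sub_bits b x y = take_bit b (x + 2 ^ b - y)"

definition shl_bits :: "nat \<Rightarrow> nat \<Rightarrow> nat \<Rightarrow> nat" where
  "shl_bits b x s = take_bit b (push_bit s x)"

definition shr_bits :: "nat \<Rightarrow> nat \<Rightarrow> nat" where
  "shr_bits x s = drop_bit s x"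

definition not_bits :: "nat \<Rightarrow> nat \<Rightarrow> nat" where
  "not_bits b x = mask b - x"

definition block :: "nat \<Rightarrow> nat \<Rightarrow> nat \<Rightarrow> nat" where
  "block w V j = take_bit w (drop_bit (j * w) V)"

definition of_blocks :: "nat \<Rightarrow> (nat \<Rightarrow> nat) \<Rightarrow> nat" where
  "of_blocks w f = (\<Sum>j<w. f j * 2 ^ (j * w))"

definition compress :: "nat \<Rightarrow> nat \<Rightarrow> nat" where
  "compress w V = (\<Sum>j<w. of_bool (bit V (j * w)) * 2 ^ j)"

definition spread :: "nat \<Rightarrow> nat \<Rightarrow> nat" where
  "spread w V = (\<Sum>j<w. of_bool (bit V j) * 2 ^ (j * w))"

text \<open>
  Word registers and wide registers are separate register files, both indexed by naturals; a
  program is a finite list of instructions and therefore uses a constant number of registers.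
  A numeral operand called \<open>k\<close>, \<open>l\<close> or \<open>addr\<close> below is an immediate constant, a program
  position or a memory address; all other operands are register indices, destination first.
  In the wide shifts the shift amount is in a word register, and in the memory instructions for
  wide words the block index and the base address are in word registers.
\<close>

datatype instr =
    Halt
  | LoadImm nat nat          \<comment> \<open>\<open>d k\<close>\<close>
  | Load nat nat             \<comment> \<open>\<open>d addr\<close>\<close>
  | LoadInd nat nat          \<comment> \<open>\<open>d a\<close>: the address is in \<open>a\<close>\<close>
  | Store nat nat            \<comment> \<open>\<open>addr a\<close>: the value is in \<open>a\<close>\<close>
  | StoreInd nat nat         \<comment> \<open>\<open>a b\<close>: the address is in \<open>a\<close>, the value in \<open>b\<close>\<close>
  | Jump nat                 \<comment> \<open>\<open>l\<close>\<close>
  | JumpInd nat              \<comment> \<open>\<open>a\<close>\<close>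
  | JumpZero nat nat         \<comment> \<open>\<open>a l\<close>\<close>
  | Add nat nat nat
  | Sub nat nat nat
  | Shl nat nat nat
  | Shr nat nat nat
  | And nat nat nat
  | Or nat nat nat
  | Not nat nat
  | WAdd nat nat nat
  | WSub nat nat nat
  | WShl nat nat nat
  | WShr nat nat nat
  | WAnd nat nat nat
  | WOr nat nat nat
  | WNot nat nat
  | Compress nat nat
  | Spread nat nat
  | ReadBlock nat nat nat    \<comment> \<open>\<open>d i a\<close>: block \<open>i\<close> of \<open>d\<close> from address \<open>a\<close>\<close>
  | WriteBlock nat nat nat   \<comment> \<open>\<open>a v i\<close>: block \<open>i\<close> of \<open>v\<close> to address \<open>a\<close>\<close>
  | ReadWide nat nat         \<comment> \<open>\<open>d a\<close>: \<open>w\<close> words from base \<open>a\<close>\<close>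
  | WriteWide nat nat        \<comment> \<open>\<open>a v\<close>: \<open>w\<close> words to base \<open>a\<close>\<close>
  | Gather nat nat           \<comment> \<open>\<open>d a\<close>: \<open>d\<^sub>j := MEM[a + d\<^sub>j]\<close>\<close>
  | Scatter nat nat nat      \<comment> \<open>\<open>a u v\<close>: \<open>MEM[a + u\<^sub>j] := v\<^sub>j\<close>\<close>

type_synonym program = "instr list"

record config =
  pc :: nat
  reg :: "nat \<Rightarrow> nat"
  wreg :: "nat \<Rightarrow> nat"
  mem :: "nat \<Rightarrow> nat"

definition wf_config :: "nat \<Rightarrow> config \<Rightarrow> bool" where
  "wf_config w c \<longleftrightarrow>
     (\<forall>i. reg c i < 2 ^ w) \<and> (\<forall>i. wreg c i < 2 ^ (w * w)) \<and> (\<forall>a < 2 ^ w. mem c a < 2 ^ w)"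

definition set_reg :: "nat \<Rightarrow> nat \<Rightarrow> config \<Rightarrow> config" where
  "set_reg d x c = c\<lparr>pc := Suc (pc c), reg := (reg c)(d := x)\<rparr>"

definition set_wreg :: "nat \<Rightarrow> nat \<Rightarrow> config \<Rightarrow> config" where
  "set_wreg d V c = c\<lparr>pc := Suc (pc c), wreg := (wreg c)(d := V)\<rparr>"

definition set_mem :: "(nat \<Rightarrow> nat) \<Rightarrow> config \<Rightarrow> config" where
  "set_mem m c = c\<lparr>pc := Suc (pc c), mem := m\<rparr>"

definition goto :: "nat \<Rightarrow> config \<Rightarrow> config" where
  "goto l c = c\<lparr>pc := l\<rparr>"

text \<open>Memory after the parallel writes \<open>MEM[addr j] := val j\<close> for \<open>j < w\<close>; only used when
  the addresses are pairwise distinct.\<close>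

definition write_all :: "nat \<Rightarrow> (nat \<Rightarrow> nat) \<Rightarrow> (nat \<Rightarrow> nat) \<Rightarrow> (nat \<Rightarrow> nat) \<Rightarrow> nat \<Rightarrow> nat" where
  "write_all w addr val m =
     (\<lambda>a. if a \<in> addr ` {..<w} then val (the_inv_into {..<w} addr a) else m a)"

text \<open>\<open>None\<close> means that the machine halts or that the instruction is not permitted: a block
  index out of range, or a write conflict (writes are exclusive).\<close>

fun exec_instr :: "nat \<Rightarrow> instr \<Rightarrow> config \<Rightarrow> config option" where
  "exec_instr w Halt c = None"
| "exec_instr w (LoadImm d k) c = Some (set_reg d (take_bit w k) c)"
| "exec_instr w (Load d addr) c = Some (set_reg d (mem c (take_bit w addr)) c)"
| "exec_instr w (LoadInd d a) c = Some (set_reg d (mem c (reg c a)) c)"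
| "exec_instr w (Store addr a) c = Some (set_mem ((mem c)(take_bit w addr := reg c a)) c)"
| "exec_instr w (StoreInd a b) c = Some (set_mem ((mem c)(reg c a := reg c b)) c)"
| "exec_instr w (Jump l) c = Some (goto l c)"
| "exec_instr w (JumpInd a) c = Some (goto (reg c a) c)"
| "exec_instr w (JumpZero a l) c = Some (goto (if reg c a = 0 then l else Suc (pc c)) c)"
| "exec_instr w (Add d a b) c = Some (set_reg d (add_bits w (reg c a) (reg c b)) c)"
| "exec_instr w (Sub d a b) c = Some (set_reg d (sub_bits w (reg c a) (reg c b)) c)"
| "exec_instr w (Shl d a b) c = Some (set_reg d (shl_bits w (reg c a) (reg c b)) c)"
| "exec_instr w (Shr d a b) c = Some (set_reg d (shr_bits (reg c a) (reg c b)) c)"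
| "exec_instr w (And d a b) c = Some (set_reg d (and (reg c a) (reg c b)) c)"
| "exec_instr w (Or d a b) c = Some (set_reg d (or (reg c a) (reg c b)) c)"
| "exec_instr w (Not d a) c = Some (set_reg d (not_bits w (reg c a)) c)"
| "exec_instr w (WAdd d u v) c = Some (set_wreg d (add_bits (w * w) (wreg c u) (wreg c v)) c)"
| "exec_instr w (WSub d u v) c = Some (set_wreg d (sub_bits (w * w) (wreg c u) (wreg c v)) c)"
| "exec_instr w (WShl d u a) c = Some (set_wreg d (shl_bits (w * w) (wreg c u) (reg c a)) c)"
| "exec_instr w (WShr d u a) c = Some (set_wreg d (shr_bits (wreg c u) (reg c a)) c)"
| "exec_instr w (WAnd d u v) c = Some (set_wreg d (and (wreg c u) (wreg c v)) c)"
| "exec_instr w (WOr d u v) c = Some (set_wreg d (or (wreg c u) (wreg c v)) c)"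
| "exec_instr w (WNot d u) c = Some (set_wreg d (not_bits (w * w) (wreg c u)) c)"
| "exec_instr w (Compress d u) c = Some (set_wreg d (compress w (wreg c u)) c)"
| "exec_instr w (Spread d u) c = Some (set_wreg d (spread w (wreg c u)) c)"
| "exec_instr w (ReadBlock d i a) c =
     (if reg c i < w
      then Some (set_wreg d (of_blocks w ((block w (wreg c d))(reg c i := mem c (reg c a)))) c)
      else None)"
| "exec_instr w (WriteBlock a v i) c =
     (if reg c i < w
      then Some (set_mem ((mem c)(reg c a := block w (wreg c v) (reg c i))) c)
      else None)"
| "exec_instr w (ReadWide d a) c =
     Some (set_wreg d (of_blocks w (\<lambda>j. mem c (add_bits w (reg c a) j))) c)"
| "exec_instr w (WriteWide a v) c =
     Some (set_mem (write_all w (add_bits w (reg c a)) (block w (wreg c v)) (mem c)) c)"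
| "exec_instr w (Gather d a) c =
     Some (set_wreg d
       (of_blocks w (\<lambda>j. mem c (add_bits w (reg c a) (block w (wreg c d) j)))) c)"
| "exec_instr w (Scatter a u v) c =
     (let addr = (\<lambda>j. add_bits w (reg c a) (block w (wreg c u) j))
      in if inj_on addr {..<w}
         then Some (set_mem (write_all w addr (block w (wreg c v)) (mem c)) c)
         else None)"

fun read_addrs :: "nat \<Rightarrow> instr \<Rightarrow> config \<Rightarrow> nat set" where
  "read_addrs w (Load d addr) c = {take_bit w addr}"
| "read_addrs w (LoadInd d a) c = {reg c a}"
| "read_addrs w (ReadBlock d i a) c = {reg c a}"
| "read_addrs w (ReadWide d a) c = add_bits w (reg c a) ` {..<w}"
| "read_addrs w (Gather d a) c = (\<lambda>j. add_bits w (reg c a) (block w (wreg c d) j)) ` {..<w}"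
| "read_addrs w _ c = {}"

fun write_addrs :: "nat \<Rightarrow> instr \<Rightarrow> config \<Rightarrow> nat set" where
  "write_addrs w (Store addr a) c = {take_bit w addr}"
| "write_addrs w (StoreInd a b) c = {reg c a}"
| "write_addrs w (WriteBlock a v i) c = {reg c a}"
| "write_addrs w (WriteWide a v) c = add_bits w (reg c a) ` {..<w}"
| "write_addrs w (Scatter a u v) c = (\<lambda>j. add_bits w (reg c a) (block w (wreg c u) j)) ` {..<w}"
| "write_addrs w _ c = {}"

text \<open>\<open>exec w P c t A B c'\<close>: from \<open>c\<close>, program \<open>P\<close> reaches \<open>c'\<close> in exactly \<open>t\<close> steps, and during
  these steps it reads exactly the addresses in \<open>A\<close> and writes exactly those in \<open>B\<close>.\<close>

inductive exec ::
  "nat \<Rightarrow> program \<Rightarrow> config \<Rightarrow> nat \<Rightarrow> nat set \<Rightarrow> nat set \<Rightarrow> config \<Rightarrow> bool"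
  for w :: nat and P :: program
where
  exec_refl: "exec w P c 0 {} {} c"
| exec_step: "\<lbrakk>pc c < length P; exec_instr w (P ! pc c) c = Some c'; exec w P c' t A B c''\<rbrakk>
    \<Longrightarrow> exec w P c (Suc t) (read_addrs w (P ! pc c) c \<union> A) (write_addrs w (P ! pc c) c \<union> B) c''"

definition halted :: "program \<Rightarrow> config \<Rightarrow> bool" where
  "halted P c \<longleftrightarrow> pc c < length P \<and> P ! pc c = Halt"

text \<open>One symbol per word, \<open>X\<close> at address \<open>0\<close> and \<open>Y\<close> directly after it; the lengths and the
  alphabet size are in the first three registers. All other registers and memory words have
  arbitrary contents.\<close>

definition initial_config :: "nat \<Rightarrow> nat \<Rightarrow> nat list \<Rightarrow> nat list \<Rightarrow> config \<Rightarrow> bool" where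
  "initial_config w \<sigma> X Y c \<longleftrightarrow>
     wf_config w c \<and> pc c = 0 \<and>
     reg c 0 = length X \<and> reg c 1 = length Y \<and> reg c 2 = \<sigma> \<and>
     (\<forall>i < length X. mem c i = X ! i) \<and> (\<forall>j < length Y. mem c (length X + j) = Y ! j)"

text \<open>The input is read-only, and every memory word outside it that is read or written counts as
  additional space.\<close>

definition computes_lcs_length ::
  "nat \<Rightarrow> program \<Rightarrow> nat \<Rightarrow> nat list \<Rightarrow> nat list \<Rightarrow> real \<Rightarrow> real \<Rightarrow> bool" where
  "computes_lcs_length w P \<sigma> X Y time space \<longleftrightarrow>
     (\<forall>c. initial_config w \<sigma> X Y c \<longrightarrow>
       (\<exists>t A B c'. exec w P c t A B c' \<and> halted P c' \<and>
          (\<exists>Z. longest_common_subseq Z X Y \<and> reg c' 0 = length Z) \<and>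
          real t \<le> time \<and>
          B \<inter> {..<length X + length Y} = {} \<and>
          real (card ((A \<union> B) - {..<length X + length Y})) \<le> space))"

text \<open>Every memory change is covered by \<open>write_addrs\<close>.\<close>

lemma exec_instr_mem_unchanged:
  assumes "exec_instr w i c = Some c'" "a \<notin> write_addrs w i c"
  shows "mem c' a = mem c a"
  using assms
  by (cases i) (auto simp: set_reg_def set_wreg_def set_mem_def goto_def write_all_def Let_def
      split: if_splits)

text \<open>The sets are finite, so \<open>card\<close> in \<open>computes_lcs_length\<close> is never applied to an infinite set.\<close>

lemma exec_finite: "exec w P c t A B c' \<Longrightarrow> finite A \<and> finite B"
proof (induction rule: exec.induct)
  case (exec_step c c' t A B c'')
  have "finite (read_addrs w i c)" "finite (write_addrs w i c)" for i
    by (cases i; simp)+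
  with exec_step show ?case by simp
qed simp

text \<open>A contiguous wide write never has a conflict.\<close>

lemma inj_on_contiguous: "inj_on (add_bits w a) {..<w}"
proof (rule inj_onI)
  fix i j assume ij: "i \<in> {..<w}" "j \<in> {..<w}" "add_bits w a i = add_bits w a j"
  have lt: "i < 2 ^ w" "j < 2 ^ w"
    using ij less_exp[of w] by (meson lessThan_iff less_trans)+
  have "[a + i = a + j] (mod 2 ^ w)"
    using ij(3) by (simp add: add_bits_def take_bit_eq_mod cong_def)
  then have "[i = j] (mod 2 ^ w)"
    by (simp only: cong_add_lcancel_nat)
  then show "i = j"
    using lt by (simp add: cong_def)
qed

text \<open>The quantifier over initial configurations in \<open>computes_lcs_length\<close> is not vacuous.\<close>

lemma initial_config_exists:
  assumes "length X + length Y < 2 ^ w" "\<sigma> < 2 ^ w" "set X \<union> set Y \<subseteq> {..<\<sigma>}"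
  shows "\<exists>c. initial_config w \<sigma> X Y c"
proof -
  define r where "r = (\<lambda>i::nat. if i = 0 then length X else if i = 1 then length Y
    else if i = 2 then \<sigma> else 0)"
  define m where "m = (\<lambda>a. if a < length (X @ Y) then (X @ Y) ! a else 0)"
  have "m a < 2 ^ w" for a
  proof (cases "a < length (X @ Y)")
    case True
    then have "(X @ Y) ! a \<in> {..<\<sigma>}"
      using assms(3) nth_mem[of a "X @ Y"] by (metis set_append subsetD)
    moreover have "m a = (X @ Y) ! a"
      using True by (simp add: m_def)
    ultimately show ?thesis using assms(2) by simp
  qed (simp add: m_def)
  moreover have "r i < 2 ^ w" for i
    using assms(1,2) by (simp add: r_def)
  moreover have "\<forall>i < length X. m i = X ! i" "\<forall>j < length Y. m (length X + j) = Y ! j"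
    by (simp_all add: m_def nth_append)
  ultimately have "initial_config w \<sigma> X Y \<lparr>pc = 0, reg = r, wreg = (\<lambda>_. 0), mem = m\<rparr>"
    unfolding initial_config_def wf_config_def by (simp add: r_def)
  then show ?thesis by blast
qed

end

theory Submission
  imports Defs
begin

text \<open>
  Adjacent entries of the table of LCS lengths differ by at most one, and the differences obey
  Boolean recurrences. Hence a column of cells, cell \<open>i\<close> holding the symbol \<open>X ! i\<close> and one
  difference bit, computes the table while \<open>Y\<close> streams through it with one further bit per symbol:
  in each step all cells of an antidiagonal are updated at once. Since each step injects a single
  symbol, no symbol ever has to be replicated. A vector of \<open>q\<close> cells of \<open>b = \<Theta>(log \<sigma>)\<close> bits each
  handles a strip of \<open>q\<close> symbols in \<open>O(n + q)\<close> steps, and the outgoing bits of a strip are the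
  incoming ones of the next.

  If the shorter string fits into a single word, it forms the only strip, the vectors are ordinary
  words, and no additional memory is needed; this matters because the space bound may be below one
  word, while wide registers can communicate with word registers only through memory. Otherwise the
  vectors are wide words with \<open>q = \<Theta>(w\<^sup>2 / b)\<close>, the strips are cut from the longer string, the
  shorter one is streamed, and the boundary bits of a strip occupy \<open>O(min n m / w)\<close> words.
\<close>

section \<open>Structured programs\<close>

text \<open>A strip of \<open>q\<close> cells has latency \<open>q\<close>, so cutting the string of
  length \<open>l\<close> and streaming the one of length \<open>s\<close> costs
  \<open>(l / q + 1) * O(s + q)\<close>. The product \<open>l * s / q\<close> gives the main term,
  as \<open>q * b\<close> is at least half of \<open>w^2\<close>. The only term that is not visibly
  linear is a single \<open>q <= w^2\<close>; it is absorbed because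
  \<open>w = O(log (m + n))\<close> makes \<open>w^2\<close> at most linear in \<open>m + n\<close>.
  The same slack pays for the setup: one fixed program has to find \<open>w\<close>, and the machine
  neither multiplies nor divides and tests only for zero, so all parameters come from counting
  loops. The threshold between the two versions also settles the space bound: if the shorter string
  does not fit into one word, then \<open>s * b > w\<close>, hence
  \<open>s * log \<sigma> / w\<close> is at least \<open>1/3\<close> and pays for the constant
  number of words beyond the boundary bits. An alphabet with one letter is split off, since
  \<open>log \<sigma> = 0\<close> allows neither fields of \<open>O(log \<sigma>)\<close> bits nor
  any additional memory.\<close>

datatype com =
    Blk "instr list"
  | Seq com com (infixr ";;" 60)
  | IfZ nat com com
  | While nat com

fun clen :: "com \<Rightarrow> nat" where
  "clen (Blk is) = length is"
| "clen (Seq c d) = clen c + clen d"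
| "clen (IfZ r c d) = clen c + clen d + 2"
| "clen (While r c) = clen c + 2"

text \<open>Jump targets are absolute, so the code depends on the position \<open>a\<close> of its
  first instruction.\<close>

fun compile :: "nat \<Rightarrow> com \<Rightarrow> program" where
  "compile a (Blk is) = is"
| "compile a (Seq c d) = compile a c @ compile (a + clen c) d"
| "compile a (IfZ r c d) =
     JumpZero r (a + clen d + 2) # compile (Suc a) d @
     Jump (a + clen d + 2 + clen c) # compile (a + clen d + 2) c"
| "compile a (While r c) = JumpZero r (a + clen c + 2) # compile (Suc a) c @ [Jump a]"

lemma length_compile [simp]: "length (compile a c) = clen c"
  by (induction c arbitrary: a) auto

definition code_at :: "program \<Rightarrow> nat \<Rightarrow> program \<Rightarrow> bool" where
  "code_at P a Q \<longleftrightarrow> (\<forall>i < length Q. a + i < length P \<and> P ! (a + i) = Q ! i)"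

lemma code_at_Nil [simp]: "code_at P a []"
  by (simp add: code_at_def)

lemma code_at_Cons [simp]:
  "code_at P a (i # Q) \<longleftrightarrow> a < length P \<and> P ! a = i \<and> code_at P (Suc a) Q"
  unfolding code_at_def
  by (auto simp: less_Suc_eq_0_disj all_conj_distrib)

lemma code_at_append [simp]:
  "code_at P a (Q @ Q') \<longleftrightarrow> code_at P a Q \<and> code_at P (a + length Q) Q'"
  by (induction Q arbitrary: a) auto

text \<open>Straight-line code can be treated without its position because these instructions only
  increment the program counter.\<close>

fun basic :: "instr \<Rightarrow> bool" where
  "basic Halt = False"
| "basic (Jump l) = False"
| "basic (JumpInd a) = False"
| "basic (JumpZero a l) = False"
| "basic _ = True"

lemma exec_instr_pc:
  assumes "basic i"
  shows "exec_instr w i (c\<lparr>pc := a\<rparr>) = map_option (\<lambda>c'. c'\<lparr>pc := Suc a\<rparr>) (exec_instr w i c)"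
  using assms by (cases i) (auto simp: set_reg_def set_wreg_def set_mem_def Let_def)

lemma read_addrs_pc: "read_addrs w i (c\<lparr>pc := a\<rparr>) = read_addrs w i c"
  by (cases i) auto

lemma write_addrs_pc: "write_addrs w i (c\<lparr>pc := a\<rparr>) = write_addrs w i c"
  by (cases i) auto

section \<open>Executions of compiled code and triples\<close>

lemma exec_trans:
  assumes "exec w P c t A B c'" "exec w P c' t' A' B' c''"
  shows "exec w P c (t + t') (A \<union> A') (B \<union> B') c''"
  using assms
proof (induction rule: exec.induct)
  case (exec_step c c1 t A B c2)
  from exec.exec_step[OF exec_step(1,2) exec_step.IH[OF exec_step.prems]] show ?case
    by (simp add: Un_assoc)
qed simp

lemma exec_one:
  assumes "pc c < length P" "exec_instr w (P ! pc c) c = Some c'"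
  shows "exec w P c 1 (read_addrs w (P ! pc c) c) (write_addrs w (P ! pc c) c) c'"
  using exec.exec_step[OF assms exec.exec_refl] by simp

text \<open>The program counter of \<open>c\<close> is overridden by the position of the code, and \<open>Q\<close> is claimed for
  a final configuration with an arbitrary program counter.\<close>

definition triple ::
  "nat \<Rightarrow> com \<Rightarrow> nat \<Rightarrow> nat set \<Rightarrow> nat set \<Rightarrow> config \<Rightarrow> (config \<Rightarrow> bool) \<Rightarrow> bool" where
  "triple w C K R W c Q \<longleftrightarrow>
     (\<forall>P a. code_at P a (compile a C) \<longrightarrow>
       (\<exists>t A B c'. exec w P (c\<lparr>pc := a\<rparr>) t A B (c'\<lparr>pc := a + clen C\<rparr>) \<and>
          t \<le> K \<and> A \<subseteq> R \<and> B \<subseteq> W \<and> Q c'))"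

text \<open>A weakest precondition for straight-line code: on a concrete list the simplifier
  executes one instruction after the other and leaves the address conditions as goals.\<close>

fun runs ::
  "nat \<Rightarrow> nat set \<Rightarrow> nat set \<Rightarrow> instr list \<Rightarrow> config \<Rightarrow> (config \<Rightarrow> bool) \<Rightarrow> bool" where
  "runs w R W [] c Q = Q c"
| "runs w R W (i # is) c Q =
     (basic i \<and> read_addrs w i c \<subseteq> R \<and> write_addrs w i c \<subseteq> W \<and>
      (case exec_instr w i c of None \<Rightarrow> False | Some c' \<Rightarrow> runs w R W is c' Q))"

lemma runs_append: "runs w R W (is @ js) c Q \<longleftrightarrow> runs w R W is c (\<lambda>c'. runs w R W js c' Q)"
  by (induction "is" arbitrary: c) (auto split: option.splits)

lemma runs_mono: "runs w R W is c Q \<Longrightarrow> (\<And>c'. Q c' \<Longrightarrow> Q' c') \<Longrightarrow> runs w R W is c Q'"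
  by (induction "is" arbitrary: c) (auto split: option.splits)

lemma runs_exec:
  assumes "runs w R W is c Q" "code_at P a is"
  shows "\<exists>A B c'. exec w P (c\<lparr>pc := a\<rparr>) (length is) A B (c'\<lparr>pc := a + length is\<rparr>) \<and>
           A \<subseteq> R \<and> B \<subseteq> W \<and> Q c'"
  using assms
proof (induction "is" arbitrary: c a)
  case Nil
  then show ?case using exec.exec_refl by (metis empty_subsetI list.size(3) runs.simps(1) add_0_right)
next
  case (Cons i is')
  from Cons.prems(1) obtain c1 where 1: "basic i" "read_addrs w i c \<subseteq> R" "write_addrs w i c \<subseteq> W"
    "exec_instr w i c = Some c1" "runs w R W is' c1 Q"
    by (auto split: option.splits)
  from Cons.IH[OF 1(5), of "Suc a"] Cons.prems(2) obtain A B c' where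
    2: "exec w P (c1\<lparr>pc := Suc a\<rparr>) (length is') A B (c'\<lparr>pc := Suc a + length is'\<rparr>)"
      "A \<subseteq> R" "B \<subseteq> W" "Q c'" by auto
  have e: "exec_instr w (P ! pc (c\<lparr>pc := a\<rparr>)) (c\<lparr>pc := a\<rparr>) = Some (c1\<lparr>pc := Suc a\<rparr>)"
    using 1 Cons.prems(2) by (simp add: exec_instr_pc)
  have l: "pc (c\<lparr>pc := a\<rparr>) < length P" using Cons.prems(2) by simp
  have "exec w P (c\<lparr>pc := a\<rparr>) (length (i # is')) (read_addrs w i c \<union> A) (write_addrs w i c \<union> B)
      (c'\<lparr>pc := a + length (i # is')\<rparr>)"
    using exec.exec_step[OF l e 2(1)] Cons.prems(2) by (simp add: read_addrs_pc write_addrs_pc)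
  moreover have "read_addrs w i c \<union> A \<subseteq> R" "write_addrs w i c \<union> B \<subseteq> W"
    using 1 2 by auto
  ultimately show ?case using 2(4) by blast
qed

lemma triple_Blk:
  assumes "runs w R W is c Q" "length is \<le> K"
  shows "triple w (Blk is) K R W c Q"
  unfolding triple_def
proof (intro allI impI)
  fix P a assume "code_at P a (compile a (Blk is))"
  then have "code_at P a is" by simp
  from runs_exec[OF assms(1) this] assms(2)
  show "\<exists>t A B c'. exec w P (c\<lparr>pc := a\<rparr>) t A B (c'\<lparr>pc := a + clen (Blk is)\<rparr>) \<and>
          t \<le> K \<and> A \<subseteq> R \<and> B \<subseteq> W \<and> Q c'"
    by auto
qed

lemma triple_mono:
  assumes "triple w C K R W c Q" "K \<le> K'" "R \<subseteq> R'" "W \<subseteq> W'" "\<And>c'. Q c' \<Longrightarrow> Q' c'"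
  shows "triple w C K' R' W' c Q'"
  unfolding triple_def
proof (intro allI impI)
  fix P a assume "code_at P a (compile a C)"
  with assms(1) obtain t A B c' where "exec w P (c\<lparr>pc := a\<rparr>) t A B (c'\<lparr>pc := a + clen C\<rparr>)"
    "t \<le> K" "A \<subseteq> R" "B \<subseteq> W" "Q c'" unfolding triple_def by blast
  with assms(2-) show "\<exists>t A B c'. exec w P (c\<lparr>pc := a\<rparr>) t A B (c'\<lparr>pc := a + clen C\<rparr>) \<and>
          t \<le> K' \<and> A \<subseteq> R' \<and> B \<subseteq> W' \<and> Q' c'"
    by (meson order_trans)
qed

lemma triple_Seq:
  assumes "triple w C K R W c Q" "\<And>c'. Q c' \<Longrightarrow> triple w D K' R W c' Q'" "K + K' \<le> K''"
  shows "triple w (C ;; D) K'' R W c Q'"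
  unfolding triple_def
proof (intro allI impI)
  fix P a assume "code_at P a (compile a (C ;; D))"
  then have 1: "code_at P a (compile a C)" "code_at P (a + clen C) (compile (a + clen C) D)" by auto
  from assms(1) 1(1) obtain t A B c' where
    2: "exec w P (c\<lparr>pc := a\<rparr>) t A B (c'\<lparr>pc := a + clen C\<rparr>)" "t \<le> K" "A \<subseteq> R" "B \<subseteq> W" "Q c'"
    unfolding triple_def by blast
  from assms(2)[OF 2(5)] 1(2) obtain t' A' B' c'' where
    3: "exec w P (c'\<lparr>pc := a + clen C\<rparr>) t' A' B' (c''\<lparr>pc := a + clen C + clen D\<rparr>)"
      "t' \<le> K'" "A' \<subseteq> R" "B' \<subseteq> W" "Q' c''"
    unfolding triple_def by blast
  have "t + t' \<le> K''" using 2 3 assms(3) by linarith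
  with exec_trans[OF 2(1) 3(1)] 2 3
  show "\<exists>t A B c'. exec w P (c\<lparr>pc := a\<rparr>) t A B (c'\<lparr>pc := a + clen (C ;; D)\<rparr>) \<and>
          t \<le> K'' \<and> A \<subseteq> R \<and> B \<subseteq> W \<and> Q' c'"
    by (metis Un_least add.assoc clen.simps(2))
qed

text \<open>The two additional steps are the test and, on the nonzero side, the jump over the other
  branch.\<close>

lemma triple_IfZ:
  assumes "reg c r = 0 \<Longrightarrow> triple w C K R W c Q" "reg c r \<noteq> 0 \<Longrightarrow> triple w D K R W c Q"
    and "K + 2 \<le> K'"
  shows "triple w (IfZ r C D) K' R W c Q"
  unfolding triple_def
proof (intro allI impI)
  fix P a assume ca: "code_at P a (compile a (IfZ r C D))"
  show "\<exists>t A B c'. exec w P (c\<lparr>pc := a\<rparr>) t A B (c'\<lparr>pc := a + clen (IfZ r C D)\<rparr>) \<and>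
          t \<le> K' \<and> A \<subseteq> R \<and> B \<subseteq> W \<and> Q c'"
  proof (cases "reg c r = 0")
    case True
    have "exec w P (c\<lparr>pc := a\<rparr>) 1 {} {} (c\<lparr>pc := a + clen D + 2\<rparr>)"
      using exec_one[of "c\<lparr>pc := a\<rparr>" P w "c\<lparr>pc := a + clen D + 2\<rparr>"] ca True
      by (simp add: goto_def)
    moreover obtain t A B c' where
      "exec w P (c\<lparr>pc := a + clen D + 2\<rparr>) t A B (c'\<lparr>pc := a + clen D + 2 + clen C\<rparr>)"
      "t \<le> K" "A \<subseteq> R" "B \<subseteq> W" "Q c'"
    proof -
      have "code_at P (a + clen D + 2) (compile (a + clen D + 2) C)" using ca by simp
      with assms(1)[OF True] that show ?thesis unfolding triple_def by blast
    qed
    ultimately show ?thesis using assms(3)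
      by (intro exI[of _ "1 + t"] exI[of _ A] exI[of _ B] exI[of _ c'])
        (auto dest: exec_trans simp: algebra_simps)
  next
    case False
    have 1: "exec w P (c\<lparr>pc := a\<rparr>) 1 {} {} (c\<lparr>pc := Suc a\<rparr>)"
      using exec_one[of "c\<lparr>pc := a\<rparr>" P w "c\<lparr>pc := Suc a\<rparr>"] ca False
      by (simp add: goto_def)
    obtain t A B c' where
      2: "exec w P (c\<lparr>pc := Suc a\<rparr>) t A B (c'\<lparr>pc := Suc a + clen D\<rparr>)"
      "t \<le> K" "A \<subseteq> R" "B \<subseteq> W" "Q c'"
    proof -
      have "code_at P (Suc a) (compile (Suc a) D)" using ca by simp
      with assms(2)[OF False] that show ?thesis unfolding triple_def by blast
    qed
    have 3: "exec w P (c'\<lparr>pc := Suc a + clen D\<rparr>) 1 {} {} (c'\<lparr>pc := a + clen D + 2 + clen C\<rparr>)"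
      using exec_one[of "c'\<lparr>pc := Suc a + clen D\<rparr>" P w "c'\<lparr>pc := a + clen D + 2 + clen C\<rparr>"] ca
      by (simp add: goto_def)
    from exec_trans[OF exec_trans[OF 1 2(1)] 3] 2 assms(3) show ?thesis
      by (intro exI[of _ "1 + t + 1"] exI[of _ A] exI[of _ B] exI[of _ c'])
        (auto simp: algebra_simps)
  qed
qed

text \<open>Indexing the invariant by the exact number of remaining iterations yields termination
  and the step count together. An iteration adds a test and a jump back to the body; the failing
  test adds the last step.\<close>

lemma triple_While:
  assumes "Inv i c"
    and body: "\<And>i c. Inv (Suc i) c \<Longrightarrow> reg c r \<noteq> 0 \<and> triple w C K R W c (Inv i)"
    and exit: "\<And>c. Inv 0 c \<Longrightarrow> reg c r = 0"
    and "i * (K + 2) + 1 \<le> K'"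
  shows "triple w (While r C) K' R W c (Inv 0)"
proof -
  have "triple w (While r C) (i * (K + 2) + 1) R W c (Inv 0)" if "Inv i c" for i c
    unfolding triple_def
  proof (intro allI impI)
    fix P a assume ca: "code_at P a (compile a (While r C))"
    from that show "\<exists>t A B c'. exec w P (c\<lparr>pc := a\<rparr>) t A B (c'\<lparr>pc := a + clen (While r C)\<rparr>) \<and>
          t \<le> i * (K + 2) + 1 \<and> A \<subseteq> R \<and> B \<subseteq> W \<and> Inv 0 c'"
    proof (induction i arbitrary: c)
      case 0
      have "exec w P (c\<lparr>pc := a\<rparr>) 1 {} {} (c\<lparr>pc := a + clen (While r C)\<rparr>)"
        using exec_one[of "c\<lparr>pc := a\<rparr>" P w "c\<lparr>pc := a + clen C + 2\<rparr>"] ca exit[OF 0]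
        by (simp add: goto_def)
      with 0 show ?case by fastforce
    next
      case (Suc i)
      have ne: "reg c r \<noteq> 0" and tr: "triple w C K R W c (Inv i)" using body[OF Suc.prems] by auto
      have 1: "exec w P (c\<lparr>pc := a\<rparr>) 1 {} {} (c\<lparr>pc := Suc a\<rparr>)"
        using exec_one[of "c\<lparr>pc := a\<rparr>" P w "c\<lparr>pc := Suc a\<rparr>"] ca ne
        by (simp add: goto_def)
      obtain t A B c' where
        2: "exec w P (c\<lparr>pc := Suc a\<rparr>) t A B (c'\<lparr>pc := Suc a + clen C\<rparr>)"
        "t \<le> K" "A \<subseteq> R" "B \<subseteq> W" "Inv i c'"
      proof -
        have "code_at P (Suc a) (compile (Suc a) C)" using ca by simp
        with tr that show ?thesis unfolding triple_def by blast
      qed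
      have 3: "exec w P (c'\<lparr>pc := Suc a + clen C\<rparr>) 1 {} {} (c'\<lparr>pc := a\<rparr>)"
        using exec_one[of "c'\<lparr>pc := Suc a + clen C\<rparr>" P w "c'\<lparr>pc := a\<rparr>"] ca
        by (simp add: goto_def)
      obtain t' A' B' c'' where
        4: "exec w P (c'\<lparr>pc := a\<rparr>) t' A' B' (c''\<lparr>pc := a + clen (While r C)\<rparr>)"
          "t' \<le> i * (K + 2) + 1" "A' \<subseteq> R" "B' \<subseteq> W" "Inv 0 c''"
        using Suc.IH[OF 2(5)] by blast
      from exec_trans[OF exec_trans[OF exec_trans[OF 1 2(1)] 3] 4(1)] 2 4 show ?case
        by (intro exI[of _ "1 + t + 1 + t'"] exI[of _ "A \<union> A'"] exI[of _ "B \<union> B'"] exI[of _ c''])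
          auto
    qed
  qed
  from triple_mono[OF this[OF assms(1)] assms(4) subset_refl subset_refl] show ?thesis by blast
qed

section \<open>Register updates and word arithmetic without overflow\<close>

lemma reg_set [simp]:
  "reg (set_reg d x c) = (reg c)(d := x)" "reg (set_wreg d v c) = reg c" "reg (set_mem f c) = reg c"
  and wreg_set [simp]:
  "wreg (set_reg d x c) = wreg c" "wreg (set_wreg d v c) = (wreg c)(d := v)"
  "wreg (set_mem f c) = wreg c"
  and mem_set [simp]:
  "mem (set_reg d x c) = mem c" "mem (set_wreg d v c) = mem c" "mem (set_mem f c) = f"
  by (simp_all add: set_reg_def set_wreg_def set_mem_def)

lemma add_bits_eq: "x + y < 2 ^ b \<Longrightarrow> add_bits b x y = x + y"
  by (simp add: add_bits_def take_bit_nat_eq_self)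

lemma sub_bits_eq:
  assumes "y \<le> x" "x < 2 ^ b"
  shows "sub_bits b x y = x - y"
proof -
  have "x + 2 ^ b - y = (x - y) + 2 ^ b" using assms(1) by simp
  then have "sub_bits b x y = (x - y) mod 2 ^ b"
    by (simp only: sub_bits_def take_bit_eq_mod mod_add_self2)
  then show ?thesis using assms(2) by simp
qed

lemma sub_bits_self [simp]: "sub_bits b x x = 0"
  by (simp add: sub_bits_def take_bit_eq_mod)

section \<open>Vectors of bit fields\<close>

text \<open>As a plain sum this is additive without any bound on the fields; only the bit-level
  lemmas require every field to fit into \<open>b\<close> bits.\<close>

definition pack :: "nat \<Rightarrow> nat \<Rightarrow> (nat \<Rightarrow> nat) \<Rightarrow> nat" where
  "pack b q f = (\<Sum>k<q. f k * 2 ^ (k * b))"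

definition flags :: "nat \<Rightarrow> nat \<Rightarrow> (nat \<Rightarrow> bool) \<Rightarrow> nat" where
  "flags b q f = pack b q (\<lambda>k. of_bool (f k))"

lemma pack_0 [simp]: "pack b 0 f = 0"
  by (simp add: pack_def)

lemma pack_Suc: "pack b (Suc q) f = pack b q f + push_bit (q * b) (f q)"
  by (simp add: pack_def push_bit_eq_mult)

lemma pack_add: "pack b q f + pack b q g = pack b q (\<lambda>k. f k + g k)"
  by (simp add: pack_def sum.distrib add_mult_distrib)

lemma pack_less: "(\<And>k. k < q \<Longrightarrow> f k < 2 ^ b) \<Longrightarrow> pack b q f < 2 ^ (q * b)"
proof (induction q)
  case (Suc q)
  have "pack b (Suc q) f < 2 ^ (q * b) + f q * 2 ^ (q * b)"
    using Suc by (simp add: pack_def)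
  also have "\<dots> = Suc (f q) * 2 ^ (q * b)" by simp
  also have "\<dots> \<le> 2 ^ b * 2 ^ (q * b)"
    using Suc.prems[of q] by (intro mult_right_mono) auto
  finally show ?case by (simp add: power_add)
qed simp

lemma not_bit_of_less: "x < 2 ^ b \<Longrightarrow> b \<le> n \<Longrightarrow> \<not> bit (x :: nat) n"
  by (metis bit_take_bit_iff not_less take_bit_nat_eq_self)

text \<open>Field \<open>q\<close> starts where the packed lower fields end, so the sum is a
  disjoint union of bits and can be replaced by \<open>or\<close>.\<close>

lemma bit_pack:
  assumes "0 < b" "\<And>k. k < q \<Longrightarrow> f k < 2 ^ b"
  shows "bit (pack b q f) n \<longleftrightarrow> n div b < q \<and> bit (f (n div b)) (n mod b)"
  using assms(2)
proof (induction q)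
  case (Suc q)
  have lt: "pack b q f < 2 ^ (q * b)" using Suc.prems by (intro pack_less) auto
  have "and (pack b q f) (push_bit (q * b) (f q)) = 0"
    by (rule bit_eqI) (use not_bit_of_less[OF lt] in \<open>auto simp: bit_and_iff bit_push_bit_iff\<close>)
  then have "pack b (Suc q) f = or (pack b q f) (push_bit (q * b) (f q))"
    by (simp add: pack_Suc disjunctive_add_eq_or)
  then have 1: "bit (pack b (Suc q) f) n \<longleftrightarrow>
      n div b < q \<and> bit (f (n div b)) (n mod b) \<or> q * b \<le> n \<and> bit (f q) (n - q * b)"
    using Suc by (auto simp: bit_or_iff bit_push_bit_iff)
  have 2: "q * b \<le> n \<and> bit (f q) (n - q * b) \<longleftrightarrow> n div b = q \<and> bit (f q) (n mod b)"
  proof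
    assume a: "q * b \<le> n \<and> bit (f q) (n - q * b)"
    then have "n - q * b < b" using not_bit_of_less[of "f q" b "n - q * b"] Suc.prems[of q] by force
    moreover from a have n: "n = (n - q * b) + q * b" by simp
    ultimately have "n div b = q" "n mod b = n - q * b"
      by (metis add.commute add.right_neutral assms(1) div_less div_mult_self3 less_nat_zero_code,
          metis mod_less mod_mult_self1)
    with a show "n div b = q \<and> bit (f q) (n mod b)" by simp
  next
    assume a: "n div b = q \<and> bit (f q) (n mod b)"
    then have "n = q * b + n mod b" by (metis div_mult_mod_eq)
    with a show "q * b \<le> n \<and> bit (f q) (n - q * b)" by (metis add_diff_cancel_left' le_add1)
  qed
  show ?case unfolding 1 2 by (auto simp: less_Suc_eq)
qed simp

lemma of_bool_less: "0 < b \<Longrightarrow> of_bool P < (2::nat) ^ b"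
  using one_less_power[of "2::nat" b] by (cases P) auto

lemma bit_flags:
  assumes "0 < b"
  shows "bit (flags b q f) n \<longleftrightarrow> n div b < q \<and> n mod b = 0 \<and> f (n div b)"
proof -
  have *: "of_bool (f k) < (2::nat) ^ b" for k using assms by (rule of_bool_less)
  show ?thesis unfolding flags_def by (subst bit_pack[OF assms *]) (auto simp: bit_simps)
qed

lemma flags_less: "0 < b \<Longrightarrow> flags b q f < 2 ^ (q * b)"
  unfolding flags_def by (rule pack_less) (rule of_bool_less)

text \<open>\<open>x\<close> and its complement within the mask are disjoint and add up to the mask,
  which turns the subtraction into a bitwise operation.\<close>

lemma bit_not_bits:
  assumes "x < 2 ^ N"
  shows "bit (not_bits N x) n \<longleftrightarrow> n < N \<and> \<not> bit x n"
proof -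
  have x: "take_bit N x = x" using assms by (simp add: take_bit_nat_eq_self)
  have "and x (and (xor x (mask N)) (mask N)) = 0"
    by (rule bit_eqI) (auto simp: bit_simps)
  then have "x + and (xor x (mask N)) (mask N) = or x (and (xor x (mask N)) (mask N))"
    by (rule disjunctive_add_eq_or)
  also have "\<dots> = mask N"
    using not_bit_of_less[OF assms] by (intro bit_eqI) (auto simp: bit_simps intro: leI)
  finally have "not_bits N x = and (xor x (mask N)) (mask N)"
    by (simp add: not_bits_def)
  then show ?thesis by (auto simp: bit_simps)
qed

lemma not_bits_less [simp]: "not_bits N x < 2 ^ N"
  by (simp add: not_bits_def mask_eq_exp_minus_1 less_imp_diff_less)

lemma less_of_bits: "(\<And>n. bit x n \<Longrightarrow> n < N) \<Longrightarrow> (x :: nat) < 2 ^ N"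
proof -
  assume a: "\<And>n. bit x n \<Longrightarrow> n < N"
  have "take_bit N x = x" by (rule bit_eqI) (use a in \<open>auto simp: bit_take_bit_iff\<close>)
  then show ?thesis by (metis take_bit_nat_less_exp)
qed

lemma bit_shl_bits: "bit (shl_bits N x s) n \<longleftrightarrow> n < N \<and> s \<le> n \<and> bit x (n - s)"
  by (simp add: shl_bits_def bit_simps)

lemma bit_shr_bits: "bit (shr_bits x s) n \<longleftrightarrow> bit x (s + n)"
  by (simp add: shr_bits_def bit_simps)

lemma shl_bits_less [simp]: "shl_bits N x s < 2 ^ N"
  by (simp add: shl_bits_def)

lemma or_less: "x < 2 ^ N \<Longrightarrow> y < 2 ^ N \<Longrightarrow> or x y < (2 :: nat) ^ N"
  by (metis or_nat_def take_bit_nat_eq_self take_bit_nat_less_exp take_bit_or)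

section \<open>Vector operations: moving, updating, comparing and loading cells\<close>

lemma sub_div_mod:
  assumes "0 < (b::nat)"
  shows "b \<le> n \<Longrightarrow> (n - b) div b = n div b - 1" "b \<le> n \<Longrightarrow> (n - b) mod b = n mod b"
    "b \<le> n \<longleftrightarrow> n div b \<noteq> 0"
  using assms by (auto simp: le_div_geq le_mod_geq div_eq_0_iff not_less)

text \<open>The conjunction with the all-true flags removes the flag that the shift pushes out of
  the last field; truncation to \<open>N\<close> bits alone would keep it if the register is longer
  than the vector.\<close>

lemma flags_shift:
  assumes "0 < b" "0 < q" "q * b \<le> N"
  shows "or (and (shl_bits N (flags b q p) b) (flags b q (\<lambda>_. True))) (of_bool v) =
    flags b q (\<lambda>k. if k = 0 then v else p (k - 1))"
proof (rule bit_eqI)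
  fix n
  have "n div b < q \<Longrightarrow> n < N" using assms by (auto simp: div_less_iff_less_mult)
  moreover have "n = 0 \<longleftrightarrow> n div b = 0 \<and> n mod b = 0"
    by (metis div_mult_mod_eq add_0_right mult_0 div_0 mod_0)
  ultimately show "bit (or (and (shl_bits N (flags b q p) b) (flags b q (\<lambda>_. True))) (of_bool v)) n =
      bit (flags b q (\<lambda>k. if k = 0 then v else p (k - 1))) n"
    using assms(1,2) sub_div_mod[OF assms(1), of n]
    by (auto simp: bit_or_iff bit_and_iff bit_shl_bits bit_flags bit_of_bool_iff)
qed

text \<open>Only the low \<open>q * b\<close> bits are described: symbols pushed out of the last
  field remain above it as garbage, which \<open>flags_eq\<close> tolerates.\<close>

lemma pack_shift:
  assumes "0 < b" "0 < q" "q * b \<le> N" "take_bit (q * b) Y = pack b q y"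
    and "\<And>k. k < q \<Longrightarrow> y k < 2 ^ b" "v < 2 ^ b"
  shows "take_bit (q * b) (or (shl_bits N Y b) v) = pack b q (\<lambda>k. if k = 0 then v else y (k - 1))"
proof (rule bit_eqI)
  fix n
  have "n div b < q \<longleftrightarrow> n < q * b" using assms by (simp add: div_less_iff_less_mult)
  moreover have "bit Y i \<longleftrightarrow> i div b < q \<and> bit (y (i div b)) (i mod b)" if "i < q * b" for i
    using arg_cong[OF assms(4), of "\<lambda>x. bit x i"] that assms(1,5)
    by (simp add: bit_take_bit_iff bit_pack)
  moreover have "bit v n \<longleftrightarrow> n div b = 0 \<and> bit v (n mod b)"
  proof (cases "n < b")
    case False
    then have "n div b \<noteq> 0" using assms(1) by (simp add: div_eq_0_iff)
    then show ?thesis using not_bit_of_less[OF assms(6), of n] False by simp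
  qed (use assms(1) in simp)
  moreover have "(if k = 0 then v else y (k - 1)) < 2 ^ b" if "k < q" for k
    using assms(5)[of "k - 1"] assms(6) that by simp
  ultimately show "bit (take_bit (q * b) (or (shl_bits N Y b) v)) n =
      bit (pack b q (\<lambda>k. if k = 0 then v else y (k - 1))) n"
    using assms(1-3) sub_div_mod[OF assms(1), of n]
    by (cases "n div b = 0") (auto simp: bit_pack bit_take_bit_iff bit_or_iff bit_shl_bits)
qed

text \<open>Nothing lies above the last field of a flag vector, so one shift isolates its flag,
  ready to be moved to a word register.\<close>

lemma flags_extract:
  assumes "0 < b" "0 < q"
  shows "shr_bits (flags b q p) ((q - 1) * b) = of_bool (p (q - 1))"
proof (rule bit_eqI)
  fix n
  obtain r where q: "q = Suc r" using assms(2) by (cases q) auto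
  have *: "(r * b + n) div b = r + n div b" "(r * b + n) mod b = n mod b"
    using assms(1) by simp_all
  have "bit (shr_bits (flags b q p) (r * b)) n \<longleftrightarrow> n div b = 0 \<and> n mod b = 0 \<and> p r"
    unfolding bit_shr_bits bit_flags[OF assms(1)] * q by auto
  also have "n div b = 0 \<and> n mod b = 0 \<and> p r \<longleftrightarrow> n = 0 \<and> p r"
    by (metis div_mult_mod_eq add_0_right mult_0 div_0 mod_0)
  finally show "bit (shr_bits (flags b q p) ((q - 1) * b)) n = bit (of_bool (p (q - 1)) :: nat) n"
    by (auto simp: q bit_of_bool_iff)
qed

text \<open>The complement has ones between the flags and above the vector, but the conjunction with
  a flag vector removes them without a further mask.\<close>

lemma flags_cell_x:
  assumes "0 < b" "q * b \<le> N"
  shows "and (or (flags b q e) (flags b q a)) (not_bits N (flags b q p)) =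
    flags b q (\<lambda>k. (e k \<or> a k) \<and> \<not> p k)"
proof (rule bit_eqI)
  fix n
  have "flags b q p < 2 ^ N"
    using flags_less[OF assms(1)] power_increasing[OF assms(2), of "2::nat"]
    by (meson le_less_trans less_le_trans one_le_numeral)
  moreover have "n div b < q \<Longrightarrow> n < N" using assms by (auto simp: div_less_iff_less_mult)
  ultimately show "bit (and (or (flags b q e) (flags b q a)) (not_bits N (flags b q p))) n =
    bit (flags b q (\<lambda>k. (e k \<or> a k) \<and> \<not> p k)) n"
    using assms(1) by (auto simp: bit_and_iff bit_or_iff bit_flags bit_not_bits)
qed

text \<open>Two instructions put the constant into every field. No borrow crosses a field boundary,
  because each field of the minuend is at least \<open>1\<close>; the proof reverses the subtraction
  into an addition of vectors.\<close>

lemma pack_low_mask: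
  assumes b: "0 < b" "q * b \<le> N"
  shows "sub_bits N (shl_bits N (flags b q (\<lambda>_. True)) (b - 1)) (flags b q (\<lambda>_. True)) =
    pack b q (\<lambda>_. 2 ^ (b - 1) - 1)"
proof -
  have pow: "2 ^ (b - 1) * 2 = (2::nat) ^ b" using assms(1) by (metis power_minus_mult)
  have le: "(2::nat) ^ (q * b) \<le> 2 ^ N" using assms(2) by simp
  have push: "push_bit (b - 1) (flags b q (\<lambda>_. True)) = pack b q (\<lambda>_. 2 ^ (b - 1))"
    by (simp add: flags_def pack_def push_bit_eq_mult sum_distrib_left mult.commute)
  have "pack b q (\<lambda>_. 2 ^ (b - 1)) < 2 ^ (q * b)" by (rule pack_less) (use b in auto)
  then have shl: "shl_bits N (flags b q (\<lambda>_. True)) (b - 1) = pack b q (\<lambda>_. 2 ^ (b - 1))"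
    and lt: "pack b q (\<lambda>_. 2 ^ (b - 1)) < 2 ^ N"
    using le unfolding shl_bits_def push by (simp_all only: take_bit_nat_eq_self less_le_trans)
  have "pack b q (\<lambda>_. 2 ^ (b - 1) - 1) + flags b q (\<lambda>_. True) = pack b q (\<lambda>_. 2 ^ (b - 1))"
    unfolding flags_def pack_add by simp
  moreover from this lt have "sub_bits N (pack b q (\<lambda>_. 2 ^ (b - 1))) (flags b q (\<lambda>_. True)) =
      pack b q (\<lambda>_. 2 ^ (b - 1)) - flags b q (\<lambda>_. True)"
    by (simp add: sub_bits_def take_bit_eq_mod)
       (metis Nat.add_diff_assoc2 add.commute le_add2 less_imp_diff_less mod_add_self2 mod_less)
  ultimately show ?thesis unfolding shl by linarith
qed

text \<open>Adding \<open>2 ^ (b - 1) - 1\<close> to the low \<open>b - 1\<close> bits of a field sets its top bit iff one of them is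
  set, and no carry leaves the field; hence the top bit of \<open>S\<close> tells whether the fields of \<open>Z\<close>
  (the exclusive or) are nonzero.\<close>

lemma flags_eq:
  assumes b: "0 < b" "q * b \<le> N" and x: "\<And>k. k < q \<Longrightarrow> x k < 2 ^ b" "\<And>k. k < q \<Longrightarrow> y k < 2 ^ b"
    and Y: "take_bit (q * b) Y = pack b q y" "Y < 2 ^ N"
    and Z: "Z = or (and (pack b q x) (not_bits N Y)) (and (not_bits N (pack b q x)) Y)"
    and M: "M = pack b q (\<lambda>_. 2 ^ (b - 1) - 1)"
    and S: "S = or (add_bits N (and Z M) M) Z"
  shows "and (not_bits N (shr_bits S (b - 1))) (flags b q (\<lambda>_. True)) = flags b q (\<lambda>k. x k = y k)"
proof -
  have pow: "2 ^ (b - 1) * 2 = (2::nat) ^ b" using assms(1) by (metis power_minus_mult)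
  have le: "(2::nat) ^ (q * b) \<le> 2 ^ N" using assms(2) by simp
  have X: "pack b q x < 2 ^ N" using pack_less[of q x b, OF x(1)] le by (meson less_le_trans)
  have in_N: "n div b < q \<longleftrightarrow> n < q * b" for n using b by (simp add: div_less_iff_less_mult)
  define z where "z = (\<lambda>k. xor (x k) (y k))"
  have z: "z k < 2 ^ b" if "k < q" for k
    using x[OF that] unfolding z_def by (metis take_bit_nat_eq_self take_bit_nat_less_exp take_bit_xor)
  have bitY: "bit Y n \<longleftrightarrow> bit (y (n div b)) (n mod b)" if "n div b < q" for n
    using arg_cong[OF Y(1), of "\<lambda>x. bit x n"] that b x(2) in_N
    by (simp add: bit_take_bit_iff bit_pack)
  have bitZ: "bit Z n \<longleftrightarrow> bit (z (n div b)) (n mod b)" if "n div b < q" for n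
    unfolding Z z_def using that b in_N[of n]
    by (auto simp: bit_simps bit_not_bits X Y(2) bitY bit_pack[OF b(1) x(1)])
  have Mlt: "2 ^ (b - 1) - 1 < (2::nat) ^ b" using pow one_le_power[of "2::nat" "b - 1"] by linarith
  have "M = pack b q (\<lambda>_. mask (b - 1))" by (simp add: M mask_eq_exp_minus_1)
  moreover have "mask (b - 1) < (2::nat) ^ b" using Mlt by (simp add: mask_eq_exp_minus_1)
  ultimately have bitM: "bit M n \<longleftrightarrow> n div b < q \<and> n mod b < b - 1" for n
    by (simp add: bit_pack[OF b(1)] bit_mask_iff)
  have ZM: "and Z M = pack b q (\<lambda>k. take_bit (b - 1) (z k))"
  proof (rule bit_eqI)
    fix n
    have *: "take_bit (b - 1) (z k) < 2 ^ b" for k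
      using take_bit_nat_less_exp[of "b - 1" "z k"] pow by linarith
    have "n mod b < b" using b by simp
    then show "bit (and Z M) n = bit (pack b q (\<lambda>k. take_bit (b - 1) (z k))) n"
      using bitZ[of n] by (subst bit_pack[OF b(1) *]) (auto simp: bit_and_iff bitM bit_take_bit_iff)
  qed
  define s where "s = (\<lambda>k. take_bit (b - 1) (z k) + (2 ^ (b - 1) - 1))"
  have s: "s k < 2 ^ b" for k
    using take_bit_nat_less_exp[of "b - 1" "z k"] pow unfolding s_def by linarith
  have ZM_M: "and Z M + M = pack b q s"
    unfolding ZM unfolding M s_def pack_add ..
  have "pack b q s < 2 ^ N" using pack_less[of q s b] s le by (meson less_le_trans)
  then have add: "add_bits N (and Z M) M = pack b q s"
    by (simp add: add_bits_def ZM_M take_bit_nat_eq_self)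
  have top: "bit (s k) (b - 1) \<longleftrightarrow> take_bit (b - 1) (z k) \<noteq> 0" for k
  proof -
    have "bit (s k) (b - 1) \<longleftrightarrow> 2 ^ (b - 1) \<le> s k"
    proof
      assume "bit (s k) (b - 1)"
      then show "2 ^ (b - 1) \<le> s k" using not_bit_of_less[of "s k" "b - 1" "b - 1"] by force
    next
      assume a: "2 ^ (b - 1) \<le> s k"
      have "s k div 2 ^ (b - 1) = 1"
        using a s[of k] pow by (intro div_nat_eqI) auto
      then show "bit (s k) (b - 1)" by (simp add: bit_iff_odd)
    qed
    also have "\<dots> \<longleftrightarrow> take_bit (b - 1) (z k) \<noteq> 0"
    proof -
      have "H \<le> t + (H - 1) \<longleftrightarrow> t \<noteq> 0" if "1 \<le> H" for H t :: nat using that by arith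
      then show ?thesis unfolding s_def by simp
    qed
    finally show ?thesis .
  qed
  have zero: "z k = 0 \<longleftrightarrow> take_bit (b - 1) (z k) = 0 \<and> \<not> bit (z k) (b - 1)" if "k < q" for k
  proof
    assume a: "take_bit (b - 1) (z k) = 0 \<and> \<not> bit (z k) (b - 1)"
    show "z k = 0"
    proof (rule bit_eqI)
      fix n
      consider "n < b - 1" | "n = b - 1" | "b \<le> n" by linarith
      then show "bit (z k) n = bit 0 n"
      proof cases
        case 1
        then show ?thesis using arg_cong[OF conjunct1[OF a], of "\<lambda>x. bit x n"]
          by (simp add: bit_take_bit_iff)
      qed (use a not_bit_of_less[OF z[OF that]] in auto)
    qed
  qed simp
  have Slt: "shr_bits S (b - 1) < 2 ^ N"
  proof (rule less_of_bits)
    fix n assume "bit (shr_bits S (b - 1)) n"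
    then have "bit S (b - 1 + n)" by (simp add: bit_shr_bits)
    moreover have "S < 2 ^ N" unfolding S add
    proof (rule or_less)
      show "Z < 2 ^ N" unfolding Z
        using not_bit_of_less[OF X] not_bit_of_less[OF Y(2)]
        by (intro less_of_bits) (auto simp: bit_simps not_less[symmetric])
    qed fact
    ultimately show "n < N" using not_bit_of_less[of S N "b - 1 + n"] by force
  qed
  show ?thesis
  proof (rule bit_eqI)
    fix n
    show "bit (and (not_bits N (shr_bits S (b - 1))) (flags b q (\<lambda>_. True))) n =
      bit (flags b q (\<lambda>k. x k = y k)) n"
    proof (cases "n div b < q \<and> n mod b = 0")
      case True
      then obtain m where n: "n = m * b" by (metis add_0_right div_mult_mod_eq)
      \<comment> \<open>The right shift moves the top bit of a field to the lowest position of the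
        same field, where the flag mask selects it.\<close>
      have *: "(b - 1 + n) div b = n div b" "(b - 1 + n) mod b = b - 1"
        unfolding n using b(1) div_mult_self1[of b "b - 1" m] mod_mult_self1[of "b - 1" m b]
        by (simp_all del: mod_mult_self1 div_mult_self1)
      have "bit (shr_bits S (b - 1)) n \<longleftrightarrow> bit (s (n div b)) (b - 1) \<or> bit (z (n div b)) (b - 1)"
        unfolding bit_shr_bits S add bit_or_iff bit_pack[OF b(1) s] *
        using bitZ[of "b - 1 + n"] True unfolding * by auto
      also have "\<dots> \<longleftrightarrow> z (n div b) \<noteq> 0"
        unfolding top using zero[of "n div b"] True by auto
      also have "\<dots> \<longleftrightarrow> x (n div b) \<noteq> y (n div b)"
        unfolding z_def by (auto simp: bit_eq_iff[of "xor _ _"] bit_eq_iff[of "x _"] bit_xor_iff)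
      finally have "bit (shr_bits S (b - 1)) n \<longleftrightarrow> x (n div b) \<noteq> y (n div b)" .
      moreover have "n < N" using True in_N b by (meson less_le_trans)
      ultimately show ?thesis using True
        unfolding bit_and_iff bit_not_bits[OF Slt] bit_flags[OF b(1)] by blast
    qed (use b in \<open>auto simp: bit_and_iff bit_flags\<close>)
  qed
qed

text \<open>Each new field enters at the top while the older ones move down. Thus both shift amounts
  are constant during the loop, and after \<open>q\<close> rounds the first field has arrived at
  position \<open>0\<close>.\<close>

lemma pack_load:
  assumes "0 < b" "i < q" "q * b \<le> N" "\<And>k. k \<le> i \<Longrightarrow> f k < 2 ^ b"
  shows "or (shr_bits (push_bit ((q - i) * b) (pack b i f)) b) (shl_bits N (f i) ((q - 1) * b)) =
    push_bit ((q - Suc i) * b) (pack b (Suc i) f)"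
proof -
  obtain r where q: "q = Suc (r + i)" using assms(2) by (metis add.commute add_Suc_right less_imp_Suc_add)
  have qi: "(q - i) * b = b + r * b" "q - Suc i = r" "(q - 1) * b = r * b + i * b"
    by (auto simp: q algebra_simps Suc_diff_le)
  have 1: "shr_bits (push_bit ((q - i) * b) (pack b i f)) b = push_bit (r * b) (pack b i f)"
    unfolding qi shr_bits_def push_bit_push_bit[symmetric] by (simp add: drop_bit_push_bit)
  have lt: "pack b i f < 2 ^ (i * b)" using assms(4) by (intro pack_less) auto
  have "push_bit (r * b + i * b) (f i) < 2 ^ (r * b + i * b) * 2 ^ b"
    using assms(4)[of i] by (simp add: push_bit_eq_mult)
  also have "\<dots> \<le> 2 ^ N" unfolding power_add[symmetric]
    by (intro power_increasing) (use assms(3) in \<open>auto simp: q algebra_simps\<close>)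
  finally have 2: "shl_bits N (f i) ((q - 1) * b) = push_bit (r * b) (push_bit (i * b) (f i))"
    unfolding qi by (simp add: shl_bits_def take_bit_nat_eq_self push_bit_push_bit)
  have "and (pack b i f) (push_bit (i * b) (f i)) = 0"
    by (rule bit_eqI) (use not_bit_of_less[OF lt] in \<open>auto simp: bit_and_iff bit_push_bit_iff\<close>)
  then have "pack b (Suc i) f = or (pack b i f) (push_bit (i * b) (f i))"
    by (simp add: pack_Suc disjunctive_add_eq_or)
  then show ?thesis unfolding 1 2 unfolding qi by (simp add: push_bit_or)
qed

section \<open>The table of LCS lengths\<close>

text \<open>The arguments are functions instead of lists so that both strings can be continued by
  padding symbols.\<close>

fun lcs_tab :: "(nat \<Rightarrow> 'a) \<Rightarrow> (nat \<Rightarrow> 'a) \<Rightarrow> nat \<Rightarrow> nat \<Rightarrow> nat" where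
  "lcs_tab x y 0 j = 0"
| "lcs_tab x y (Suc i) 0 = 0"
| "lcs_tab x y (Suc i) (Suc j) =
     (if x i = y j then Suc (lcs_tab x y i j) else max (lcs_tab x y i (Suc j)) (lcs_tab x y (Suc i) j))"

lemma lcs_tab_0_right [simp]: "lcs_tab x y i 0 = 0"
  by (cases i) auto

text \<open>The bound in one direction needs both directions at a smaller neighbouring entry, hence
  a single induction on \<open>i + j\<close> for all four inequalities.\<close>

lemma lcs_tab_step:
  "lcs_tab x y i j \<le> lcs_tab x y (Suc i) j \<and> lcs_tab x y (Suc i) j \<le> Suc (lcs_tab x y i j) \<and>
   lcs_tab x y i j \<le> lcs_tab x y i (Suc j) \<and> lcs_tab x y i (Suc j) \<le> Suc (lcs_tab x y i j)"
proof (induction "i + j" arbitrary: i j rule: less_induct)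
  case less
  have a: "lcs_tab x y i j \<le> lcs_tab x y (Suc i) j \<and> lcs_tab x y (Suc i) j \<le> Suc (lcs_tab x y i j)"
  proof (cases j)
    case (Suc j')
    show ?thesis using less[of i j'] Suc by (auto simp: max_def)
  qed simp
  have b: "lcs_tab x y i j \<le> lcs_tab x y i (Suc j) \<and> lcs_tab x y i (Suc j) \<le> Suc (lcs_tab x y i j)"
  proof (cases i)
    case (Suc i')
    show ?thesis using less[of i' j] Suc by (auto simp: max_def)
  qed simp
  from a b show ?case by simp
qed

text \<open>By \<open>lcs_tab_step\<close> a difference is \<open>0\<close> or \<open>1\<close>, so
  it is determined by whether the two entries differ.\<close>

definition dif_x :: "(nat \<Rightarrow> 'a) \<Rightarrow> (nat \<Rightarrow> 'a) \<Rightarrow> nat \<Rightarrow> nat \<Rightarrow> bool" where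
  "dif_x x y i j \<longleftrightarrow> lcs_tab x y (Suc i) j \<noteq> lcs_tab x y i j"

definition dif_y :: "(nat \<Rightarrow> 'a) \<Rightarrow> (nat \<Rightarrow> 'a) \<Rightarrow> nat \<Rightarrow> nat \<Rightarrow> bool" where
  "dif_y x y i j \<longleftrightarrow> lcs_tab x y i (Suc j) \<noteq> lcs_tab x y i j"

text \<open>Let \<open>h\<close> be the entry at \<open>(i, j)\<close>, and \<open>a\<close> and
  \<open>p\<close> the differences there in the first and in the second index. The opposite corner
  is \<open>h + 1\<close> on a match and \<open>h + max a p\<close> otherwise; subtracting
  \<open>h + p\<close> gives the formula. \<open>dif_y_Suc\<close> is its mirror image.\<close>

lemma dif_x_Suc: "dif_x x y i (Suc j) \<longleftrightarrow> (x i = y j \<or> dif_x x y i j) \<and> \<not> dif_y x y i j"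
  using lcs_tab_step[of x y i j] lcs_tab_step[of x y i "Suc j"] lcs_tab_step[of x y "Suc i" j]
  by (auto simp: dif_x_def dif_y_def max_def split: if_splits)

lemma dif_y_Suc: "dif_y x y (Suc i) j \<longleftrightarrow> (x i = y j \<or> dif_y x y i j) \<and> \<not> dif_x x y i j"
  using lcs_tab_step[of x y i j] lcs_tab_step[of x y i "Suc j"] lcs_tab_step[of x y "Suc i" j]
  by (auto simp: dif_x_def dif_y_def max_def split: if_splits)

lemma dif_x_0 [simp]: "\<not> dif_x x y i 0"
  by (simp add: dif_x_def)

lemma dif_y_0 [simp]: "\<not> dif_y x y 0 j"
  by (simp add: dif_y_def)

lemma lcs_tab_Suc_right: "lcs_tab x y i (Suc j) = lcs_tab x y i j + of_bool (dif_y x y i j)"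
  using lcs_tab_step[of x y i j] by (auto simp: dif_y_def)

text \<open>This is what allows the last strip to extend beyond the end of the string: rows of
  padding do not change the table.\<close>

lemma lcs_tab_no_match:
  assumes "m \<le> i" "\<And>i' j'. m \<le> i' \<Longrightarrow> j' < j \<Longrightarrow> x i' \<noteq> y j'"
  shows "lcs_tab x y i j = lcs_tab x y m j"
  using assms
proof (induction i rule: dec_induct)
  case (step i)
  have "lcs_tab x y (Suc i) j' = lcs_tab x y i j'" if "j' \<le> j" for j'
    using that
  proof (induction j')
    case (Suc j')
    have "x i \<noteq> y j'" using step Suc by auto
    with Suc lcs_tab_step[of x y i j'] show ?case by (auto simp: max_def)
  qed simp
  with step show ?case by simp
qed simp

lemma lcs_tab_cong:
  assumes "\<And>i'. i' < i \<Longrightarrow> x i' = x' i'" "\<And>j'. j' < j \<Longrightarrow> y j' = y' j'"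
  shows "lcs_tab x y i j = lcs_tab x' y' i j"
  using assms
  by (induction x y i j rule: lcs_tab.induct) (auto intro!: arg_cong2[where f = max])

text \<open>The recursion of \<open>subseq\<close> works at the front of lists, whereas the table
  extends prefixes at the end.\<close>

lemma subseq_snoc_snoc:
  "subseq (zs @ [z]) (xs @ [x]) \<longleftrightarrow> (if z = x then subseq zs xs else subseq (zs @ [z]) xs)"
proof (cases "z = x")
  case False
  have "subseq (zs @ [z]) xs" if sub: "subseq (zs @ [z]) (xs @ [x])"
  proof -
    obtain us vs where "zs @ [z] = us @ vs" "subseq us xs" "subseq vs [x]"
      using sub by (auto simp: subseq_append_iff)
    moreover have "vs = [] \<or> vs = [x]"
      using \<open>subseq vs [x]\<close> by (cases vs) (auto split: if_splits)
    ultimately show ?thesis using False by auto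
  qed
  then show ?thesis using False by (auto intro: subseq_rev_drop_many)
qed simp

lemma subseq_snocD: "subseq (zs @ [z]) (xs @ [x]) \<Longrightarrow> subseq zs xs"
  by (metis subseq_snoc_snoc subseq_order.trans prefix_imp_subseq prefixI)

text \<open>On a match, removing the last symbol of any common subsequence leaves one of the two
  shorter prefixes, so the diagonal entry is optimal. Without a match, a common subsequence does not
  need both last symbols, so one prefix can be shortened.\<close>

lemma lcs_tab_take:
  assumes "i \<le> length X" "j \<le> length Y"
  shows "(\<exists>Z. common_subseq Z (take i X) (take j Y) \<and> length Z = lcs_tab ((!) X) ((!) Y) i j) \<and>
    (\<forall>Z. common_subseq Z (take i X) (take j Y) \<longrightarrow> length Z \<le> lcs_tab ((!) X) ((!) Y) i j)"
  using assms
proof (induction "(!) X" "(!) Y" i j rule: lcs_tab.induct)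
  case (3 i j)
  let ?X = "take i X" and ?Y = "take j Y"
  have X: "take (Suc i) X = ?X @ [X ! i]" and Y: "take (Suc j) Y = ?Y @ [Y ! j]"
    using 3 by (simp_all add: take_Suc_conv_app_nth)
  show ?case
  proof (cases "X ! i = Y ! j")
    case True
    have ub: "length Z \<le> lcs_tab ((!) X) ((!) Y) (Suc i) (Suc j)"
      if Z: "common_subseq Z (take (Suc i) X) (take (Suc j) Y)" for Z
    proof (cases Z rule: rev_cases)
      case (snoc Z' z)
      have "common_subseq Z' ?X ?Y"
        using Z snoc unfolding common_subseq_def X Y
        by (auto dest: subseq_snocD)
      with 3 True snoc show ?thesis by (auto simp: Suc_le_eq less_Suc_eq_le)
    qed simp
    obtain Z where Z: "common_subseq Z ?X ?Y" "length Z = lcs_tab ((!) X) ((!) Y) i j"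
      using 3 True by auto
    have "common_subseq (Z @ [X ! i]) (take (Suc i) X) (take (Suc j) Y)"
      using Z True unfolding common_subseq_def X Y by (simp add: subseq_snoc_snoc)
    with Z True have "\<exists>Z. common_subseq Z (take (Suc i) X) (take (Suc j) Y) \<and>
        length Z = lcs_tab ((!) X) ((!) Y) (Suc i) (Suc j)"
      by (intro exI[of _ "Z @ [X ! i]"]) simp
    with ub show ?thesis by blast
  next
    case False
    have IH1: "(\<exists>Z. common_subseq Z ?X (take (Suc j) Y) \<and> length Z = lcs_tab ((!) X) ((!) Y) i (Suc j)) \<and>
      (\<forall>Z. common_subseq Z ?X (take (Suc j) Y) \<longrightarrow> length Z \<le> lcs_tab ((!) X) ((!) Y) i (Suc j))"
      and IH2: "(\<exists>Z. common_subseq Z (take (Suc i) X) ?Y \<and> length Z = lcs_tab ((!) X) ((!) Y) (Suc i) j) \<and>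
      (\<forall>Z. common_subseq Z (take (Suc i) X) ?Y \<longrightarrow> length Z \<le> lcs_tab ((!) X) ((!) Y) (Suc i) j)"
      using 3 False by auto
    have split: "common_subseq Z (take (Suc i) X) (take (Suc j) Y) \<longleftrightarrow>
      common_subseq Z ?X (take (Suc j) Y) \<or> common_subseq Z (take (Suc i) X) ?Y" for Z
    proof (cases Z rule: rev_cases)
      case (snoc Z' z)
      have mono: "subseq (Z' @ [z]) U \<Longrightarrow> subseq (Z' @ [z]) (U @ [u])" for U u
        by (rule subseq_rev_drop_many)
      show ?thesis using False snoc mono unfolding common_subseq_def X Y
        by (auto simp: subseq_snoc_snoc split: if_splits)
    qed (simp add: common_subseq_def)
    show ?thesis unfolding split using IH1 IH2 False by (auto simp: max_def le_max_iff_disj)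
  qed
qed (auto simp: common_subseq_def)

lemma longest_common_subseq_tab:
  "\<exists>Z. longest_common_subseq Z X Y \<and> length Z = lcs_tab ((!) X) ((!) Y) (length X) (length Y)"
  using lcs_tab_take[of "length X" X "length Y" Y] unfolding longest_common_subseq_def by fastforce

section \<open>The strip program\<close>

text \<open>The strip program exists in two versions, one on wide registers (\<open>wd\<close>) and one on the word
  registers from \<open>100\<close> on.\<close>

definition vlen :: "bool \<Rightarrow> nat \<Rightarrow> nat" where
  "vlen wd w = (if wd then w * w else w)"

definition vreg :: "bool \<Rightarrow> config \<Rightarrow> nat \<Rightarrow> nat" where
  "vreg wd c i = (if wd then wreg c i else reg c (100 + i))"

definition vAdd :: "bool \<Rightarrow> nat \<Rightarrow> nat \<Rightarrow> nat \<Rightarrow> instr" where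
  "vAdd wd d u v = (if wd then WAdd d u v else Add (100 + d) (100 + u) (100 + v))"

definition vSub :: "bool \<Rightarrow> nat \<Rightarrow> nat \<Rightarrow> nat \<Rightarrow> instr" where
  "vSub wd d u v = (if wd then WSub d u v else Sub (100 + d) (100 + u) (100 + v))"

definition vAnd :: "bool \<Rightarrow> nat \<Rightarrow> nat \<Rightarrow> nat \<Rightarrow> instr" where
  "vAnd wd d u v = (if wd then WAnd d u v else And (100 + d) (100 + u) (100 + v))"

definition vOr :: "bool \<Rightarrow> nat \<Rightarrow> nat \<Rightarrow> nat \<Rightarrow> instr" where
  "vOr wd d u v = (if wd then WOr d u v else Or (100 + d) (100 + u) (100 + v))"

definition vNot :: "bool \<Rightarrow> nat \<Rightarrow> nat \<Rightarrow> instr" where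
  "vNot wd d u = (if wd then WNot d u else Not (100 + d) (100 + u))"

definition vShl :: "bool \<Rightarrow> nat \<Rightarrow> nat \<Rightarrow> nat \<Rightarrow> instr" where
  "vShl wd d u a = (if wd then WShl d u a else Shl (100 + d) (100 + u) a)"

definition vShr :: "bool \<Rightarrow> nat \<Rightarrow> nat \<Rightarrow> nat \<Rightarrow> instr" where
  "vShr wd d u a = (if wd then WShr d u a else Shr (100 + d) (100 + u) a)"

abbreviation (input) "rOne \<equiv> 3::nat"
abbreviation (input) "rZero \<equiv> 4::nat"
abbreviation (input) "rW \<equiv> 5::nat"
abbreviation (input) "rB \<equiv> 6::nat"
abbreviation (input) "rB1 \<equiv> 7::nat"
abbreviation (input) "rQ \<equiv> 8::nat"
abbreviation (input) "rSh \<equiv> 9::nat"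
abbreviation (input) "rK \<equiv> 10::nat"
abbreviation (input) "rKm \<equiv> 11::nat"
abbreviation (input) "rScr \<equiv> 12::nat"
abbreviation (input) "rBB \<equiv> 13::nat"
text \<open>Register \<open>2\<close> holds \<open>\<sigma>\<close> on entry, and
  \<open>\<sigma>\<close> is the padding symbol of the string that is cut into strips.\<close>

abbreviation (input) "rXpad \<equiv> 2::nat"
abbreviation (input) "rYpad \<equiv> 14::nat"
abbreviation (input) "rXp \<equiv> 15::nat"
abbreviation (input) "rXr \<equiv> 16::nat"
abbreviation (input) "rYp0 \<equiv> 17::nat"
abbreviation (input) "rYn \<equiv> 18::nat"
abbreviation (input) "rF \<equiv> 19::nat"
abbreviation (input) "rCnt \<equiv> 20::nat"
abbreviation (input) "rI \<equiv> 21::nat"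
abbreviation (input) "rT \<equiv> 22::nat"
abbreviation (input) "rPin \<equiv> 23::nat"
abbreviation (input) "rYp \<equiv> 24::nat"
abbreviation (input) "rYr \<equiv> 25::nat"
abbreviation (input) "rJ \<equiv> 26::nat"
abbreviation (input) "rO \<equiv> 27::nat"
abbreviation (input) "rOr \<equiv> 28::nat"
abbreviation (input) "rLag \<equiv> 29::nat"
abbreviation (input) "rT2 \<equiv> 30::nat"
abbreviation (input) "rT3 \<equiv> 31::nat"
abbreviation (input) "rT4 \<equiv> 32::nat"
abbreviation (input) "rA \<equiv> 33::nat"

abbreviation (input) "vX \<equiv> 0::nat"
abbreviation (input) "vY \<equiv> 1::nat"
abbreviation (input) "vL \<equiv> 2::nat"
abbreviation (input) "vM \<equiv> 3::nat"
abbreviation (input) "vA \<equiv> 4::nat"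
abbreviation (input) "vP \<equiv> 5::nat"
abbreviation (input) "vT \<equiv> 6::nat"
abbreviation (input) "vZ \<equiv> 7::nat"
abbreviation (input) "vE \<equiv> 8::nat"

text \<open>The only way from word registers to wide registers and back is through memory, here the
  scratch word at the address in \<open>rScr\<close>.\<close>

definition lift :: "bool \<Rightarrow> nat \<Rightarrow> instr list" where
  "lift wd r = (if wd then [WSub vT vT vT, StoreInd rScr r, ReadBlock vT rZero rScr]
     else [Add (100 + vT) r rZero])"

definition lower :: "bool \<Rightarrow> nat \<Rightarrow> instr list" where
  "lower wd r = (if wd then [WriteBlock rScr vT rZero, LoadInd r rScr]
     else [Add r (100 + vT) rZero])"

text \<open>One round of \<open>pack_load\<close>, with the new field taken from a word
  register.\<close>

definition inject :: "bool \<Rightarrow> nat \<Rightarrow> nat \<Rightarrow> instr list" where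
  "inject wd d r = lift wd r @ [vShl wd vT vT rSh, vShr wd d d rB, vOr wd d d vT]"

text \<open>The boundary between two strips is a bit array in memory with \<open>2 ^ k\<close> bits per word. A
  narrow pass has a single strip and needs none. The register \<open>rF\<close> is \<open>0\<close> during the first strip,
  where the incoming bits are \<open>0\<close> but the array is not initialized yet.\<close>

definition get_bit :: "bool \<Rightarrow> instr list" where
  "get_bit wd = (if wd then [Shr rPin rJ rK, Add rPin rPin rBB, LoadInd rPin rPin,
     And rT2 rJ rKm, Shr rPin rPin rT2, And rPin rPin rF] else [LoadImm rPin 0])"

definition put_bit :: "bool \<Rightarrow> instr list" where
  "put_bit wd = (if wd then [Shr rA rO rK, Add rA rA rBB, And rT2 rO rKm, Shl rT3 rOne rT2,
     Not rT3 rT3, LoadInd rT4 rA, And rT4 rT4 rT3, Shl rT3 rT rT2, Or rT4 rT4 rT3,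
     StoreInd rA rT4] else [])"

definition load_init :: "bool \<Rightarrow> com" where
  "load_init wd = Blk [vSub wd vX vX vX, vSub wd vY vY vY, vSub wd vL vL vL, Add rI rQ rZero]"

definition load_next :: com where
  "load_next = IfZ rXr (Blk [Add rT rXpad rZero])
     (Blk [LoadInd rT rXp, Add rXp rXp rOne, Sub rXr rXr rOne])"

text \<open>The constant vectors \<open>vY\<close> and \<open>vL\<close> are filled by the loop that
  loads the symbols, which avoids a separate replication of constants.\<close>

definition load_push :: "bool \<Rightarrow> com" where
  "load_push wd = Blk (inject wd vX rT) ;; Blk (inject wd vY rYpad) ;; Blk (inject wd vL rOne) ;;
     Blk [Sub rI rI rOne]"

definition load :: "bool \<Rightarrow> com" where
  "load wd = load_init wd ;; While rI (load_next ;; load_push wd)"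

definition stream_init :: "bool \<Rightarrow> com" where
  "stream_init wd = Blk [vShl wd vM vL rB1, vSub wd vM vM vL, vSub wd vA vA vA, vSub wd vP vP vP,
     Add rYp rYp0 rZero, Add rYr rYn rZero, LoadImm rJ 0, LoadImm rO 0, LoadImm rCnt 0,
     Add rOr rYn rZero, Sub rLag rQ rOne]"

definition stream_next :: "bool \<Rightarrow> com" where
  "stream_next wd = IfZ rYr (Blk [Add rT rYpad rZero, LoadImm rPin 0])
     (Blk [LoadInd rT rYp, Add rYp rYp rOne, Sub rYr rYr rOne] ;;
      Blk (get_bit wd) ;; Blk [Add rJ rJ rOne])"

text \<open>Symbols and \<open>dif_y\<close> bits travel from cell to cell, whereas the
  \<open>dif_x\<close> bits in \<open>vA\<close> belong to the rows and stay.\<close>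

definition stream_shift :: "bool \<Rightarrow> com" where
  "stream_shift wd =
     Blk (vShl wd vY vY rB # lift wd rT @ [vOr wd vY vY vT]) ;;
     Blk ([vShl wd vP vP rB, vAnd wd vP vP vL] @ lift wd rPin @ [vOr wd vP vP vT])"

definition cells_eq :: "bool \<Rightarrow> com" where
  "cells_eq wd = Blk [vNot wd vT vY, vAnd wd vZ vX vT, vNot wd vT vX, vAnd wd vT vT vY,
     vOr wd vZ vZ vT, vAnd wd vT vZ vM, vAdd wd vT vT vM, vOr wd vT vT vZ, vShr wd vT vT rB1,
     vNot wd vT vT, vAnd wd vE vT vL]"

text \<open>The recurrences \<open>dif_x_Suc\<close> and \<open>dif_y_Suc\<close> in all cells at
  once. The new \<open>vA\<close> waits in \<open>vZ\<close> until the new \<open>vP\<close> has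
  been computed from the old \<open>vA\<close>.\<close>

definition cells_step :: "bool \<Rightarrow> com" where
  "cells_step wd = Blk ([vNot wd vT vP, vOr wd vZ vE vA, vAnd wd vZ vZ vT, vOr wd vP vE vP,
     vNot wd vT vA, vAnd wd vP vP vT, vOr wd vA vZ vZ, vShr wd vT vP rSh] @ lower wd rT)"

text \<open>While \<open>rLag\<close> is positive, the last cell has not yet met a symbol and its
  bit does not belong to the boundary. Afterwards the sum of its bits is the table entry at the end
  of the strip.\<close>

definition stream_out :: "bool \<Rightarrow> com" where
  "stream_out wd = IfZ rLag
     (Blk (put_bit wd) ;; Blk [Add rCnt rCnt rT, Add rO rO rOne, Sub rOr rOr rOne])
     (Blk [Sub rLag rLag rOne])"

definition stream_body :: "bool \<Rightarrow> com" where
  "stream_body wd = stream_next wd ;; stream_shift wd ;; cells_eq wd ;; cells_step wd ;; stream_out wd"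

definition strip :: "bool \<Rightarrow> com" where
  "strip wd = load wd ;; stream_init wd ;; While rOr (stream_body wd) ;; Blk [LoadImm rF 1]"

text \<open>Clearing \<open>rCnt\<close> here provides the answer for an empty string, which has no
  strip.\<close>

definition pass :: "bool \<Rightarrow> com" where
  "pass wd = Blk [LoadImm rF 0, LoadImm rCnt 0] ;; While rXr (strip wd)"

section \<open>Frames, the setting of a pass, and the loading of a strip\<close>

lemmas vinstr_defs = vAdd_def vSub_def vAnd_def vOr_def vNot_def vShl_def vShr_def vreg_def vlen_def

lemma of_blocks_single: "0 < w \<Longrightarrow> of_blocks w ((block w 0)(0 := x)) = x"
proof -
  assume "0 < w"
  then obtain v where w: "w = Suc v" by (cases w) auto
  show ?thesis unfolding of_blocks_def w
    by (subst sum.lessThan_Suc_shift) (simp add: block_def)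
qed

lemma block_0: "block w V 0 = take_bit w V"
  by (simp add: block_def)

text \<open>In a narrow pass the vector registers are word registers, hence the bound on \<open>i\<close>.\<close>

definition frame :: "bool \<Rightarrow> nat set \<Rightarrow> nat set \<Rightarrow> nat set \<Rightarrow> config \<Rightarrow> config \<Rightarrow> bool" where
  "frame wd S T M c c' \<longleftrightarrow>
     (\<forall>i < 100. i \<notin> S \<longrightarrow> reg c' i = reg c i) \<and> (\<forall>i. i \<notin> T \<longrightarrow> vreg wd c' i = vreg wd c i) \<and>
     (\<forall>a. a \<notin> M \<longrightarrow> mem c' a = mem c a)"

lemma frame_trans:
  "frame wd S T M c c' \<Longrightarrow> frame wd S' T' M' c' c'' \<Longrightarrow>
   S \<union> S' \<subseteq> S'' \<Longrightarrow> T \<union> T' \<subseteq> T'' \<Longrightarrow> M \<union> M' \<subseteq> M'' \<Longrightarrow> frame wd S'' T'' M'' c c''"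
  unfolding frame_def by (metis UnCI subset_iff)

text \<open>\<open>U\<close> is cut into strips and \<open>V\<close> is streamed; \<open>up\<close>
  and \<open>vp\<close> are their addresses. A wide pass has its scratch word at \<open>base\<close>
  and the boundary array behind it. The largest shift amount \<open>(q - 1) * b\<close> must fit
  into a word, and both padding symbols into a field.\<close>

locale lcs_machine =
  fixes wd :: bool and w b q k \<sigma> :: nat and U V :: "nat list" and up vp base :: nat
  assumes w: "2 \<le> w" and b: "2 \<le> b" "b \<le> w" and q: "0 < q" "q < 2 ^ w"
    and qb: "q * b \<le> vlen wd w" "(q - 1) * b < 2 ^ w"
    and \<sigma>: "\<sigma> + 1 < 2 ^ b"
    and U: "set U \<subseteq> {..<\<sigma>}" "length U < 2 ^ w" "up + length U \<le> 2 ^ w"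
    and V: "set V \<subseteq> {..<\<sigma>}" "length V < 2 ^ w" "vp + length V \<le> 2 ^ w" "V \<noteq> []"
    and wide: "wd \<Longrightarrow> 2 ^ k \<le> w" "wd \<Longrightarrow> base + 1 + (length V - 1) div 2 ^ k < 2 ^ w"
      "wd \<Longrightarrow> up + length U \<le> base" "wd \<Longrightarrow> vp + length V \<le> base"
    and narrow: "\<not> wd \<Longrightarrow> length U \<le> q"
begin

abbreviation "N \<equiv> vlen wd w"

definition "extra = (if wd then {base .. base + 1 + (length V - 1) div 2 ^ k} else {})"

definition "input = {up ..< up + length U} \<union> {vp ..< vp + length V}"

abbreviation "tr C K \<equiv> triple w C K (input \<union> extra) extra"

abbreviation "rn is c Q \<equiv> runs w (input \<union> extra) extra is c Q"

definition fixed :: "config \<Rightarrow> bool" where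
  "fixed c \<longleftrightarrow> reg c rOne = 1 \<and> reg c rZero = 0 \<and> reg c rB = b \<and> reg c rB1 = b - 1 \<and>
     reg c rQ = q \<and> reg c rSh = (q - 1) * b \<and> reg c rXpad = \<sigma> \<and> reg c rYpad = \<sigma> + 1 \<and>
     reg c rYp0 = vp \<and> reg c rYn = length V \<and>
     (wd \<longrightarrow> reg c rK = k \<and> reg c rKm = mask k \<and> reg c rScr = base \<and> reg c rBB = base + 1) \<and>
     (\<forall>i < length U. mem c (up + i) = U ! i) \<and> (\<forall>j < length V. mem c (vp + j) = V ! j)"

text \<open>The padding symbols \<open>\<sigma>\<close> and \<open>\<sigma> + 1\<close> match nothing.\<close>

definition "xs i = (if i < length U then U ! i else \<sigma>)"

definition "ys j = (if j < length V then V ! j else \<sigma> + 1)"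

abbreviation "D \<equiv> lcs_tab xs ys"

lemma base_in: "wd \<Longrightarrow> base \<in> extra"
  unfolding extra_def by simp

lemma extra_disjoint: "extra \<inter> input = {}"
  using wide(3,4) by (auto simp: extra_def input_def)

text \<open>Each phase only has to state a frame: its writes stay in \<open>extra\<close>, which is
  disjoint from the input, so parameters and input survive.\<close>

lemma fixed_frame:
  assumes "fixed c" "frame wd S T M c c'" "M \<subseteq> extra"
    and "S \<inter> {rXpad, rOne, rZero, rB, rB1, rQ, rSh, rYpad, rYp0, rYn, rK, rKm, rScr, rBB} = {}"
  shows "fixed c'"
proof -
  have "reg c' i = reg c i" if "i \<in> {rXpad, rOne, rZero, rB, rB1, rQ, rSh, rYpad, rYp0, rYn, rK, rKm, rScr, rBB}" for i
    using assms(2,4) that by (auto simp: frame_def)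
  moreover have "mem c' a = mem c a" if "a \<in> input" for a
    using assms(2,3) that extra_disjoint by (auto simp: frame_def)
  ultimately show ?thesis using assms(1) by (simp add: fixed_def input_def)
qed

lemma xs_less: "xs i < 2 ^ b" and ys_less: "ys j < 2 ^ b" and xs_le: "xs i \<le> \<sigma>"
  and ys_ne: "length V \<le> j \<Longrightarrow> ys j = \<sigma> + 1"
proof -
  have "i < length U \<Longrightarrow> U ! i < \<sigma>" "j < length V \<Longrightarrow> V ! j < \<sigma>" for i j
    using U(1) V(1) by (meson lessThan_iff nth_mem subsetD)+
  then show "xs i < 2 ^ b" "ys j < 2 ^ b" "xs i \<le> \<sigma>" "length V \<le> j \<Longrightarrow> ys j = \<sigma> + 1"
    using \<sigma> by (force simp: xs_def ys_def)+
qed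

lemma pow_b_le: "(2::nat) ^ b \<le> 2 ^ w"
  using b by simp

lemma \<sigma>_less: "\<sigma> + 1 < 2 ^ w"
  using \<sigma> pow_b_le by linarith

lemma one_less_pow: "(1::nat) < 2 ^ w"
  using w one_less_power[of "2::nat" w] by simp

lemma pow_N: "(2::nat) ^ w \<le> 2 ^ N"
proof -
  have "w \<le> w * w" by simp
  then show ?thesis by (simp add: vlen_def)
qed

lemma take_bit_word: "x < 2 ^ w \<Longrightarrow> take_bit w x = (x::nat)"
  by (simp add: take_bit_nat_eq_self)

text \<open>Stated with a continuation \<open>rest\<close>, so that it can be used inside a longer
  block. The set \<open>{base} \<inter> extra\<close> is empty in a narrow pass, and thus one frame
  describes both versions.\<close>

lemma lift_runs:
  assumes "fixed c" "reg c r < 2 ^ w" "r < 100"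
    and "\<And>c'. frame wd {} {vT} ({base} \<inter> extra) c c' \<Longrightarrow> vreg wd c' vT = reg c r \<Longrightarrow> runs w R W rest c' Q"
    and "extra \<subseteq> R" "extra \<subseteq> W"
  shows "runs w R W (lift wd r @ rest) c Q"
proof (cases wd)
  case True
  have base: "base \<in> R" "base \<in> W" "{base} \<inter> extra = {base}"
    using assms(5,6) base_in[OF True] by auto
  have c: "reg c rScr = base" "reg c rZero = 0" using assms(1) True unfolding fixed_def by simp_all
  have w0: "0 < w" using w by simp
  show ?thesis using c base w0 assms(3)
    by (simp add: lift_def True of_blocks_single)
      (rule assms(4), use True base in \<open>auto simp: frame_def vreg_def\<close>)
next
  case False
  have "reg c rZero = 0" using assms(1) unfolding fixed_def by simp
  then show ?thesis using assms(2,3)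
    by (simp add: lift_def False add_bits_eq) (rule assms(4), auto simp: frame_def vreg_def False)
qed

lemma inject_triple:
  assumes "fixed c" "reg c r < 2 ^ w" "r < 100" "d \<noteq> vT"
  shows "tr (Blk (inject wd d r)) 6 c
    (\<lambda>c'. frame wd {} {d, vT} ({base} \<inter> extra) c c' \<and>
      vreg wd c' d = or (shr_bits (vreg wd c d) b) (shl_bits N (reg c r) ((q - 1) * b)))"
proof (rule triple_Blk)
  show "rn (inject wd d r) c
    (\<lambda>c'. frame wd {} {d, vT} ({base} \<inter> extra) c c' \<and>
      vreg wd c' d = or (shr_bits (vreg wd c d) b) (shl_bits N (reg c r) ((q - 1) * b)))"
    unfolding inject_def
  proof (rule lift_runs[OF assms(1-3)])
    fix c1 assume 1: "frame wd {} {vT} ({base} \<inter> extra) c c1" "vreg wd c1 vT = reg c r"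
    have "reg c1 rSh = (q - 1) * b" "reg c1 rB = b"
      using assms(1) 1 by (auto simp: frame_def fixed_def)
    then show "rn [vShl wd vT vT rSh, vShr wd d d rB, vOr wd d d vT] c1
      (\<lambda>c'. frame wd {} {d, vT} ({base} \<inter> extra) c c' \<and>
      vreg wd c' d = or (shr_bits (vreg wd c d) b) (shl_bits N (reg c r) ((q - 1) * b)))"
      using 1 assms(4) by (cases wd) (auto simp: frame_def vinstr_defs)
  qed auto
qed (simp add: inject_def lift_def)

text \<open>\<open>take_bit\<close> is there because the string may end at the last address, in
  which case the pointer behind it wraps around to \<open>0\<close>; \<open>min\<close> because the
  pointer stops while padding is loaded.\<close>

lemma load_next_triple:
  assumes "fixed c" "reg c rXp = take_bit w (up + min j (length U))" "reg c rXr = length U - j"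
  shows "tr load_next 5 c (\<lambda>c'. frame wd {rT, rXp, rXr} {} {} c c' \<and> reg c' rT = xs j \<and>
    reg c' rXp = take_bit w (up + min (Suc j) (length U)) \<and> reg c' rXr = length U - Suc j)"
  unfolding load_next_def
proof (rule triple_IfZ[where K = 3])
  assume "reg c rXr = 0"
  then have j: "length U \<le> j" using assms by simp
  have "reg c rZero = 0" "reg c rXpad = \<sigma>" using assms(1) unfolding fixed_def by simp_all
  moreover have "\<sigma> < 2 ^ w" using \<sigma>_less by simp
  ultimately show "tr (Blk [Add rT rXpad rZero]) 3 c (\<lambda>c'. frame wd {rT, rXp, rXr} {} {} c c' \<and> reg c' rT = xs j \<and>
    reg c' rXp = take_bit w (up + min (Suc j) (length U)) \<and> reg c' rXr = length U - Suc j)"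
    using j assms by (intro triple_Blk) (auto simp: add_bits_eq frame_def vreg_def xs_def)
next
  assume "reg c rXr \<noteq> 0"
  then have j: "j < length U" using assms by simp
  have 1: "reg c rOne = 1" "mem c (up + j) = U ! j" using assms(1) j unfolding fixed_def by simp_all
  have 2: "reg c rXp = up + j" using assms(2) j U(3) by (simp add: take_bit_word)
  have 3: "up + j \<in> input \<union> extra" using j by (simp add: input_def)
  have "length U - j < 2 ^ w" using U(2) by simp
  then show "tr (Blk [LoadInd rT rXp, Add rXp rXp rOne, Sub rXr rXr rOne]) 3 c
    (\<lambda>c'. frame wd {rT, rXp, rXr} {} {} c c' \<and> reg c' rT = xs j \<and>
    reg c' rXp = take_bit w (up + min (Suc j) (length U)) \<and> reg c' rXr = length U - Suc j)"
    using j 1 2 3 assms(3)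
    by (intro triple_Blk) (auto simp: sub_bits_eq add_bits_def frame_def vreg_def xs_def)
qed simp

lemma load_push_triple:
  assumes "fixed c" "reg c rT < 2 ^ w" "0 < reg c rI" "reg c rI < 2 ^ w"
  shows "tr (load_push wd) 19 c (\<lambda>c'. frame wd {rI} {vX, vY, vL, vT} ({base} \<inter> extra) c c' \<and>
    vreg wd c' vX = or (shr_bits (vreg wd c vX) b) (shl_bits N (reg c rT) ((q - 1) * b)) \<and>
    vreg wd c' vY = or (shr_bits (vreg wd c vY) b) (shl_bits N (\<sigma> + 1) ((q - 1) * b)) \<and>
    vreg wd c' vL = or (shr_bits (vreg wd c vL) b) (shl_bits N 1 ((q - 1) * b)) \<and>
    reg c' rI = reg c rI - 1)" (is "tr _ _ _ ?Q")
  unfolding load_push_def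
proof (rule triple_Seq[OF inject_triple])
  show "fixed c" "reg c rT < 2 ^ w" by fact+
  fix c1 assume 1: "frame wd {} {vX, vT} ({base} \<inter> extra) c c1 \<and>
    vreg wd c1 vX = or (shr_bits (vreg wd c vX) b) (shl_bits N (reg c rT) ((q - 1) * b))"
  have f1: "fixed c1" by (rule fixed_frame[OF assms(1) conjunct1[OF 1]]) auto
  show "tr (Blk (inject wd vY rYpad) ;; Blk (inject wd vL rOne) ;; Blk [Sub rI rI rOne]) 13 c1 ?Q"
  proof (rule triple_Seq[OF inject_triple])
    show "fixed c1" by fact
    have y1: "reg c1 rYpad = \<sigma> + 1" using f1 unfolding fixed_def by simp
    then show "reg c1 rYpad < 2 ^ w" using \<sigma>_less by simp
    fix c2 assume 2: "frame wd {} {vY, vT} ({base} \<inter> extra) c1 c2 \<and>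
      vreg wd c2 vY = or (shr_bits (vreg wd c1 vY) b) (shl_bits N (reg c1 rYpad) ((q - 1) * b))"
    have f2: "fixed c2" by (rule fixed_frame[OF f1 conjunct1[OF 2]]) auto
    show "tr (Blk (inject wd vL rOne) ;; Blk [Sub rI rI rOne]) 7 c2 ?Q"
    proof (rule triple_Seq[OF inject_triple])
      show "fixed c2" by fact
      have o2: "reg c2 rOne = 1" using f2 unfolding fixed_def by simp
      then show "reg c2 rOne < 2 ^ w" using one_less_pow by simp
      fix c3 assume 3: "frame wd {} {vL, vT} ({base} \<inter> extra) c2 c3 \<and>
        vreg wd c3 vL = or (shr_bits (vreg wd c2 vL) b) (shl_bits N (reg c2 rOne) ((q - 1) * b))"
      have o3: "reg c3 rOne = 1" "reg c3 rI = reg c rI"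
        using 1 2 3 o2 by (simp_all add: frame_def)
      have fr: "frame wd {} {vX, vY, vL, vT} ({base} \<inter> extra) c c3"
        by (rule frame_trans[OF frame_trans[OF conjunct1[OF 1] conjunct1[OF 2]
          order_refl order_refl order_refl] conjunct1[OF 3]]) auto
      have v: "vreg wd c3 vX = vreg wd c1 vX" "vreg wd c3 vY = vreg wd c2 vY"
        "vreg wd c1 vY = vreg wd c vY" "vreg wd c2 vL = vreg wd c vL"
        using 1 2 3 by (simp_all add: frame_def)
      show "tr (Blk [Sub rI rI rOne]) 1 c3 ?Q"
      proof (rule triple_Blk)
        have "vreg wd (set_reg rI x c3) i = vreg wd c3 i" for x i by (simp add: vreg_def)
        then show "rn [Sub rI rI rOne] c3 ?Q"
          using fr o3 v 1 2 3 y1 o2 assms(3,4)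
          by (simp add: sub_bits_eq) (simp add: frame_def)
      qed simp
    qed auto
  qed auto
qed auto

abbreviation "load_frame \<equiv> frame wd {rI, rT, rXp, rXr} {vX, vY, vL, vT} ({base} \<inter> extra)"

definition loading :: "nat \<Rightarrow> nat \<Rightarrow> config \<Rightarrow> bool" where
  "loading off i c \<longleftrightarrow> reg c rI = q - i \<and>
     reg c rXp = take_bit w (up + min (off + i) (length U)) \<and> reg c rXr = length U - (off + i) \<and>
     vreg wd c vX = push_bit ((q - i) * b) (pack b i (\<lambda>k. xs (off + k))) \<and>
     vreg wd c vY = push_bit ((q - i) * b) (pack b i (\<lambda>_. \<sigma> + 1)) \<and>
     vreg wd c vL = push_bit ((q - i) * b) (pack b i (\<lambda>_. 1))"

lemma load_body_triple:
  assumes c: "fixed c" "i < q" and l: "loading off i c"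
  shows "tr (load_next ;; load_push wd) 24 c (\<lambda>c'.
    load_frame c c' \<and> loading off (Suc i) c')"
    (is "tr _ _ _ ?Q")
proof -
  note l' = l[unfolded loading_def]
  have p: "reg c rXp = take_bit w (up + min (off + i) (length U))" "reg c rXr = length U - (off + i)"
    using l' by blast+
  show ?thesis
  proof (rule triple_Seq[OF load_next_triple[OF c(1) p]])
    fix c1 assume 1: "frame wd {rT, rXp, rXr} {} {} c c1 \<and> reg c1 rT = xs (off + i) \<and>
      reg c1 rXp = take_bit w (up + min (Suc (off + i)) (length U)) \<and> reg c1 rXr = length U - Suc (off + i)"
    have f: "fixed c1" by (rule fixed_frame[OF c(1) conjunct1[OF 1]]) auto
    have i: "reg c1 rI = q - i" using 1 l' by (simp add: frame_def)
    then have i0: "0 < reg c1 rI" "reg c1 rI < 2 ^ w" using c(2) q(2) by auto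
    have x: "reg c1 rT < 2 ^ w" using 1 xs_less[of "off + i"] pow_b_le by (simp add: less_le_trans)
    show "tr (load_push wd) 19 c1 ?Q"
    proof (rule triple_mono[OF load_push_triple[OF f x i0]])
      fix c' assume 2: "frame wd {rI} {vX, vY, vL, vT} ({base} \<inter> extra) c1 c' \<and>
        vreg wd c' vX = or (shr_bits (vreg wd c1 vX) b) (shl_bits N (reg c1 rT) ((q - 1) * b)) \<and>
        vreg wd c' vY = or (shr_bits (vreg wd c1 vY) b) (shl_bits N (\<sigma> + 1) ((q - 1) * b)) \<and>
        vreg wd c' vL = or (shr_bits (vreg wd c1 vL) b) (shl_bits N 1 ((q - 1) * b)) \<and>
        reg c' rI = reg c1 rI - 1"
      have fr: "load_frame c c'"
        by (rule frame_trans[OF conjunct1[OF 1] conjunct1[OF 2]]) auto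
      have vv: "vreg wd c1 j = vreg wd c j" for j using 1 by (simp add: frame_def)
      have v: "vreg wd c vX = push_bit ((q - i) * b) (pack b i (\<lambda>k. xs (off + k)))"
        "vreg wd c vY = push_bit ((q - i) * b) (pack b i (\<lambda>_. \<sigma> + 1))"
        "vreg wd c vL = push_bit ((q - i) * b) (pack b i (\<lambda>_. 1))" using l' by blast+
      have b0: "0 < b" using b by simp
      have s: "(1::nat) < 2 ^ b" using b0 by (metis one_less_numeral_iff one_less_power semiring_norm(76))
      have "reg c' rXp = reg c1 rXp" "reg c' rXr = reg c1 rXr" using 2 by (simp_all add: frame_def)
      with 1 2 show "?Q c'" unfolding loading_def vv v i
        using fr pack_load[OF b0 c(2) qb(1), of "\<lambda>k. xs (off + k)"]
          pack_load[OF b0 c(2) qb(1), of "\<lambda>_. \<sigma> + 1"] pack_load[OF b0 c(2) qb(1), of "\<lambda>_. 1"]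
          xs_less \<sigma> s by simp
    qed auto
  qed simp
qed

lemma load_triple:
  assumes c: "fixed c" "reg c rXp = take_bit w (up + min off (length U))" "reg c rXr = length U - off"
  shows "tr (load wd) (q * 26 + 5) c (\<lambda>c'.
    load_frame c c' \<and>
    reg c' rXp = take_bit w (up + min (off + q) (length U)) \<and> reg c' rXr = length U - (off + q) \<and>
    vreg wd c' vX = pack b q (\<lambda>k. xs (off + k)) \<and>
    vreg wd c' vY = pack b q (\<lambda>_. \<sigma> + 1) \<and> vreg wd c' vL = flags b q (\<lambda>_. True))"
proof -
  define Inv where "Inv = (\<lambda>r c'. r \<le> q \<and>
    load_frame c c' \<and> loading off (q - r) c')"
  have "tr (load wd) (q * 26 + 5) c (Inv 0)"
    unfolding load_def
  proof (rule triple_Seq)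
    have "reg c rQ = q" "reg c rZero = 0" using c(1) unfolding fixed_def by simp_all
    then show "tr (load_init wd) 4 c (Inv q)"
      unfolding load_init_def Inv_def loading_def using c(2,3) q
      by (intro triple_Blk; cases wd) (simp_all add: vinstr_defs add_bits_eq frame_def)
    fix c1 assume "Inv q c1"
    then show "tr (While rI (load_next ;; load_push wd)) (q * (24 + 2) + 1) c1 (Inv 0)"
    proof (rule triple_While)
      fix r c1 assume I: "Inv (Suc r) c1"
      define i where "i = q - Suc r"
      have i: "i < q" "q - Suc r = i" "q - r = Suc i" "r \<le> q" using I by (auto simp: i_def Inv_def)
      note I' = I[unfolded Inv_def i(2)]
      have fr: "load_frame c c1"
        and l: "loading off i c1" using I' by blast+
      have f: "fixed c1" by (rule fixed_frame[OF c(1) fr]) auto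
      have "tr (load_next ;; load_push wd) 24 c1 (Inv r)"
      proof (rule triple_mono[OF load_body_triple[OF f i(1) l]])
        fix c' assume 2: "load_frame c1 c' \<and>
          loading off (Suc i) c'"
        have "load_frame c c'"
          by (rule frame_trans[OF fr conjunct1[OF 2]]) auto
        with 2 i(4) show "Inv r c'" unfolding Inv_def i(3) by blast
      qed auto
      moreover have "reg c1 rI = q - i" using l unfolding loading_def by blast
      ultimately show "reg c1 rI \<noteq> 0 \<and> tr (load_next ;; load_push wd) 24 c1 (Inv r)" using i(1) by simp
    next
      show "Inv 0 c \<Longrightarrow> reg c rI = 0" for c unfolding Inv_def loading_def by simp
    qed simp
  qed simp
  then show ?thesis
    by (rule triple_mono) (simp_all add: Inv_def loading_def flags_def)
qed

section \<open>One step of the stream\<close>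

text \<open>Values of the cells after \<open>\<tau>\<close> steps of the stream: cell \<open>i\<close> has processed the symbols
  \<open>ys j\<close> with \<open>j < \<tau> - i\<close>, and its stream fields hold symbol \<open>\<tau> - 1 - i\<close> if there is one.\<close>

definition "yf \<tau> i = (if i < \<tau> then ys (\<tau> - 1 - i) else \<sigma> + 1)"

text \<open>The bit that leaves cell \<open>i\<close>, on row \<open>off + i + 1\<close>; the
  entering bit \<open>ps\<close> is on row \<open>off + i\<close>. Both are \<open>0\<close> when
  they accompany padding.\<close>

definition "pf off \<tau> i \<longleftrightarrow> i < \<tau> \<and> \<tau> - 1 - i < length V \<and> dif_y xs ys (off + i + 1) (\<tau> - 1 - i)"

text \<open>The \<open>min\<close> freezes the bit once all of \<open>V\<close> has passed the
  cell.\<close>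

definition "af off \<tau> i \<longleftrightarrow> dif_x xs ys (off + i) (min (\<tau> - i) (length V))"

definition "pin off \<tau> \<longleftrightarrow> \<tau> < length V \<and> dif_y xs ys off \<tau>"

definition "ps off \<tau> i = (if i = 0 then pin off \<tau> else pf off \<tau> (i - 1))"

lemma yf_Suc: "yf (Suc \<tau>) = (\<lambda>i. if i = 0 then ys \<tau> else yf \<tau> (i - 1))"
  by (rule ext) (auto simp: yf_def)

lemma yf_less: "yf \<tau> i < 2 ^ b"
  using ys_less \<sigma> by (simp add: yf_def)

lemma xs_ne: "xs i \<noteq> \<sigma> + 1"
  using xs_le[of i] by simp

lemma ps_eq: "ps off \<tau> i \<longleftrightarrow> i \<le> \<tau> \<and> \<tau> - i < length V \<and> dif_y xs ys (off + i) (\<tau> - i)"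
  by (cases i) (auto simp: ps_def pin_def pf_def)

lemma yf_Suc_eq: "yf (Suc \<tau>) i = (if i \<le> \<tau> then ys (\<tau> - i) else \<sigma> + 1)"
  by (auto simp: yf_def)

text \<open>A cell that faces a symbol of \<open>V\<close> follows the recurrences. Otherwise it
  faces padding, which matches nothing, and its entering bit is \<open>0\<close>; the same formulas
  then keep the stored bit and emit \<open>0\<close>. Idle cells therefore need no test.\<close>

lemma cell_Suc:
  "af off (Suc \<tau>) i \<longleftrightarrow> (xs (off + i) = yf (Suc \<tau>) i \<or> af off \<tau> i) \<and> \<not> ps off \<tau> i" (is ?A)
  "pf off (Suc \<tau>) i \<longleftrightarrow> (xs (off + i) = yf (Suc \<tau>) i \<or> ps off \<tau> i) \<and> \<not> af off \<tau> i" (is ?P)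
proof -
  have "?A \<and> ?P"
  proof (cases "i \<le> \<tau> \<and> \<tau> - i < length V")
    case True
    then have "min (Suc \<tau> - i) (length V) = Suc (\<tau> - i)" "min (\<tau> - i) (length V) = \<tau> - i" by auto
    with True show ?thesis
      by (simp add: af_def pf_def ps_eq yf_Suc_eq dif_x_Suc dif_y_Suc less_Suc_eq_le)
  next
    case False
    then have "yf (Suc \<tau>) i = \<sigma> + 1" by (auto simp: yf_Suc_eq ys_ne)
    moreover have "min (Suc \<tau> - i) (length V) = min (\<tau> - i) (length V)" using False by auto
    ultimately show ?thesis using False xs_ne[of "off + i"] unfolding af_def pf_def ps_eq by auto
  qed
  then show ?A ?P by auto
qed

text \<open>A word holds \<open>2 ^ k\<close> boundary bits instead of \<open>w\<close>, so that
  quotient and remainder are a shift and a mask.\<close>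

definition "bnd c j = bit (mem c (base + 1 + j div 2 ^ k)) (j mod 2 ^ k)"

lemma bnd_address:
  assumes wd "j < length V"
  shows "base + 1 + j div 2 ^ k < 2 ^ w" "base + 1 + j div 2 ^ k \<in> extra"
proof -
  have "j div 2 ^ k \<le> (length V - 1) div 2 ^ k" using assms(2) by (intro div_le_mono) simp
  then show "base + 1 + j div 2 ^ k < 2 ^ w" "base + 1 + j div 2 ^ k \<in> extra"
    using wide(2)[OF assms(1)] assms(1) unfolding extra_def by auto
qed

lemma bnd_frame: "frame wd S T ({base} \<inter> extra) c c' \<Longrightarrow> bnd c' j = bnd c j"
  by (simp add: bnd_def frame_def)

lemma and_of_bool: "and x (of_bool P) = (of_bool (odd x \<and> P) :: nat)"
  by (cases P) (simp_all add: and_one_eq mod_2_eq_odd)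

lemma get_bit_triple:
  assumes "fixed c" "reg c rJ = j" "j < length V" "reg c rF = of_bool (off \<noteq> 0)"
    and "wd \<Longrightarrow> off \<noteq> 0 \<Longrightarrow> bnd c j = dif_y xs ys off j" "\<not> wd \<Longrightarrow> off = 0"
  shows "tr (Blk (get_bit wd)) 6 c (\<lambda>c'. frame wd {rPin, rT2} {} {} c c' \<and> reg c' rPin = of_bool (pin off j))"
proof (rule triple_Blk)
  \<comment> \<open>For \<open>off = 0\<close> the masked bit is \<open>0\<close>, which agrees with
    \<open>dif_y_0\<close>.\<close>
  have "bnd c j \<and> off \<noteq> 0 \<longleftrightarrow> pin off j" if wd
    using assms(3,5) that by (cases "off = 0") (auto simp: pin_def)
  then have *: "odd (drop_bit (j mod 2 ^ k) (mem c (base + 1 + j div 2 ^ k))) \<and> 0 < off \<longleftrightarrow> pin off j" if wd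
    using that by (simp add: bnd_def bit_iff_odd_drop_bit)
  show "rn (get_bit wd) c
    (\<lambda>c'. frame wd {rPin, rT2} {} {} c c' \<and> reg c' rPin = of_bool (pin off j))"
  proof (cases wd)
    case True
    have "reg c rK = k" "reg c rKm = mask k" "reg c rBB = base + 1"
      using assms(1) True unfolding fixed_def by auto
    moreover have "and j (mask k) = j mod 2 ^ k" by (simp add: take_bit_eq_mod flip: take_bit_eq_mask)
    moreover note bnd_address[OF True assms(3)] * [OF True]
    ultimately show ?thesis using assms(2,4)
      by (simp add: get_bit_def True shr_bits_def drop_bit_eq_div[of k] add_bits_eq add.commute and_of_bool
          frame_def vreg_def add.left_commute)
  next
    case False
    then show ?thesis using assms(6) by (simp add: get_bit_def pin_def frame_def vreg_def)
  qed
qed (simp add: get_bit_def)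

lemma put_bit_triple:
  assumes "fixed c" "reg c rO = j" "j < length V" "reg c rT = of_bool v"
  shows "tr (Blk (put_bit wd)) 10 c (\<lambda>c'. frame wd {rA, rT2, rT3, rT4} {} extra c c' \<and>
    (wd \<longrightarrow> (\<forall>i. bnd c' i = (if i = j then v else bnd c i))))"
proof (rule triple_Blk)
  show "rn (put_bit wd) c (\<lambda>c'. frame wd {rA, rT2, rT3, rT4} {} extra c c' \<and>
    (wd \<longrightarrow> (\<forall>i. bnd c' i = (if i = j then v else bnd c i))))"
  proof (cases wd)
    case True
    let ?a = "base + 1 + j div 2 ^ k" and ?r = "j mod 2 ^ k"
    let ?x = "or (and (mem c ?a) (not_bits w (2 ^ ?r))) (shl_bits w (of_bool v) ?r)"
    have r: "?r < 2 ^ k" "2 ^ k \<le> w" using wide(1)[OF True] by auto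
    then have rw: "?r < w" by (rule less_le_trans)
    then have pw: "(2::nat) ^ ?r < 2 ^ w" by simp
    have "bit ?x i \<longleftrightarrow> (if i = ?r then v else bit (mem c ?a) i)" if "i < w" for i
      using that by (auto simp: bit_or_iff bit_and_iff bit_not_bits[OF pw] bit_shl_bits bit_of_bool_iff
          bit_exp_iff)
    then have *: "bit ?x (i mod 2 ^ k) \<longleftrightarrow> (if i mod 2 ^ k = ?r then v else bit (mem c ?a) (i mod 2 ^ k))" for i
      using r(2) by (meson less_le_trans mod_less_divisor pos2 zero_less_power)
    have bnd: "bit (((mem c)(?a := ?x)) (base + 1 + i div 2 ^ k)) (i mod 2 ^ k) \<longleftrightarrow> (if i = j then v else bnd c i)" for i
    proof (cases "i div 2 ^ k = j div 2 ^ k")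
      case True
      then have "i mod 2 ^ k = ?r \<longleftrightarrow> i = j" by (metis div_mult_mod_eq)
      then show ?thesis using * [of i] True unfolding bnd_def by auto
    qed (auto simp: bnd_def)
    have "reg c rK = k" "reg c rKm = mask k" "reg c rBB = base + 1" "reg c rOne = 1"
      using assms(1) True unfolding fixed_def by auto
    moreover have "and j (mask k) = ?r" by (simp add: take_bit_eq_mod flip: take_bit_eq_mask)
    moreover have "shl_bits w 1 ?r = 2 ^ ?r"
      using pw by (simp add: shl_bits_def push_bit_eq_mult take_bit_nat_eq_self)
    moreover note bnd_address[OF True assms(3)] bnd
    ultimately show ?thesis using assms(2,4)
      by (simp add: put_bit_def True shr_bits_def drop_bit_eq_div[of k] add_bits_eq add.commute
          frame_def vreg_def add.left_commute bnd_def)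
  next
    case False
    then show ?thesis by (simp add: put_bit_def frame_def)
  qed
qed (simp add: put_bit_def)

lemma stream_next_triple:
  assumes "fixed c" "reg c rYp = take_bit w (vp + min \<tau> (length V))" "reg c rYr = length V - \<tau>"
    "reg c rJ = min \<tau> (length V)" "reg c rF = of_bool (off \<noteq> 0)"
    and "wd \<Longrightarrow> off \<noteq> 0 \<Longrightarrow> \<tau> < length V \<Longrightarrow> bnd c \<tau> = dif_y xs ys off \<tau>" "\<not> wd \<Longrightarrow> off = 0"
  shows "tr (stream_next wd) 12 c (\<lambda>c'. frame wd {rT, rPin, rYp, rYr, rJ, rT2} {} {} c c' \<and>
    reg c' rT = ys \<tau> \<and> reg c' rPin = of_bool (pin off \<tau>) \<and>
    reg c' rYp = take_bit w (vp + min (Suc \<tau>) (length V)) \<and> reg c' rYr = length V - Suc \<tau> \<and>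
    reg c' rJ = min (Suc \<tau>) (length V))" (is "tr _ _ _ ?Q")
  unfolding stream_next_def
proof (rule triple_IfZ[where K = 10])
  assume "reg c rYr = 0"
  then have j: "length V \<le> \<tau>" using assms by simp
  have "reg c rZero = 0" "reg c rYpad = \<sigma> + 1" using assms(1) unfolding fixed_def by simp_all
  then show "tr (Blk [Add rT rYpad rZero, LoadImm rPin 0]) 10 c ?Q"
    using j assms \<sigma>_less
    by (intro triple_Blk) (auto simp: add_bits_eq frame_def vreg_def ys_ne pin_def)
next
  assume "reg c rYr \<noteq> 0"
  then have j: "\<tau> < length V" using assms by simp
  have one: "reg c rOne = 1" "mem c (vp + \<tau>) = V ! \<tau>" using assms(1) j unfolding fixed_def by simp_all
  have 2: "reg c rYp = vp + \<tau>" using assms(2) j V(3) by (simp add: take_bit_word)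
  have 3: "vp + \<tau> \<in> input \<union> extra" using j by (simp add: input_def)
  have n: "length V - \<tau> < 2 ^ w" using V(2) by simp
  show "tr (Blk [LoadInd rT rYp, Add rYp rYp rOne, Sub rYr rYr rOne] ;;
      Blk (get_bit wd) ;; Blk [Add rJ rJ rOne]) 10 c ?Q"
  proof (rule triple_Seq)
    show "tr (Blk [LoadInd rT rYp, Add rYp rYp rOne, Sub rYr rYr rOne]) 3 c
      (\<lambda>c'. frame wd {rT, rYp, rYr} {} {} c c' \<and> reg c' rT = ys \<tau> \<and>
        reg c' rYp = take_bit w (vp + Suc \<tau>) \<and> reg c' rYr = length V - Suc \<tau>)"
      using j one 2 3 assms(3) n
      by (intro triple_Blk) (auto simp: sub_bits_eq add_bits_def frame_def vreg_def ys_def)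
    fix c1 assume 4: "frame wd {rT, rYp, rYr} {} {} c c1 \<and> reg c1 rT = ys \<tau> \<and>
        reg c1 rYp = take_bit w (vp + Suc \<tau>) \<and> reg c1 rYr = length V - Suc \<tau>"
    have f: "fixed c1" by (rule fixed_frame[OF assms(1) conjunct1[OF 4]]) auto
    have r: "reg c1 rJ = \<tau>" "reg c1 rF = of_bool (off \<noteq> 0)" "bnd c1 \<tau> = bnd c \<tau>"
      using 4 assms(4,5) j by (auto simp: frame_def bnd_def)
    have b: "bnd c1 \<tau> = dif_y xs ys off \<tau>" if wd "off \<noteq> 0" using assms(6)[OF that j] r by simp
    show "tr (Blk (get_bit wd) ;; Blk [Add rJ rJ rOne]) 7 c1 ?Q"
    proof (rule triple_Seq[OF get_bit_triple[OF f r(1) j r(2) b assms(7)]])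
      fix c2 assume 5: "frame wd {rPin, rT2} {} {} c1 c2 \<and> reg c2 rPin = of_bool (pin off \<tau>)"
      have fr: "frame wd {rT, rPin, rYp, rYr, rT2} {} {} c c2"
        by (rule frame_trans[OF conjunct1[OF 4] conjunct1[OF 5]]) auto
      have "reg c2 rJ = \<tau>" "reg c2 rOne = 1" "reg c2 rT = ys \<tau>" "reg c2 rYr = length V - Suc \<tau>"
        "reg c2 rYp = take_bit w (vp + Suc \<tau>)"
        using 4 5 r one by (auto simp: frame_def)
      then show "tr (Blk [Add rJ rJ rOne]) 1 c2 ?Q"
        using 5 fr j V(2) by (intro triple_Blk) (auto simp: add_bits_eq frame_def vreg_def)
    qed auto
  qed simp
qed simp

lemma stream_shift_triple:
  assumes "fixed c" "reg c rT = yv" "yv < 2 ^ b" "reg c rPin = of_bool pv"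
    "vreg wd c vL = flags b q (\<lambda>_. True)" "vreg wd c vP = flags b q p"
    "take_bit (q * b) (vreg wd c vY) = pack b q y" "\<And>k. k < q \<Longrightarrow> y k < 2 ^ b"
  shows "tr (stream_shift wd) 11 c (\<lambda>c'. frame wd {} {vY, vP, vT} ({base} \<inter> extra) c c' \<and>
    vreg wd c' vY < 2 ^ N \<and>
    take_bit (q * b) (vreg wd c' vY) = pack b q (\<lambda>k. if k = 0 then yv else y (k - 1)) \<and>
    vreg wd c' vP = flags b q (\<lambda>k. if k = 0 then pv else p (k - 1)))" (is "tr _ _ _ ?Q")
  unfolding stream_shift_def
proof (rule triple_Seq)
  let ?Y = "\<lambda>c'. frame wd {} {vY, vT} ({base} \<inter> extra) c c' \<and>
    vreg wd c' vY = or (shl_bits N (vreg wd c vY) b) yv"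
  have b0: "0 < b" using b by simp
  have N: "yv < 2 ^ N" "yv < 2 ^ w" using assms(3) pow_b_le pow_N by linarith+
  have B: "reg c rB = b" using assms(1) unfolding fixed_def by simp
  show "tr (Blk (vShl wd vY vY rB # lift wd rT @ [vOr wd vY vY vT])) 5 c ?Y"
  proof (rule triple_Blk)
    \<comment> \<open>Naming the configuration after the first instruction makes
      \<open>lift_runs\<close> applicable to the remaining list.\<close>
    define c0 where "c0 = (case exec_instr w (vShl wd vY vY rB) c of Some c' \<Rightarrow> c' | None \<Rightarrow> c)"
    have c0: "exec_instr w (vShl wd vY vY rB) c = Some c0" "frame wd {} {vY} {} c c0"
      "vreg wd c0 vY = shl_bits N (vreg wd c vY) b"
      using B by (cases wd; simp add: c0_def vinstr_defs frame_def)+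
    have f0: "fixed c0" by (rule fixed_frame[OF assms(1) c0(2)]) auto
    have r0: "reg c0 rT = yv" using c0(2) assms(2) by (simp add: frame_def)
    have "rn (lift wd rT @ [vOr wd vY vY vT]) c0 ?Y"
    proof (rule lift_runs[OF f0])
      fix c1 assume 1: "frame wd {} {vT} ({base} \<inter> extra) c0 c1" "vreg wd c1 vT = reg c0 rT"
      have fr: "frame wd {} {vY, vT} ({base} \<inter> extra) c c1"
        by (rule frame_trans[OF c0(2) 1(1)]) auto
      have "vreg wd c1 vY = shl_bits N (vreg wd c vY) b" using 1(1) c0(3) by (simp add: frame_def)
      with fr 1(2) r0 show "rn [vOr wd vY vY vT] c1 ?Y"
        by (cases wd) (simp_all add: vinstr_defs frame_def)
    qed (use r0 N in auto)
    with c0(1) show "rn (vShl wd vY vY rB # lift wd rT @ [vOr wd vY vY vT]) c ?Y"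
      by (simp add: vShl_def split: if_splits)
  qed (simp add: lift_def)
  fix c1 assume 1: "frame wd {} {vY, vT} ({base} \<inter> extra) c c1 \<and>
    vreg wd c1 vY = or (shl_bits N (vreg wd c vY) b) yv"
  have f1: "fixed c1" by (rule fixed_frame[OF assms(1) conjunct1[OF 1]]) auto
  have B1: "reg c1 rB = b" using f1 unfolding fixed_def by simp
  have v1: "vreg wd c1 vP = flags b q p" "vreg wd c1 vL = flags b q (\<lambda>_. True)" "reg c1 rPin = of_bool pv"
    using 1 assms(4-6) by (simp_all add: frame_def)
  show "tr (Blk ([vShl wd vP vP rB, vAnd wd vP vP vL] @ lift wd rPin @ [vOr wd vP vP vT])) 6 c1 ?Q"
  proof (rule triple_Blk)
    let ?P = "and (shl_bits N (flags b q p) b) (flags b q (\<lambda>_. True))"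
    show "rn ([vShl wd vP vP rB, vAnd wd vP vP vL] @ lift wd rPin @ [vOr wd vP vP vT]) c1 ?Q"
      unfolding runs_append
    proof (rule runs_mono)
      show "rn [vShl wd vP vP rB, vAnd wd vP vP vL] c1
        (\<lambda>c'. frame wd {} {vP} {} c1 c' \<and> vreg wd c' vP = ?P)"
        using B1 v1 by (cases wd) (simp_all add: vinstr_defs frame_def)
      fix c2 assume 2: "frame wd {} {vP} {} c1 c2 \<and> vreg wd c2 vP = ?P"
      have f2: "fixed c2" by (rule fixed_frame[OF f1 conjunct1[OF 2]]) auto
      have r2: "reg c2 rPin = of_bool pv" using 2 v1 by (simp add: frame_def)
      show "rn (lift wd rPin) c2
        (\<lambda>c'. rn [vOr wd vP vP vT] c' ?Q)"
        unfolding runs_append[symmetric]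
      proof (rule lift_runs[OF f2])
        fix c3 assume 3: "frame wd {} {vT} ({base} \<inter> extra) c2 c3" "vreg wd c3 vT = reg c2 rPin"
        have fr: "frame wd {} {vY, vP, vT} ({base} \<inter> extra) c c3"
          by (rule frame_trans[OF frame_trans[OF conjunct1[OF 1] conjunct1[OF 2]
            order_refl order_refl order_refl] 3(1)]) auto
        have v3: "vreg wd c3 vP = ?P" "vreg wd c3 vT = of_bool pv"
          "vreg wd c3 vY = or (shl_bits N (vreg wd c vY) b) yv"
          using 1 2 3 r2 by (simp_all add: frame_def)
        have Q: "or ?P (of_bool pv) = flags b q (\<lambda>k. if k = 0 then pv else p (k - 1))"
          "take_bit (q * b) (or (shl_bits N (vreg wd c vY) b) yv) =
            pack b q (\<lambda>k. if k = 0 then yv else y (k - 1))"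
          "or (shl_bits N (vreg wd c vY) b) yv < 2 ^ N"
          by (rule flags_shift[OF b0 q(1) qb(1)] pack_shift[OF b0 q(1) qb(1) assms(7,8,3)]
              or_less shl_bits_less N(1) | assumption)+
        show "rn [vOr wd vP vP vT] c3 ?Q"
          using fr Q v3 by (cases wd) (simp_all add: vinstr_defs frame_def)
      qed (use r2 one_less_pow in auto)
    qed
  qed (simp add: lift_def)
qed simp

lemma cells_eq_triple:
  assumes "fixed c" "vreg wd c vL = flags b q (\<lambda>_. True)" "vreg wd c vM = pack b q (\<lambda>_. 2 ^ (b - 1) - 1)"
    "vreg wd c vX = pack b q x" "\<And>k. k < q \<Longrightarrow> x k < 2 ^ b"
    "take_bit (q * b) (vreg wd c vY) = pack b q y" "\<And>k. k < q \<Longrightarrow> y k < 2 ^ b" "vreg wd c vY < 2 ^ N"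
  shows "tr (cells_eq wd) 11 c (\<lambda>c'. frame wd {} {vT, vZ, vE} {} c c' \<and>
    vreg wd c' vE = flags b q (\<lambda>k. x k = y k))"
  unfolding cells_eq_def
proof (rule triple_Blk, goal_cases)
  case 1
  have b0: "0 < b" using b by simp
  have "reg c rB1 = b - 1" using assms(1) unfolding fixed_def by simp
  then show ?case
    using flags_eq[OF b0 qb(1) assms(5,7,6,8) refl refl refl] assms(2-4)
    by (cases wd) (simp_all add: vinstr_defs frame_def)
qed simp

lemma cells_step_triple:
  assumes "fixed c" "vreg wd c vE = flags b q e" "vreg wd c vA = flags b q a" "vreg wd c vP = flags b q p"
  shows "tr (cells_step wd) 10 c (\<lambda>c'. frame wd {rT} {vT, vZ, vP, vA} ({base} \<inter> extra) c c' \<and>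
    vreg wd c' vA = flags b q (\<lambda>k. (e k \<or> a k) \<and> \<not> p k) \<and>
    vreg wd c' vP = flags b q (\<lambda>k. (e k \<or> p k) \<and> \<not> a k) \<and>
    reg c' rT = of_bool ((e (q - 1) \<or> p (q - 1)) \<and> \<not> a (q - 1)))" (is "tr _ _ _ ?Q")
  unfolding cells_step_def
proof (rule triple_Blk)
  have b0: "0 < b" using b by simp
  let ?p = "\<lambda>k. (e k \<or> p k) \<and> \<not> a k"
  let ?is = "[vNot wd vT vP, vOr wd vZ vE vA, vAnd wd vZ vZ vT, vOr wd vP vE vP,
     vNot wd vT vA, vAnd wd vP vP vT, vOr wd vA vZ vZ, vShr wd vT vP rSh]"
  have "reg c rSh = (q - 1) * b" using assms(1) unfolding fixed_def by simp
  then have 1: "rn ?is c (\<lambda>c'. frame wd {} {vT, vZ, vP, vA} {} c c' \<and>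
    vreg wd c' vA = flags b q (\<lambda>k. (e k \<or> a k) \<and> \<not> p k) \<and> vreg wd c' vP = flags b q ?p \<and>
    vreg wd c' vT = of_bool (?p (q - 1)))"
    using flags_cell_x[OF b0 qb(1), of e a p] flags_cell_x[OF b0 qb(1), of e p a] assms(2-4)
      flags_extract[OF b0 q(1), of ?p]
    by (cases wd) (simp_all add: vinstr_defs frame_def)
  show "rn (?is @ lower wd rT) c ?Q"
    unfolding runs_append
  proof (rule runs_mono[OF 1])
    fix c1 assume 2: "frame wd {} {vT, vZ, vP, vA} {} c c1 \<and>
      vreg wd c1 vA = flags b q (\<lambda>k. (e k \<or> a k) \<and> \<not> p k) \<and> vreg wd c1 vP = flags b q ?p \<and>
      vreg wd c1 vT = of_bool (?p (q - 1))"
    have f1: "fixed c1" by (rule fixed_frame[OF assms(1) conjunct1[OF 2]]) auto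
    have w0: "0 < w" using w by simp
    have t: "take_bit w (of_bool P) = (of_bool P :: nat)" for P
      using w0 by (cases P) auto
    show "rn (lower wd rT) c1 ?Q"
    proof (cases wd)
      case True
      have "reg c1 rScr = base" "reg c1 rZero = 0" using f1 True unfolding fixed_def by auto
      moreover have "base \<in> extra" "{base} \<inter> extra = {base}" using base_in[OF True] by auto
      ultimately show ?thesis using 2 w0 True t
        by (simp add: lower_def vreg_def block_0 frame_def)
    next
      case False
      have "reg c1 rZero = 0" using f1 unfolding fixed_def by auto
      then show ?thesis using 2 w0 False t one_less_pow
        by (simp add: lower_def vreg_def add_bits_def frame_def)
    qed
  qed
qed (simp add: lower_def)

end

text \<open>Keeps the running count in \<open>rCnt\<close> below the length of the streamed string,
  so it cannot overflow.\<close>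

lemma lcs_tab_le: "lcs_tab x y i j \<le> j"
proof (induction j)
  case (Suc j)
  then show ?case using lcs_tab_step[of x y i j] by linarith
qed simp

lemma vreg_set_reg [simp]: "d < 100 \<Longrightarrow> vreg wd (set_reg d x c) i = vreg wd c i"
  by (simp add: vreg_def)

section \<open>Complete strips and passes\<close>

context lcs_machine
begin

text \<open>After \<open>\<tau>\<close> steps the last cell has seen \<open>Suc \<tau> - q\<close>
  symbols. The boundary array is updated in place: that many positions already hold row
  \<open>off + q\<close>, the others still hold row \<open>off\<close>. Since \<open>q\<close> is
  positive, the write position never overtakes the read position, and within a step reading precedes
  writing.\<close>

definition strm :: "nat \<Rightarrow> nat \<Rightarrow> config \<Rightarrow> bool" where
  "strm off \<tau> c \<longleftrightarrow> fixed c \<and> vreg wd c vX = pack b q (\<lambda>i. xs (off + i)) \<and>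
     vreg wd c vL = flags b q (\<lambda>_. True) \<and> vreg wd c vM = pack b q (\<lambda>_. 2 ^ (b - 1) - 1) \<and>
     vreg wd c vY < 2 ^ N \<and> take_bit (q * b) (vreg wd c vY) = pack b q (yf \<tau>) \<and>
     vreg wd c vA = flags b q (af off \<tau>) \<and> vreg wd c vP = flags b q (pf off \<tau>) \<and>
     reg c rYp = take_bit w (vp + min \<tau> (length V)) \<and> reg c rYr = length V - \<tau> \<and>
     reg c rJ = min \<tau> (length V) \<and> reg c rO = Suc \<tau> - q \<and> reg c rOr = length V - (Suc \<tau> - q) \<and>
     reg c rLag = q - 1 - \<tau> \<and> reg c rCnt = D (off + q) (Suc \<tau> - q) \<and> reg c rF = of_bool (off \<noteq> 0) \<and>
     (wd \<longrightarrow> (\<forall>j < length V. if j < Suc \<tau> - q then bnd c j = dif_y xs ys (off + q) j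
        else off \<noteq> 0 \<longrightarrow> bnd c j = dif_y xs ys off j))"

lemma stream_out_triple:
  assumes c: "fixed c" "reg c rO = Suc \<tau> - q" "reg c rOr = length V - (Suc \<tau> - q)" "reg c rLag = q - 1 - \<tau>"
      "reg c rCnt = D (off + q) (Suc \<tau> - q)" "reg c rT = of_bool (pf off (Suc \<tau>) (q - 1))"
    and \<tau>: "Suc \<tau> - q < length V"
  shows "tr (stream_out wd) 15 c (\<lambda>c'. frame wd {rA, rT2, rT3, rT4, rCnt, rO, rOr, rLag} {} extra c c' \<and>
     reg c' rO = Suc (Suc \<tau>) - q \<and> reg c' rOr = length V - (Suc (Suc \<tau>) - q) \<and>
     reg c' rLag = q - 1 - Suc \<tau> \<and> reg c' rCnt = D (off + q) (Suc (Suc \<tau>) - q) \<and>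
     (wd \<longrightarrow> (\<forall>j. bnd c' j = (if q \<le> Suc \<tau> \<and> j = Suc \<tau> - q then dif_y xs ys (off + q) j else bnd c j))))"
    (is "tr _ _ _ ?Q")
  unfolding stream_out_def
proof (rule triple_IfZ[where K = 13])
  assume "reg c rLag = 0"
  then have q': "q \<le> Suc \<tau>" using c(4) by simp
  define o' where "o' = Suc \<tau> - q"
  have o': "Suc \<tau> - q = o'" "Suc (Suc \<tau>) - q = Suc o'" "q - 1 - Suc \<tau> = 0" "o' < length V"
    using q' \<tau> by (auto simp: o'_def)
  \<comment> \<open>The bit leaving cell \<open>q - 1\<close> lies on the first row behind the
    strip.\<close>
  have "pf off (Suc \<tau>) (q - 1) = dif_y xs ys (off + q) o'"
  proof -
    have "Suc \<tau> - 1 - (q - 1) = o'" "off + (q - 1) + 1 = off + q" "q - 1 < Suc \<tau>"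
      using q(1) q' by (auto simp: o'_def)
    then show ?thesis using o'(4) unfolding pf_def by simp
  qed
  then have T: "reg c rT = of_bool (dif_y xs ys (off + q) o')" using c(6) by simp
  show "tr (Blk (put_bit wd) ;; Blk [Add rCnt rCnt rT, Add rO rO rOne, Sub rOr rOr rOne]) 13 c ?Q"
  proof (rule triple_Seq[OF put_bit_triple[OF c(1) c(2)[unfolded o'(1)] o'(4) T]])
    fix c1 assume 1: "frame wd {rA, rT2, rT3, rT4} {} extra c c1 \<and>
      (wd \<longrightarrow> (\<forall>i. bnd c1 i = (if i = o' then dif_y xs ys (off + q) o' else bnd c i)))"
    have "reg c rOne = 1" using c(1) unfolding fixed_def by simp
    with 1 T c o' have r: "reg c1 rOne = 1" "reg c1 rT = of_bool (dif_y xs ys (off + q) o')"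
      "reg c1 rCnt = D (off + q) o'" "reg c1 rO = o'" "reg c1 rOr = length V - o'"
      "reg c1 rLag = 0" using \<open>reg c rLag = 0\<close> by (simp_all add: frame_def)
    have lt: "Suc o' < 2 ^ w" "length V - o' < 2 ^ w" "D (off + q) o' + of_bool (dif_y xs ys (off + q) o') < 2 ^ w"
      using V(2) o'(4) lcs_tab_le[of xs ys "off + q" "Suc o'"] by (simp_all add: lcs_tab_Suc_right)
    show "tr (Blk [Add rCnt rCnt rT, Add rO rO rOne, Sub rOr rOr rOne]) 3 c1 ?Q"
    proof (rule triple_Blk)
      show "rn [Add rCnt rCnt rT, Add rO rO rOne, Sub rOr rOr rOne] c1 ?Q"
        unfolding o' using r lt 1 o'(4) q'
        by (simp add: add_bits_eq sub_bits_eq lcs_tab_Suc_right) (simp add: frame_def bnd_def)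
    qed simp
  qed simp
next
  assume l: "reg c rLag \<noteq> 0"
  then have q': "\<not> q \<le> Suc \<tau>" "Suc (Suc \<tau>) - q = 0" "Suc \<tau> - q = 0" using c(4) by simp_all
  have "reg c rOne = 1" using c(1) unfolding fixed_def by simp
  moreover have "q - 1 - \<tau> < 2 ^ w" "1 \<le> q - 1 - \<tau>" using q(2) l c(4) by simp_all
  ultimately show "tr (Blk [Sub rLag rLag rOne]) 13 c ?Q"
    using c(2-5) q' by (intro triple_Blk) (simp_all add: sub_bits_eq frame_def vreg_def bnd_def)
qed simp

lemma stream_body_triple:
  assumes s: "strm off \<tau> c" and \<tau>: "Suc \<tau> - q < length V" and nw: "\<not> wd \<Longrightarrow> off = 0"
  shows "tr (stream_body wd) 60 c (\<lambda>c'. strm off (Suc \<tau>) c' \<and>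
    frame wd {rT, rPin, rYp, rYr, rJ, rA, rT2, rT3, rT4, rCnt, rO, rOr, rLag}
      {vY, vP, vT, vZ, vE, vA} extra c c')" (is "tr _ _ _ ?Q")
proof -
  note s' = s[unfolded strm_def]
  have c: "fixed c" "reg c rYp = take_bit w (vp + min \<tau> (length V))" "reg c rYr = length V - \<tau>"
    "reg c rJ = min \<tau> (length V)" "reg c rF = of_bool (off \<noteq> 0)"
    using s' by blast+
  have bn: "bnd c \<tau> = dif_y xs ys off \<tau>" if wd "off \<noteq> 0" "\<tau> < length V"
  proof -
    \<comment> \<open>The position about to be read has not been overwritten yet.\<close>
    have "\<not> \<tau> < Suc \<tau> - q" using q(1) by simp
    then show ?thesis using s' that by auto
  qed
  show ?thesis
    unfolding stream_body_def
  proof (rule triple_Seq[OF stream_next_triple[OF c bn nw]])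
    fix c1 assume 1: "frame wd {rT, rPin, rYp, rYr, rJ, rT2} {} {} c c1 \<and>
      reg c1 rT = ys \<tau> \<and> reg c1 rPin = of_bool (pin off \<tau>) \<and>
      reg c1 rYp = take_bit w (vp + min (Suc \<tau>) (length V)) \<and> reg c1 rYr = length V - Suc \<tau> \<and>
      reg c1 rJ = min (Suc \<tau>) (length V)"
    have f1: "fixed c1" by (rule fixed_frame[OF c(1) conjunct1[OF 1]]) auto
    have v1: "vreg wd c1 i = vreg wd c i" for i using 1 by (simp add: frame_def)
    have r1: "reg c1 rT = ys \<tau>" "reg c1 rPin = of_bool (pin off \<tau>)"
      and v1': "vreg wd c1 vL = flags b q (\<lambda>_. True)" "vreg wd c1 vP = flags b q (pf off \<tau>)"
      "take_bit (q * b) (vreg wd c1 vY) = pack b q (yf \<tau>)"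
      using 1 s' unfolding v1 by blast+
    show "tr (stream_shift wd ;; cells_eq wd ;; cells_step wd ;; stream_out wd) 47 c1 ?Q"
    proof (rule triple_Seq[OF stream_shift_triple[OF f1 r1(1) ys_less r1(2) v1' yf_less]])
      fix c2 assume 2: "frame wd {} {vY, vP, vT} ({base} \<inter> extra) c1 c2 \<and>
        vreg wd c2 vY < 2 ^ N \<and>
        take_bit (q * b) (vreg wd c2 vY) = pack b q (\<lambda>k. if k = 0 then ys \<tau> else yf \<tau> (k - 1)) \<and>
        vreg wd c2 vP = flags b q (\<lambda>k. if k = 0 then pin off \<tau> else pf off \<tau> (k - 1))"
      have f2: "fixed c2" by (rule fixed_frame[OF f1 conjunct1[OF 2]]) auto
      have v2: "vreg wd c2 i = vreg wd c i" if "i \<notin> {vY, vP, vT}" for i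
        using 2 that v1 unfolding frame_def by metis
      have v2': "vreg wd c2 vL = flags b q (\<lambda>_. True)" "vreg wd c2 vM = pack b q (\<lambda>_. 2 ^ (b - 1) - 1)"
        "vreg wd c2 vX = pack b q (\<lambda>i. xs (off + i))" "vreg wd c2 vA = flags b q (af off \<tau>)"
        using s' v2[of vL] v2[of vM] v2[of vX] v2[of vA] by simp_all
      have y2: "take_bit (q * b) (vreg wd c2 vY) = pack b q (yf (Suc \<tau>))" "vreg wd c2 vY < 2 ^ N"
        and p2: "vreg wd c2 vP = flags b q (ps off \<tau>)"
        using 2 unfolding yf_Suc ps_def[abs_def] by blast+
      show "tr (cells_eq wd ;; cells_step wd ;; stream_out wd) 36 c2 ?Q"
      proof (rule triple_Seq[OF cells_eq_triple[OF f2 v2'(1-3) xs_less y2(1) yf_less y2(2)]])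
        fix c3 assume 3: "frame wd {} {vT, vZ, vE} {} c2 c3 \<and>
          vreg wd c3 vE = flags b q (\<lambda>k. xs (off + k) = yf (Suc \<tau>) k)"
        have f3: "fixed c3" by (rule fixed_frame[OF f2 conjunct1[OF 3]]) auto
        have v3: "vreg wd c3 vA = flags b q (af off \<tau>)" "vreg wd c3 vP = flags b q (ps off \<tau>)"
          using 3 v2' p2 by (simp_all add: frame_def)
        show "tr (cells_step wd ;; stream_out wd) 25 c3 ?Q"
        proof (rule triple_Seq[OF cells_step_triple[OF f3 conjunct2[OF 3] v3]])
          fix c4 assume "frame wd {rT} {vT, vZ, vP, vA} ({base} \<inter> extra) c3 c4 \<and>
            vreg wd c4 vA = flags b q (\<lambda>k. (xs (off + k) = yf (Suc \<tau>) k \<or> af off \<tau> k) \<and> \<not> ps off \<tau> k) \<and>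
            vreg wd c4 vP = flags b q (\<lambda>k. (xs (off + k) = yf (Suc \<tau>) k \<or> ps off \<tau> k) \<and> \<not> af off \<tau> k) \<and>
            reg c4 rT = of_bool ((xs (off + (q - 1)) = yf (Suc \<tau>) (q - 1) \<or> ps off \<tau> (q - 1)) \<and>
              \<not> af off \<tau> (q - 1))"
          then have 4: "frame wd {rT} {vT, vZ, vP, vA} ({base} \<inter> extra) c3 c4"
            "vreg wd c4 vA = flags b q (af off (Suc \<tau>))" "vreg wd c4 vP = flags b q (pf off (Suc \<tau>))"
            "reg c4 rT = of_bool (pf off (Suc \<tau>) (q - 1))"
            unfolding cell_Suc[symmetric] by blast+
          have f4: "fixed c4" by (rule fixed_frame[OF f3 4(1)]) auto
          have fr12: "frame wd {rT, rPin, rYp, rYr, rJ, rT2} {vY, vP, vT} ({base} \<inter> extra) c c2"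
            by (rule frame_trans[OF conjunct1[OF 1] conjunct1[OF 2]]) auto
          have fr34: "frame wd {rT} {vT, vZ, vE, vP, vA} ({base} \<inter> extra) c2 c4"
            by (rule frame_trans[OF conjunct1[OF 3] 4(1)]) auto
          have fr: "frame wd {rT, rPin, rYp, rYr, rJ, rT2} {vY, vP, vT, vZ, vE, vA} ({base} \<inter> extra) c c4"
            by (rule frame_trans[OF fr12 fr34]) auto
          have r4: "reg c4 rO = Suc \<tau> - q" "reg c4 rOr = length V - (Suc \<tau> - q)"
            "reg c4 rLag = q - 1 - \<tau>" "reg c4 rCnt = D (off + q) (Suc \<tau> - q)" "reg c4 rF = of_bool (off \<noteq> 0)"
            using fr s' unfolding frame_def by simp_all
          have y4: "reg c4 rYp = take_bit w (vp + min (Suc \<tau>) (length V))"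
            "reg c4 rYr = length V - Suc \<tau>" "reg c4 rJ = min (Suc \<tau>) (length V)"
            using 1 2 fr34 unfolding frame_def by simp_all
          have v4: "vreg wd c4 vL = flags b q (\<lambda>_. True)" "vreg wd c4 vM = pack b q (\<lambda>_. 2 ^ (b - 1) - 1)"
            "vreg wd c4 vX = pack b q (\<lambda>i. xs (off + i))" "vreg wd c4 vY = vreg wd c2 vY"
            using v2' fr34 unfolding frame_def by simp_all
          have bnd4: "bnd c4 j = bnd c j" for j by (rule bnd_frame[OF fr])
          show "tr (stream_out wd) 15 c4 ?Q"
          proof (rule triple_mono[OF stream_out_triple[OF f4 r4(1-4) 4(4) \<tau>]])
            fix c5 assume 5: "frame wd {rA, rT2, rT3, rT4, rCnt, rO, rOr, rLag} {} extra c4 c5 \<and>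
              reg c5 rO = Suc (Suc \<tau>) - q \<and> reg c5 rOr = length V - (Suc (Suc \<tau>) - q) \<and>
              reg c5 rLag = q - 1 - Suc \<tau> \<and> reg c5 rCnt = D (off + q) (Suc (Suc \<tau>) - q) \<and>
              (wd \<longrightarrow> (\<forall>j. bnd c5 j = (if q \<le> Suc \<tau> \<and> j = Suc \<tau> - q then dif_y xs ys (off + q) j else bnd c4 j)))"
            have f5: "fixed c5" by (rule fixed_frame[OF f4 conjunct1[OF 5]]) auto
            have v5: "vreg wd c5 i = vreg wd c4 i" for i using 5 by (simp add: frame_def)
            have r5: "reg c5 rF = of_bool (off \<noteq> 0)"
              "reg c5 rYp = take_bit w (vp + min (Suc \<tau>) (length V))"
              "reg c5 rYr = length V - Suc \<tau>" "reg c5 rJ = min (Suc \<tau>) (length V)"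
              using 5 r4(5) y4 unfolding frame_def by simp_all
            have b5: "if j < Suc (Suc \<tau>) - q then bnd c5 j = dif_y xs ys (off + q) j
              else off \<noteq> 0 \<longrightarrow> bnd c5 j = dif_y xs ys off j" if wd "j < length V" for j
            proof -
              have "if j < Suc \<tau> - q then bnd c j = dif_y xs ys (off + q) j
                else off \<noteq> 0 \<longrightarrow> bnd c j = dif_y xs ys off j" using s' that by blast
              moreover have "bnd c5 j = (if q \<le> Suc \<tau> \<and> j = Suc \<tau> - q then dif_y xs ys (off + q) j else bnd c j)"
                using 5 that bnd4 by simp
              ultimately show ?thesis by (cases "j < Suc \<tau> - q"; cases "q \<le> Suc \<tau> \<and> j = Suc \<tau> - q") auto
            qed
            have fr5: "frame wd {rT, rPin, rYp, rYr, rJ, rA, rT2, rT3, rT4, rCnt, rO, rOr, rLag}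
              {vY, vP, vT, vZ, vE, vA} extra c c5"
              by (rule frame_trans[OF fr conjunct1[OF 5]]) auto
            show "?Q c5"
              unfolding strm_def v5 v4 using f5 4(2,3) y2 5 r5 b5 fr5 by blast
          qed auto
        qed simp
      qed simp
    qed simp
  qed auto
qed

text \<open>The state between two strips. After the last one \<open>off\<close> may exceed the
  length of \<open>U\<close>, hence the \<open>min\<close> and the truncated difference.\<close>

definition sinv :: "nat \<Rightarrow> config \<Rightarrow> bool" where
  "sinv off c \<longleftrightarrow> fixed c \<and> reg c rXp = take_bit w (up + min off (length U)) \<and>
     reg c rXr = length U - off \<and> reg c rF = of_bool (off \<noteq> 0) \<and> reg c rCnt = D off (length V) \<and>
     (wd \<longrightarrow> off \<noteq> 0 \<longrightarrow> (\<forall>j < length V. bnd c j = dif_y xs ys off j))"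

text \<open>\<open>q\<close> rounds of loading at \<open>24 + 2\<close> steps and
  \<open>length V + q - 1\<close> rounds of streaming at \<open>60 + 2\<close> steps, as the last
  symbol must still pass through the remaining \<open>q - 1\<close> cells.\<close>

definition "strip_time = q * 26 + (length V + q) * 62 + 20"

lemma strip_triple:
  assumes s: "sinv off c" and nw: "\<not> wd \<Longrightarrow> off = 0"
  shows "tr (strip wd) strip_time c (sinv (off + q))"
proof -
  note s' = s[unfolded sinv_def]
  have c: "fixed c" "reg c rXp = take_bit w (up + min off (length U))" "reg c rXr = length U - off"
    using s' by blast+
  have b0: "0 < b" using b by simp
  define F where "F = (\<lambda>c' :: config. reg c' rXp = take_bit w (up + min (off + q) (length U)) \<and>
    reg c' rXr = length U - (off + q))"
  show ?thesis unfolding strip_def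
  proof (rule triple_Seq[OF load_triple[OF c]])
    fix c1 assume 1: "load_frame c c1 \<and>
      reg c1 rXp = take_bit w (up + min (off + q) (length U)) \<and> reg c1 rXr = length U - (off + q) \<and>
      vreg wd c1 vX = pack b q (\<lambda>k. xs (off + k)) \<and>
      vreg wd c1 vY = pack b q (\<lambda>_. \<sigma> + 1) \<and> vreg wd c1 vL = flags b q (\<lambda>_. True)"
    have f1: "fixed c1" by (rule fixed_frame[OF c(1) conjunct1[OF 1]]) auto
    have b1: "bnd c1 j = bnd c j" for j using 1 by (intro bnd_frame) blast
    show "tr (stream_init wd ;; While rOr (stream_body wd) ;; Blk [LoadImm rF 1])
      ((length V + q) * 62 + 15) c1 (sinv (off + q))"
    proof (rule triple_Seq[where K = 11 and Q = "\<lambda>c'. strm off 0 c' \<and> F c'"])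
      have r: "reg c1 rB1 = b - 1" "reg c1 rYp0 = vp" "reg c1 rZero = 0" "reg c1 rYn = length V"
        "reg c1 rQ = q" "reg c1 rOne = 1" using f1 unfolding fixed_def by simp_all
      have vL1: "vreg wd c1 vL = flags b q (\<lambda>_. True)" using 1 by blast
      have vp: "vp < 2 ^ w" using V(3,4) by (cases V) auto
      have "rn [vShl wd vM vL rB1, vSub wd vM vM vL, vSub wd vA vA vA, vSub wd vP vP vP,
          Add rYp rYp0 rZero, Add rYr rYn rZero, LoadImm rJ 0, LoadImm rO 0, LoadImm rCnt 0,
          Add rOr rYn rZero, Sub rLag rQ rOne] c1
        (\<lambda>c'. frame wd {rYp, rYr, rJ, rO, rCnt, rOr, rLag} {vM, vA, vP} {} c1 c' \<and>
          vreg wd c' vM = pack b q (\<lambda>_. 2 ^ (b - 1) - 1) \<and> vreg wd c' vA = 0 \<and> vreg wd c' vP = 0 \<and>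
          reg c' rYp = vp \<and> reg c' rYr = length V \<and> reg c' rJ = 0 \<and> reg c' rO = 0 \<and> reg c' rCnt = 0 \<and>
          reg c' rOr = length V \<and> reg c' rLag = q - 1)"
        using r vL1 pack_low_mask[OF b0 qb(1)] vp V(2) q
        by (cases wd) (simp_all add: vinstr_defs frame_def add_bits_eq sub_bits_eq)
      then show "tr (stream_init wd) 11 c1 (\<lambda>c'. strm off 0 c' \<and> F c')"
        unfolding stream_init_def
      proof (rule triple_Blk[OF runs_mono])
        fix c' assume 2: "frame wd {rYp, rYr, rJ, rO, rCnt, rOr, rLag} {vM, vA, vP} {} c1 c' \<and>
          vreg wd c' vM = pack b q (\<lambda>_. 2 ^ (b - 1) - 1) \<and> vreg wd c' vA = 0 \<and> vreg wd c' vP = 0 \<and>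
          reg c' rYp = vp \<and> reg c' rYr = length V \<and> reg c' rJ = 0 \<and> reg c' rO = 0 \<and> reg c' rCnt = 0 \<and>
          reg c' rOr = length V \<and> reg c' rLag = q - 1"
        have f: "fixed c'" by (rule fixed_frame[OF f1 conjunct1[OF 2]]) auto
        have z: "flags b q (\<lambda>_. False) = 0" by (simp add: flags_def pack_def)
        have f0: "yf 0 = (\<lambda>_. \<sigma> + 1)" "af off 0 = (\<lambda>_. False)" "pf off 0 = (\<lambda>_. False)"
          by (auto simp: yf_def af_def pf_def)
        have lt: "pack b q (\<lambda>_. \<sigma> + 1) < 2 ^ (q * b)" using \<sigma> by (intro pack_less)
        have "(2::nat) ^ (q * b) \<le> 2 ^ N" using qb(1) by simp
        with lt have ltN: "pack b q (\<lambda>_. \<sigma> + 1) < 2 ^ N" by (rule less_le_trans)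
        have v: "vreg wd c' vX = vreg wd c1 vX" "vreg wd c' vY = vreg wd c1 vY"
          "vreg wd c' vL = vreg wd c1 vL" "reg c' rF = reg c rF" "reg c' rXp = reg c1 rXp"
          "reg c' rXr = reg c1 rXr"
          using 2 1 unfolding frame_def by simp_all
        have bn: "bnd c' j = bnd c j" for j using 2 b1 unfolding frame_def bnd_def by simp
        have e: "Suc 0 - q = 0" "take_bit w vp = vp" using q(1) vp by (simp_all add: take_bit_word)
        have "wd \<longrightarrow> (\<forall>j < length V. off \<noteq> 0 \<longrightarrow> bnd c j = dif_y xs ys off j)" "reg c rF = of_bool (off \<noteq> 0)"
          using s' by blast+
        moreover have "vreg wd c1 vX = pack b q (\<lambda>k. xs (off + k))" "vreg wd c1 vY = pack b q (\<lambda>_. \<sigma> + 1)"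
          "vreg wd c1 vL = flags b q (\<lambda>_. True)" "F c1" using 1 unfolding F_def by blast+
        ultimately show "strm off 0 c' \<and> F c'"
          using f 2 lt ltN unfolding strm_def F_def v bn e f0 z
          by (simp add: e take_bit_nat_eq_self)
      qed simp
      fix c2 assume 2: "strm off 0 c2 \<and> F c2"
      define Inv where "Inv = (\<lambda>r c'. r \<le> length V + q - 1 \<and> strm off (length V + q - 1 - r) c' \<and> F c')"
      show "tr (While rOr (stream_body wd) ;; Blk [LoadImm rF 1]) ((length V + q) * 62 + 2) c2 (sinv (off + q))"
      proof (rule triple_Seq[where Q = "Inv 0"])
        have "Inv (length V + q - 1) c2" using 2 by (simp add: Inv_def)
        then show "tr (While rOr (stream_body wd)) ((length V + q - 1) * (60 + 2) + 1) c2 (Inv 0)"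
        proof (rule triple_While)
          fix r c3 assume I: "Inv (Suc r) c3"
          define \<tau> where "\<tau> = length V + q - 1 - Suc r"
          have I': "strm off \<tau> c3" "F c3" using I unfolding Inv_def \<tau>_def by blast+
          have \<tau>: "Suc \<tau> - q < length V" "length V + q - 1 - r = Suc \<tau>" "r \<le> length V + q - 1"
            using I q(1) V(4) unfolding Inv_def \<tau>_def by auto
          have "tr (stream_body wd) 60 c3 (Inv r)"
          proof (rule triple_mono[OF stream_body_triple[OF I'(1) \<tau>(1) nw]])
            fix c4 assume 4: "strm off (Suc \<tau>) c4 \<and>
              frame wd {rT, rPin, rYp, rYr, rJ, rA, rT2, rT3, rT4, rCnt, rO, rOr, rLag}
                {vY, vP, vT, vZ, vE, vA} extra c3 c4"
            then have "F c4" using I'(2) unfolding F_def frame_def by simp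
            with 4 \<tau> show "Inv r c4" unfolding Inv_def by simp
          qed auto
          moreover have "reg c3 rOr \<noteq> 0" using I'(1) \<tau>(1) unfolding strm_def by simp
          ultimately show "reg c3 rOr \<noteq> 0 \<and> tr (stream_body wd) 60 c3 (Inv r)" by simp
        next
          fix c3 assume "Inv 0 c3"
          then show "reg c3 rOr = 0" using q(1) unfolding Inv_def strm_def by simp
        qed simp
        fix c3 assume "Inv 0 c3"
        then have 3: "strm off (length V + q - 1) c3" "F c3" unfolding Inv_def by simp_all
        have l: "Suc (length V + q - 1) - q = length V" using q(1) by simp
        show "tr (Blk [LoadImm rF 1]) 1 c3 (sinv (off + q))"
        proof (rule triple_Blk)
          have 4: "fixed c3" "reg c3 rCnt = D (off + q) (length V)"
            "wd \<Longrightarrow> j < length V \<Longrightarrow> bnd c3 j = dif_y xs ys (off + q) j" for j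
            using 3(1) unfolding strm_def l by auto
          have fr: "frame wd {rF} {} {} c3 (set_reg rF 1 c3)" by (simp add: frame_def)
          have "fixed (set_reg rF 1 c3)" by (rule fixed_frame[OF 4(1) fr]) auto
          then have f: "fixed (set_reg rF (Suc 0) c3)" by simp
          have t1: "take_bit w 1 = (1::nat)" using one_less_pow by (rule take_bit_word)
          have "bnd (set_reg rF (Suc 0) c3) j = bnd c3 j" for j by (simp add: bnd_def)
          with f have "sinv (off + q) (set_reg rF 1 c3)"
            using 4(2,3) 3(2) q(1) unfolding F_def sinv_def by simp
          then show "rn [LoadImm rF 1] c3 (sinv (off + q))"
            using t1 by simp
        qed simp
      qed simp
    qed simp
  qed (simp add: strip_time_def)
qed

text \<open>The rows behind \<open>U\<close> contain \<open>\<sigma>\<close>, which does not occur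
  in \<open>V\<close>, so overshooting the end is harmless.\<close>

lemma D_eq: "length U \<le> off \<Longrightarrow> D off (length V) = lcs_tab ((!) U) ((!) V) (length U) (length V)"
proof -
  assume "length U \<le> off"
  moreover have "xs i \<noteq> ys j" if "length U \<le> i" "j < length V" for i j
  proof -
    have "V ! j < \<sigma>" using V(1) nth_mem[OF that(2)] by auto
    then show ?thesis using that by (simp add: xs_def ys_def)
  qed
  ultimately have "D off (length V) = D (length U) (length V)" by (intro lcs_tab_no_match)
  also have "\<dots> = lcs_tab ((!) U) ((!) V) (length U) (length V)"
    by (rule lcs_tab_cong) (auto simp: xs_def ys_def)
  finally show ?thesis .
qed

lemma pass_triple:
  assumes "fixed c" "reg c rXp = take_bit w up" "reg c rXr = length U"
  shows "tr (pass wd) ((length U + q - 1) div q * (strip_time + 2) + 3) c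
    (\<lambda>c'. reg c' rCnt = lcs_tab ((!) U) ((!) V) (length U) (length V) \<and> fixed c')"
proof -
  \<comment> \<open>The first two bounds say that \<open>r\<close> further strips suffice and
    \<open>r - 1\<close> do not. The disjunction ensures that a narrow pass, which stores no
    boundary, never starts a second strip.\<close>
  define Inv where "Inv = (\<lambda>r c'. \<exists>off. sinv off c' \<and> length U \<le> off + r * q \<and>
    (r \<noteq> 0 \<longrightarrow> off + (r - 1) * q < length U) \<and> (wd \<or> off = 0 \<or> length U \<le> off))"
  have ceil: "length U \<le> (length U + q - 1) div q * q"
    "(length U + q - 1) div q \<noteq> 0 \<Longrightarrow> ((length U + q - 1) div q - 1) * q < length U"
  proof -
    define m r where "m = length U + q - 1" and "r = m mod q"
    have r: "r < q" "m = m div q * q + r" using q(1) by (auto simp: r_def)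
    then show "length U \<le> (length U + q - 1) div q * q" unfolding m_def[symmetric] using m_def by linarith
    assume "(length U + q - 1) div q \<noteq> 0"
    then obtain d where d: "m div q = Suc d" unfolding m_def[symmetric] by (cases "m div q") auto
    with r have "m = q + d * q + r" by simp
    with m_def q(1) have "d * q < length U" by linarith
    then show "((length U + q - 1) div q - 1) * q < length U"
      unfolding m_def[symmetric] d by simp
  qed
  have "tr (pass wd) ((length U + q - 1) div q * (strip_time + 2) + 3) c (Inv 0)"
    unfolding pass_def
  proof (rule triple_Seq)
    show "tr (Blk [LoadImm rF 0, LoadImm rCnt 0]) 2 c (Inv ((length U + q - 1) div q))"
    proof (rule triple_Blk)
      have f: "fixed (set_reg rCnt 0 (set_reg rF 0 c))"
        by (rule fixed_frame[of c "{rF, rCnt}" "{}" "{}"]) (use assms(1) in \<open>auto simp: frame_def vreg_def\<close>)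
      then have "sinv 0 (set_reg rCnt 0 (set_reg rF 0 c))"
        using assms by (simp add: sinv_def)
      then show "rn [LoadImm rF 0, LoadImm rCnt 0] c (Inv ((length U + q - 1) div q))"
      proof -
        assume s: "sinv 0 (set_reg rCnt 0 (set_reg rF 0 c))"
        have "Inv ((length U + q - 1) div q) (set_reg rCnt 0 (set_reg rF 0 c))"
          unfolding Inv_def by (rule exI[of _ 0]) (use s ceil in \<open>simp only: add_0; blast\<close>)
        then show ?thesis by simp
      qed
    qed simp
    fix c1 assume "Inv ((length U + q - 1) div q) c1"
    then show "tr (While rXr (strip wd)) ((length U + q - 1) div q * (strip_time + 2) + 1) c1 (Inv 0)"
    proof (rule triple_While)
      fix r c2 assume "Inv (Suc r) c2"
      then obtain off where o: "sinv off c2" "length U \<le> off + Suc r * q" "off + r * q < length U"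
        "wd \<or> off = 0 \<or> length U \<le> off"
        unfolding Inv_def by (metis Suc_not_Zero diff_Suc_1)
      have nw: "off = 0" if "\<not> wd" using that o(3,4) by (meson le_add1 le_trans not_le)
      have "tr (strip wd) strip_time c2 (Inv r)"
      proof (rule triple_mono[OF strip_triple[OF o(1) nw]])
        fix c' assume 3: "sinv (off + q) c'"
        have "wd \<or> off + q = 0 \<or> length U \<le> off + q" using narrow by (meson le_add2 le_trans)
        moreover have "r \<noteq> 0 \<longrightarrow> off + q + (r - 1) * q < length U" using o(3) by (cases r) auto
        moreover have "length U \<le> off + q + r * q" using o(2) by simp
        ultimately show "Inv r c'" unfolding Inv_def using 3 by blast
      qed auto
      moreover have "reg c2 rXr = length U - off" "off < length U"
        using o(1,3) unfolding sinv_def by simp_all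
      ultimately show "reg c2 rXr \<noteq> 0 \<and> tr (strip wd) strip_time c2 (Inv r)" by simp
    next
      fix c2 assume "Inv 0 c2"
      then obtain off where "sinv off c2" "length U \<le> off" unfolding Inv_def by auto
      then show "reg c2 rXr = 0" unfolding sinv_def by simp
    qed simp
  qed simp
  then show ?thesis
  proof (rule triple_mono)
    fix c' assume "Inv 0 c'"
    then obtain off where "sinv off c'" "length U \<le> off" unfolding Inv_def by auto
    then show "reg c' rCnt = lcs_tab ((!) U) ((!) V) (length U) (length V) \<and> fixed c'"
      unfolding sinv_def using D_eq[of off] by simp
  qed auto
qed

end

section \<open>The complete program\<close>

text \<open>Address and length of the shorter string, then of the longer one.\<close>

abbreviation (input) "rSp \<equiv> 34::nat"
abbreviation (input) "rSl \<equiv> 35::nat"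
abbreviation (input) "rLp \<equiv> 36::nat"
abbreviation (input) "rLl \<equiv> 37::nat"

text \<open>Without a comparison instruction, both numbers are counted down. The time is linear in
  the first one, which is affordable because it is always a string length.\<close>

definition greater :: com where
  "greater = Blk [LoadImm rT2 0] ;;
     While rA (IfZ rT4 (Blk [LoadImm rT2 1]) (Blk [Sub rT4 rT4 rOne]) ;; Blk [Sub rA rA rOne])"

text \<open>The program is the same for all \<open>w\<close>; it learns \<open>w\<close> by shifting
  a one until it leaves the word.\<close>

definition word_size :: com where
  "word_size = Blk [Add rT rOne rZero, LoadImm rW 0] ;;
     While rT (Blk [Shl rT rT rOne, Add rW rW rOne])"

definition bit_length :: "nat \<Rightarrow> com" where
  "bit_length d = Blk [LoadImm d 0] ;; While rT (Blk [Shr rT rT rOne, Add d d rOne])"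

text \<open>\<open>rJ\<close> counts down from \<open>b\<close> and signals that another field fits.
  The product \<open>rO\<close> is accumulated on the way, since it could not be computed afterwards
  by a multiplication.\<close>

definition quotient :: com where
  "quotient = Blk [Add rI rW rZero, Add rJ rB rZero, LoadImm rQ 0, LoadImm rO 0] ;;
     While rI (Blk [Sub rI rI rOne, Sub rJ rJ rOne] ;;
       IfZ rJ (Blk [Add rQ rQ rOne, Add rJ rB rZero, Add rO rO rB]) (Blk [])) ;;
     Blk [Sub rSh rO rB]"

definition roles :: com where
  "roles = Blk [LoadImm rOne 1, LoadImm rZero 0, Add rA 0 rZero, Add rT4 1 rZero] ;; greater ;;
     IfZ rT2
       (Blk [Add rSp rZero rZero, Add rSl 0 rZero, Add rLp 0 rZero, Add rLl 1 rZero])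
       (Blk [Add rSp 0 rZero, Add rSl 1 rZero, Add rLp rZero rZero, Add rLl 0 rZero]) ;;
     Blk [Sub rT rXpad rOne]"

text \<open>\<open>b\<close> is the bit length of the larger padding symbol
  \<open>\<sigma> + 1\<close>. The bit length of \<open>w div 2\<close> is the logarithm of
  \<open>w\<close> rounded down, which becomes \<open>k\<close>.\<close>

definition parameters :: com where
  "parameters = word_size ;; Blk [Add rYpad rXpad rOne, Add rT rYpad rZero] ;; bit_length rB ;;
     Blk [Sub rB1 rB rOne, Shr rT rW rOne] ;; bit_length rK ;;
     Blk [Shl rKm rOne rK, Sub rKm rKm rOne] ;; quotient ;;
     Blk [Add rA rSl rZero, Add rT4 rQ rZero] ;; greater"

definition narrow_pass :: com where
  "narrow_pass = Blk [Add rXp rSp rZero, Add rXr rSl rZero, Add rYp0 rLp rZero, Add rYn rLl rZero] ;;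
     pass False"

text \<open>Registers \<open>0\<close> and \<open>1\<close> still hold the lengths, so their sum is
  the first address behind the input. The loop turns the parameters of a word into those of a wide
  word by \<open>w - 1\<close> additions.\<close>

definition wide_pass :: com where
  "wide_pass = Blk [Add rXp rLp rZero, Add rXr rLl rZero, Add rYp0 rSp rZero, Add rYn rSl rZero,
       Add rScr 0 1, Add rBB rScr rOne, Add rJ rQ rZero, Sub rI rW rOne] ;;
     While rI (Blk [Add rQ rQ rJ, Add rSh rSh rO, Sub rI rI rOne]) ;; pass True"

text \<open>\<open>rT\<close> holds \<open>\<sigma> - 1\<close> after \<open>roles\<close>, so the
  first test recognizes the alphabet with one letter.\<close>

definition lcs_com :: com where
  "lcs_com = roles ;; IfZ rT (Blk [Add 0 rSl rZero])
     (parameters ;; IfZ rT2 narrow_pass wide_pass ;; Blk [Add 0 rCnt rZero])"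

text \<open>The setup is confined to word registers, where this simpler form of \<open>frame\<close>
  suffices.\<close>

definition keep :: "nat set \<Rightarrow> config \<Rightarrow> config \<Rightarrow> bool" where
  "keep S c c' \<longleftrightarrow> (\<forall>i. i \<notin> S \<longrightarrow> reg c' i = reg c i) \<and> mem c' = mem c"

lemma keep_trans: "keep S c c' \<Longrightarrow> keep S' c' c'' \<Longrightarrow> S \<union> S' \<subseteq> S'' \<Longrightarrow> keep S'' c c''"
  unfolding keep_def by (metis UnCI subset_iff)

section \<open>Effect and cost of the setup\<close>

lemma greater_triple:
  assumes "0 < w" "reg c rOne = 1" "reg c rA = x" "reg c rT4 = y" "x < 2 ^ w" "y < 2 ^ w"
  shows "triple w greater (x * 6 + 2) {} {} c
    (\<lambda>c'. keep {rA, rT4, rT2} c c' \<and> (reg c' rT2 = 0 \<longleftrightarrow> x \<le> y))"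
proof -
  let ?body = "IfZ rT4 (Blk [LoadImm rT2 1]) (Blk [Sub rT4 rT4 rOne]) ;; Blk [Sub rA rA rOne]"
  \<comment> \<open>\<open>x - r\<close> rounds are over. The truncated difference expresses that
    \<open>rT4\<close> stays \<open>0\<close> once \<open>y\<close> is used up; from the next round
    on \<open>rT2\<close> is \<open>1\<close>.\<close>
  define Inv where "Inv = (\<lambda>r c'. r \<le> x \<and> keep {rA, rT4, rT2} c c' \<and> reg c' rA = r \<and>
    reg c' rT4 = y - (x - r) \<and> reg c' rT2 = of_bool (y < x - r))"
  have "triple w greater (x * 6 + 2) {} {} c (Inv 0)"
    unfolding greater_def
  proof (rule triple_Seq)
    show "triple w (Blk [LoadImm rT2 0]) 1 {} {} c (Inv x)"
      by (rule triple_Blk) (use assms in \<open>simp_all add: Inv_def keep_def\<close>)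
    fix c1 assume "Inv x c1"
    then show "triple w (While rA ?body) (x * (4 + 2) + 1) {} {} c1 (Inv 0)"
    proof (rule triple_While)
      fix r c2 assume I: "Inv (Suc r) c2"
      have r: "Suc r \<le> x" "reg c2 rA = Suc r" "reg c2 rT4 = y - (x - Suc r)"
        "reg c2 rT2 = of_bool (y < x - Suc r)" "reg c2 rOne = 1" "Suc r < 2 ^ w"
        and k: "keep {rA, rT4, rT2} c c2"
        using I assms unfolding Inv_def keep_def by simp_all
      define Q where "Q = (\<lambda>c'. keep {rA, rT4, rT2} c c' \<and> reg c' rA = Suc r \<and>
        reg c' rT4 = y - (x - r) \<and> reg c' rT2 = of_bool (y < x - r) \<and> reg c' rOne = 1)"
      have "triple w ?body 4 {} {} c2 (Inv r)"
      proof (rule triple_Seq[where Q = Q])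
        show "triple w (IfZ rT4 (Blk [LoadImm rT2 1]) (Blk [Sub rT4 rT4 rOne])) 3 {} {} c2 Q"
        proof (rule triple_IfZ)
          assume "reg c2 rT4 = 0"
          then show "triple w (Blk [LoadImm rT2 1]) 1 {} {} c2 Q"
            using r k assms(1) by (intro triple_Blk) (auto simp: Q_def keep_def)
        next
          assume "reg c2 rT4 \<noteq> 0"
          moreover have "y - (x - Suc r) < 2 ^ w" using assms by simp
          ultimately show "triple w (Blk [Sub rT4 rT4 rOne]) 1 {} {} c2 Q"
            using r k by (intro triple_Blk) (auto simp: Q_def keep_def sub_bits_eq)
        qed simp
        show "triple w (Blk [Sub rA rA rOne]) 1 {} {} c3 (Inv r)" if "Q c3" for c3
          by (rule triple_Blk) (use that r in \<open>auto simp: Q_def Inv_def keep_def sub_bits_eq\<close>)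
      qed simp
      with r show "reg c2 rA \<noteq> 0 \<and> triple w ?body 4 {} {} c2 (Inv r)" by simp
    qed (auto simp: Inv_def)
  qed simp
  then show ?thesis by (rule triple_mono) (auto simp: Inv_def)
qed

lemma word_size_triple:
  assumes "0 < w" "reg c rOne = 1" "reg c rZero = 0"
  shows "triple w word_size (w * 4 + 3) {} {} c (\<lambda>c'. keep {rT, rW} c c' \<and> reg c' rW = w)"
proof -
  \<comment> \<open>The shifted one is a proper power of two until \<open>r = 0\<close>, where
    truncation turns it into \<open>0\<close>.\<close>
  define Inv where "Inv = (\<lambda>r c'. r \<le> w \<and> keep {rT, rW} c c' \<and> reg c' rT = take_bit w (2 ^ (w - r)) \<and>
    reg c' rW = w - r)"
  have "triple w word_size (w * 4 + 3) {} {} c (Inv 0)"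
    unfolding word_size_def
  proof (rule triple_Seq)
    show "triple w (Blk [Add rT rOne rZero, LoadImm rW 0]) 2 {} {} c (Inv w)"
      by (rule triple_Blk) (use assms in \<open>simp_all add: Inv_def keep_def add_bits_def\<close>)
    fix c1 assume "Inv w c1"
    then show "triple w (While rT (Blk [Shl rT rT rOne, Add rW rW rOne])) (w * (2 + 2) + 1) {} {} c1 (Inv 0)"
    proof (rule triple_While)
      fix r c2 assume I: "Inv (Suc r) c2"
      have "(2::nat) ^ (w - Suc r) < 2 ^ w" using I by (simp add: Inv_def)
      then have r: "reg c2 rT = 2 ^ (w - Suc r)" "reg c2 rW = w - Suc r" "reg c2 rOne = 1"
        "keep {rT, rW} c c2" "Suc r \<le> w"
        using I assms unfolding Inv_def keep_def by (simp_all add: take_bit_nat_eq_self)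
      have e: "w - r = Suc (w - Suc r)" using r(5) by simp
      have lt: "w - Suc r + 1 < 2 ^ w" using less_exp[of w] r(5) by linarith
      have "runs w {} {} [Shl rT rT rOne, Add rW rW rOne] c2 (Inv r)"
        using r lt unfolding Inv_def e
        by (simp add: shl_bits_def push_bit_eq_mult add_bits_eq keep_def mult.commute)
      then have "triple w (Blk [Shl rT rT rOne, Add rW rW rOne]) 2 {} {} c2 (Inv r)"
        by (rule triple_Blk) simp
      with r(1) show "reg c2 rT \<noteq> 0 \<and> triple w (Blk [Shl rT rT rOne, Add rW rW rOne]) 2 {} {} c2 (Inv r)"
        by simp
    next
      show "reg c2 rT = 0" if "Inv 0 c2" for c2 using that by (simp add: Inv_def take_bit_eq_mod)
    qed simp
  qed simp
  then show ?thesis by (rule triple_mono) (auto simp: Inv_def)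
qed

text \<open>\<open>L\<close> is specified by powers of two, which keeps logarithms out of the
  correctness of the program.\<close>

lemma bit_length_triple:
  assumes "0 < w" "reg c rOne = 1" "reg c rT = x" "x < 2 ^ L" "L = 0 \<or> 2 ^ (L - 1) \<le> x" "L < 2 ^ w"
    and d: "d \<noteq> rT" "d \<noteq> rOne"
  shows "triple w (bit_length d) (L * 4 + 2) {} {} c (\<lambda>c'. keep {rT, d} c c' \<and> reg c' d = L)"
proof -
  define Inv where "Inv = (\<lambda>r c'. r \<le> L \<and> keep {rT, d} c c' \<and> reg c' rT = x div 2 ^ (L - r) \<and>
    reg c' d = L - r)"
  have "triple w (bit_length d) (L * 4 + 2) {} {} c (Inv 0)"
    unfolding bit_length_def
  proof (rule triple_Seq)
    show "triple w (Blk [LoadImm d 0]) 1 {} {} c (Inv L)"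
      by (rule triple_Blk) (use assms in \<open>simp_all add: Inv_def keep_def\<close>)
    fix c1 assume "Inv L c1"
    then show "triple w (While rT (Blk [Shr rT rT rOne, Add d d rOne])) (L * (2 + 2) + 1) {} {} c1 (Inv 0)"
    proof (rule triple_While)
      fix r c2 assume I: "Inv (Suc r) c2"
      have r: "reg c2 rT = x div 2 ^ (L - Suc r)" "reg c2 d = L - Suc r" "reg c2 rOne = 1"
        "keep {rT, d} c c2" "Suc r \<le> L"
        using I assms unfolding Inv_def keep_def by simp_all
      have e: "L - r = Suc (L - Suc r)" using r(5) by simp
      have lt: "L - Suc r + 1 < 2 ^ w" using assms(6) r(5) by linarith
      have "x div 2 ^ (L - Suc r) div 2 = x div 2 ^ Suc (L - Suc r)"
        by (simp add: div_mult2_eq[symmetric] mult.commute)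
      then have "runs w {} {} [Shr rT rT rOne, Add d d rOne] c2 (Inv r)"
        using r lt d unfolding Inv_def e
        by (simp add: shr_bits_def drop_bit_eq_div add_bits_eq keep_def)
      then have t: "triple w (Blk [Shr rT rT rOne, Add d d rOne]) 2 {} {} c2 (Inv r)"
        by (rule triple_Blk) simp
      have "(2::nat) ^ (L - Suc r) \<le> 2 ^ (L - 1)" by (intro power_increasing) auto
      moreover have "2 ^ (L - 1) \<le> x" using assms(5) r(5) by simp
      ultimately have "2 ^ (L - Suc r) \<le> x" by (rule order_trans)
      then have "x div 2 ^ (L - Suc r) \<noteq> 0" by (simp add: div_eq_0_iff not_less)
      with r(1) t show "reg c2 rT \<noteq> 0 \<and> triple w (Blk [Shr rT rT rOne, Add d d rOne]) 2 {} {} c2 (Inv r)"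
        by simp
    next
      show "reg c2 rT = 0" if "Inv 0 c2" for c2 using that assms(4) by (simp add: Inv_def)
    qed simp
  qed simp
  then show ?thesis by (rule triple_mono) (auto simp: Inv_def)
qed

lemma quotient_triple:
  assumes "reg c rOne = 1" "reg c rZero = 0" "reg c rW = w" "reg c rB = b" "0 < b" "b \<le> w"
  shows "triple w quotient (w * 9 + 6) {} {} c (\<lambda>c'. keep {rI, rJ, rQ, rO, rSh} c c' \<and>
    reg c' rQ = w div b \<and> reg c' rO = w div b * b \<and> reg c' rSh = (w div b - 1) * b)" (is "triple _ _ _ _ _ _ ?Q")
proof -
  let ?body = "Blk [Sub rI rI rOne, Sub rJ rJ rOne] ;;
    IfZ rJ (Blk [Add rQ rQ rOne, Add rJ rB rZero, Add rO rO rB]) (Blk [])"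
  have w: "w < 2 ^ w" by (rule less_exp)
  have bw: "b < 2 ^ w" using w assms(6) by linarith
  define Inv where "Inv = (\<lambda>r c'. r \<le> w \<and> keep {rI, rJ, rQ, rO, rSh} c c' \<and> reg c' rI = r \<and>
    reg c' rQ = (w - r) div b \<and> reg c' rO = (w - r) div b * b \<and> reg c' rJ = b - (w - r) mod b)"
  show ?thesis
    unfolding quotient_def
  proof (rule triple_Seq)
    show "triple w (Blk [Add rI rW rZero, Add rJ rB rZero, LoadImm rQ 0, LoadImm rO 0]) 4 {} {} c (Inv w)"
      by (rule triple_Blk) (use assms w bw in \<open>simp_all add: Inv_def keep_def add_bits_eq\<close>)
    fix c1 assume I1: "Inv w c1"
    show "triple w (While rI ?body ;;
     Blk [Sub rSh rO rB]) (w * 9 + 2) {} {} c1 ?Q"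
    proof (rule triple_Seq)
      show "triple w (While rI ?body)
         (w * (7 + 2) + 1) {} {} c1 (Inv 0)"
        using I1
      proof (rule triple_While)
        fix r c2 assume I: "Inv (Suc r) c2"
        define i where "i = w - Suc r"
        have r: "reg c2 rI = Suc r" "reg c2 rQ = i div b" "reg c2 rO = i div b * b"
          "reg c2 rJ = b - i mod b" "reg c2 rOne = 1" "reg c2 rZero = 0" "reg c2 rB = b"
          "keep {rI, rJ, rQ, rO, rSh} c c2" "Suc r \<le> w"
          using I assms unfolding Inv_def keep_def i_def by simp_all
        have wr: "w - r = Suc i" using r(9) by (simp add: i_def)
        have im: "i mod b < b" using assms(5) by simp
        define Q where "Q = (\<lambda>c'. keep {rI, rJ, rQ, rO, rSh} c c' \<and> reg c' rI = r \<and>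
          reg c' rQ = i div b \<and> reg c' rO = i div b * b \<and> reg c' rJ = b - i mod b - 1 \<and>
          reg c' rOne = 1 \<and> reg c' rZero = 0 \<and> reg c' rB = b)"
        have "triple w ?body 7 {} {} c2 (Inv r)"
        proof (rule triple_Seq[where Q = Q])
          have lt: "Suc r < 2 ^ w" "b - i mod b < 2 ^ w" "1 \<le> b - i mod b"
            using r(9) w assms(6) im by linarith+
          show "triple w (Blk [Sub rI rI rOne, Sub rJ rJ rOne]) 2 {} {} c2 Q"
            using r lt by (intro triple_Blk) (auto simp: Q_def keep_def sub_bits_eq)
          fix c3 assume c3: "Q c3"
          note q3 = c3[unfolded Q_def]
          show "triple w (IfZ rJ (Blk [Add rQ rQ rOne, Add rJ rB rZero, Add rO rO rB]) (Blk [])) 5 {} {} c3 (Inv r)"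
          proof (rule triple_IfZ)
            assume "reg c3 rJ = 0"
            then have m: "Suc (i mod b) = b" using q3 im by simp
            then have d: "Suc i mod b = 0" "Suc i div b = Suc (i div b)"
              by (simp_all add: mod_Suc div_Suc)
            have "Suc (i div b) * b = Suc i" using d by (metis add_0_right div_mult_mod_eq)
            then have s: "Suc (i div b) * b < 2 ^ w" using r(9) wr w by linarith
            have "Suc (i div b) \<le> Suc (i div b) * b" using assms(5) by (cases b) auto
            with s have "Suc (i div b) < 2 ^ w" by linarith
            then show "triple w (Blk [Add rQ rQ rOne, Add rJ rB rZero, Add rO rO rB]) 3 {} {} c3 (Inv r)"
              using q3 s r(9) wr d bw
              by (intro triple_Blk) (auto simp: Inv_def keep_def add_bits_eq add.commute)
          next
            assume "reg c3 rJ \<noteq> 0"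
            then have m: "Suc (i mod b) \<noteq> b" using q3 by auto
            then have d: "Suc i mod b = Suc (i mod b)" "Suc i div b = i div b"
              by (simp_all add: mod_Suc div_Suc)
            then show "triple w (Blk []) 3 {} {} c3 (Inv r)"
              using q3 r(9) wr d by (intro triple_Blk) (auto simp: Inv_def)
          qed simp
        qed simp
        with r(1) show "reg c2 rI \<noteq> 0 \<and> triple w ?body 7 {} {} c2 (Inv r)" by simp
      qed (auto simp: Inv_def)
      fix c2 assume "Inv 0 c2"
      then have r: "reg c2 rQ = w div b" "reg c2 rO = w div b * b" "reg c2 rB = b"
        "keep {rI, rJ, rQ, rO, rSh} c c2"
        using assms unfolding Inv_def keep_def by simp_all
      have "1 \<le> w div b" using assms(5,6) by (simp add: div_greater_zero_iff Suc_le_eq)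
      then have "b \<le> w div b * b" "w div b * b < 2 ^ w"
        using w by (auto intro: le_less_trans[OF div_times_less_eq_dividend])
      with r show "triple w (Blk [Sub rSh rO rB]) 1 {} {} c2 ?Q"
        by (intro triple_Blk) (auto simp: keep_def sub_bits_eq diff_mult_distrib)
    qed simp
  qed simp
qed

definition roles_set :: "nat \<Rightarrow> nat \<Rightarrow> nat \<Rightarrow> config \<Rightarrow> config \<Rightarrow> bool" where
  "roles_set m n \<sigma> c c' \<longleftrightarrow> mem c' = mem c \<and>
    reg c' 0 = m \<and> reg c' 1 = n \<and> reg c' rXpad = \<sigma> \<and> reg c' rOne = 1 \<and> reg c' rZero = 0 \<and>
    reg c' rSp = (if m \<le> n then 0 else m) \<and> reg c' rSl = min m n \<and>
    reg c' rLp = (if m \<le> n then m else 0) \<and> reg c' rLl = max m n"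

lemma roles_triple:
  assumes "0 < w" "reg c 0 = m" "reg c 1 = n" "reg c 2 = \<sigma>" "m < 2 ^ w" "n < 2 ^ w" "1 \<le> \<sigma>" "\<sigma> < 2 ^ w"
  shows "triple w roles (m * 6 + 13) {} {} c (\<lambda>c'. roles_set m n \<sigma> c c' \<and> reg c' rT = \<sigma> - 1)" (is "triple _ _ _ _ _ _ ?Q")
  unfolding roles_def
proof (rule triple_Seq)
  show "triple w (Blk [LoadImm rOne 1, LoadImm rZero 0, Add rA 0 rZero, Add rT4 1 rZero]) 4 {} {} c
    (\<lambda>c'. keep {rOne, rZero, rA, rT4} c c' \<and> reg c' rOne = 1 \<and> reg c' rZero = 0 \<and>
      reg c' rA = m \<and> reg c' rT4 = n)"
    using assms by (intro triple_Blk) (auto simp: keep_def add_bits_eq)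
  fix c1 assume 1: "keep {rOne, rZero, rA, rT4} c c1 \<and> reg c1 rOne = 1 \<and> reg c1 rZero = 0 \<and>
      reg c1 rA = m \<and> reg c1 rT4 = n"
  show "triple w (greater ;;
     IfZ rT2
       (Blk [Add rSp rZero rZero, Add rSl 0 rZero, Add rLp 0 rZero, Add rLl 1 rZero])
       (Blk [Add rSp 0 rZero, Add rSl 1 rZero, Add rLp rZero rZero, Add rLl 0 rZero]) ;;
     Blk [Sub rT rXpad rOne]) (m * 6 + 9) {} {} c1 ?Q"
  proof (rule triple_Seq[OF greater_triple])
    fix c2 assume 2: "keep {rA, rT4, rT2} c1 c2 \<and> (reg c2 rT2 = 0 \<longleftrightarrow> m \<le> n)"
    have k: "keep {rOne, rZero, rA, rT4, rT2} c c2"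
      by (rule keep_trans[OF conjunct1[OF 1] conjunct1[OF 2]]) auto
    have r: "reg c2 0 = m" "reg c2 1 = n" "reg c2 rXpad = \<sigma>" "mem c2 = mem c"
      using k assms unfolding keep_def by simp_all
    have r': "reg c2 rOne = 1" "reg c2 rZero = 0" using 1 2 unfolding keep_def by simp_all
    define Q where "Q = roles_set m n \<sigma> c"
    show "triple w (IfZ rT2
       (Blk [Add rSp rZero rZero, Add rSl 0 rZero, Add rLp 0 rZero, Add rLl 1 rZero])
       (Blk [Add rSp 0 rZero, Add rSl 1 rZero, Add rLp rZero rZero, Add rLl 0 rZero]) ;;
     Blk [Sub rT rXpad rOne]) 7 {} {} c2 ?Q"
    proof (rule triple_Seq[where Q = Q])
      show "triple w (IfZ rT2
       (Blk [Add rSp rZero rZero, Add rSl 0 rZero, Add rLp 0 rZero, Add rLl 1 rZero])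
       (Blk [Add rSp 0 rZero, Add rSl 1 rZero, Add rLp rZero rZero, Add rLl 0 rZero])) 6 {} {} c2 Q"
      proof (rule triple_IfZ)
        assume "reg c2 rT2 = 0"
        then have "m \<le> n" using 2 by simp
        then show "triple w (Blk [Add rSp rZero rZero, Add rSl 0 rZero, Add rLp 0 rZero, Add rLl 1 rZero]) 4 {} {} c2 Q"
          using r r' assms(5,6) by (intro triple_Blk) (simp_all add: Q_def roles_set_def add_bits_eq)
      next
        assume "reg c2 rT2 \<noteq> 0"
        then have "\<not> m \<le> n" using 2 by simp
        then show "triple w (Blk [Add rSp 0 rZero, Add rSl 1 rZero, Add rLp rZero rZero, Add rLl 0 rZero]) 4 {} {} c2 Q"
          using r r' assms(5,6) by (intro triple_Blk) (simp_all add: Q_def roles_set_def add_bits_eq)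
      qed simp
      show "triple w (Blk [Sub rT rXpad rOne]) 1 {} {} c3 ?Q" if "Q c3" for c3
        using that assms(7,8) by (intro triple_Blk) (simp_all add: Q_def roles_set_def sub_bits_eq)
    qed simp
  qed (use 1 assms in auto)
qed simp

lemma parameters_triple:
  assumes c: "reg c rOne = 1" "reg c rZero = 0" "reg c rXpad = \<sigma>" "reg c rSl = s" "s < 2 ^ w"
    and b: "2 \<le> b" "b \<le> w" "\<sigma> + 1 < 2 ^ b" "2 ^ (b - 1) \<le> \<sigma> + 1"
    and k: "2 ^ k \<le> w" "w < 2 ^ Suc k"
  shows "triple w parameters (w * 21 + s * 6 + 23) {} {} c (\<lambda>c'.
    keep {rT, rW, rYpad, rB, rB1, rK, rKm, rI, rJ, rQ, rO, rSh, rA, rT4, rT2} c c' \<and>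
    reg c' rW = w \<and> reg c' rB = b \<and> reg c' rB1 = b - 1 \<and> reg c' rYpad = \<sigma> + 1 \<and>
    reg c' rK = k \<and> reg c' rKm = mask k \<and> reg c' rQ = w div b \<and> reg c' rO = w div b * b \<and>
    reg c' rSh = (w div b - 1) * b \<and> (reg c' rT2 = 0 \<longleftrightarrow> s \<le> w div b))" (is "triple _ _ _ _ _ _ ?Q")
proof -
  have w: "w < 2 ^ w" "0 < w" using b by (simp_all add: less_exp)
  have "(2::nat) ^ b \<le> 2 ^ w" using b(2) by simp
  with b(3) have \<sigma>: "\<sigma> + 1 < 2 ^ w" by linarith
  have kw: "k < w" using k(1) less_exp[of k] by linarith
  have qw: "w div b < 2 ^ w" using w(1) by (meson div_le_dividend le_less_trans)
  let ?tail3 = "quotient ;; Blk [Add rA rSl rZero, Add rT4 rQ rZero] ;; greater"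
  let ?tail2 = "bit_length rK ;; Blk [Shl rKm rOne rK, Sub rKm rKm rOne] ;; ?tail3"
  let ?tail1 = "bit_length rB ;; Blk [Sub rB1 rB rOne, Shr rT rW rOne] ;; ?tail2"
  show ?thesis
    unfolding parameters_def
  proof (rule triple_Seq[OF word_size_triple[OF w(2) c(1,2)]])
    fix c1 assume 1: "keep {rT, rW} c c1 \<and> reg c1 rW = w"
    have r1: "reg c1 rOne = 1" "reg c1 rZero = 0" "reg c1 rXpad = \<sigma>" using 1 c unfolding keep_def by simp_all
    show "triple w (Blk [Add rYpad rXpad rOne, Add rT rYpad rZero] ;; ?tail1) (w * 17 + s * 6 + 20) {} {} c1 ?Q"
    proof (rule triple_Seq)
      show "triple w (Blk [Add rYpad rXpad rOne, Add rT rYpad rZero]) 2 {} {} c1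
        (\<lambda>c'. keep {rYpad, rT} c1 c' \<and> reg c' rYpad = \<sigma> + 1 \<and> reg c' rT = \<sigma> + 1)"
        using r1 \<sigma> by (intro triple_Blk) (auto simp: keep_def add_bits_eq)
      fix c2 assume 2: "keep {rYpad, rT} c1 c2 \<and> reg c2 rYpad = \<sigma> + 1 \<and> reg c2 rT = \<sigma> + 1"
      have r2: "reg c2 rOne = 1" "reg c2 rT = \<sigma> + 1" using 2 r1 unfolding keep_def by simp_all
      have L: "b = 0 \<or> 2 ^ (b - 1) \<le> \<sigma> + 1" "b < 2 ^ w" using b w by linarith+
      show "triple w ?tail1 (w * 17 + s * 6 + 18) {} {} c2 ?Q"
      proof (rule triple_Seq[OF bit_length_triple[OF w(2) r2 b(3) L]])
        fix c3 assume 3: "keep {rT, rB} c2 c3 \<and> reg c3 rB = b"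
        have r3: "reg c3 rOne = 1" "reg c3 rW = w" using 3 2 1 r1 unfolding keep_def by simp_all
        have bw: "b < 2 ^ w" by fact
        show "triple w (Blk [Sub rB1 rB rOne, Shr rT rW rOne] ;; ?tail2) (w * 13 + s * 6 + 16) {} {} c3 ?Q"
        proof (rule triple_Seq)
          show "triple w (Blk [Sub rB1 rB rOne, Shr rT rW rOne]) 2 {} {} c3
            (\<lambda>c'. keep {rB1, rT} c3 c' \<and> reg c' rB1 = b - 1 \<and> reg c' rT = w div 2)"
            using r3 3 b bw by (intro triple_Blk) (auto simp: keep_def sub_bits_eq shr_bits_def drop_bit_eq_div)
          fix c4 assume 4: "keep {rB1, rT} c3 c4 \<and> reg c4 rB1 = b - 1 \<and> reg c4 rT = w div 2"
          have r4: "reg c4 rOne = 1" "reg c4 rT = w div 2" using 4 r3 unfolding keep_def by simp_all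
          have K: "w div 2 < 2 ^ k" "k = 0 \<or> 2 ^ (k - 1) \<le> w div 2" "k < 2 ^ w"
          proof -
            show "w div 2 < 2 ^ k" using k(2) by simp
            show "k = 0 \<or> 2 ^ (k - 1) \<le> w div 2"
              using k(1) by (cases k) (simp_all add: less_eq_div_iff_mult_less_eq mult.commute)
            show "k < 2 ^ w" using kw w by linarith
          qed
          show "triple w ?tail2 (w * 13 + s * 6 + 14) {} {} c4 ?Q"
          proof (rule triple_Seq[OF bit_length_triple[OF w(2) r4 K]])
            fix c5 assume 5: "keep {rT, rK} c4 c5 \<and> reg c5 rK = k"
            have r5: "reg c5 rOne = 1" "reg c5 rK = k" using 5 r4 unfolding keep_def by simp_all
            have kk: "(2::nat) ^ k < 2 ^ w" using kw by simp
            show "triple w (Blk [Shl rKm rOne rK, Sub rKm rKm rOne] ;; ?tail3) (w * 9 + s * 6 + 12) {} {} c5 ?Q"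
            proof (rule triple_Seq)
              show "triple w (Blk [Shl rKm rOne rK, Sub rKm rKm rOne]) 2 {} {} c5
                (\<lambda>c'. keep {rKm} c5 c' \<and> reg c' rKm = mask k)"
                using r5 kk by (intro triple_Blk)
                  (auto simp: keep_def sub_bits_eq shl_bits_def push_bit_eq_mult take_bit_nat_eq_self
                    mask_eq_exp_minus_1)
              fix c6 assume 6: "keep {rKm} c5 c6 \<and> reg c6 rKm = mask k"
              have r6: "reg c6 rOne = 1" "reg c6 rZero = 0" "reg c6 rW = w" "reg c6 rB = b"
                using 6 5 4 3 2 r1 r3 unfolding keep_def by simp_all
              show "triple w ?tail3 (w * 9 + s * 6 + 10) {} {} c6 ?Q"
              proof (rule triple_Seq[OF quotient_triple[OF r6]])
                fix c7 assume 7: "keep {rI, rJ, rQ, rO, rSh} c6 c7 \<and>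
                  reg c7 rQ = w div b \<and> reg c7 rO = w div b * b \<and> reg c7 rSh = (w div b - 1) * b"
                have k7: "keep {rT, rW, rYpad, rB, rB1, rK, rKm, rI, rJ, rQ, rO, rSh} c c7"
                  using 1 2 3 4 5 6 7 unfolding keep_def by simp
                have r7: "reg c7 rOne = 1" "reg c7 rZero = 0" "reg c7 rSl = s"
                  using k7 c unfolding keep_def by simp_all
                have v7: "reg c7 rW = w" "reg c7 rB = b" "reg c7 rB1 = b - 1" "reg c7 rYpad = \<sigma> + 1"
                  "reg c7 rK = k" "reg c7 rKm = mask k"
                  using 1 2 3 4 5 6 7 unfolding keep_def by simp_all
                show "triple w (Blk [Add rA rSl rZero, Add rT4 rQ rZero] ;; greater) (s * 6 + 4) {} {} c7 ?Q"
                proof (rule triple_Seq)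
                  show "triple w (Blk [Add rA rSl rZero, Add rT4 rQ rZero]) 2 {} {} c7
                    (\<lambda>c'. keep {rA, rT4} c7 c' \<and> reg c' rA = s \<and> reg c' rT4 = w div b)"
                    using r7 7 c(5) qw by (intro triple_Blk) (auto simp: keep_def add_bits_eq)
                  fix c8 assume 8: "keep {rA, rT4} c7 c8 \<and> reg c8 rA = s \<and> reg c8 rT4 = w div b"
                  have r8: "reg c8 rOne = 1" "reg c8 rA = s" "reg c8 rT4 = w div b"
                    using 8 r7 unfolding keep_def by simp_all
                  show "triple w greater (s * 6 + 2) {} {} c8 ?Q"
                  proof (rule triple_mono[OF greater_triple[OF w(2) r8 c(5) qw]])
                    fix c9 assume 9: "keep {rA, rT4, rT2} c8 c9 \<and> (reg c9 rT2 = 0 \<longleftrightarrow> s \<le> w div b)"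
                    have "keep {rT, rW, rYpad, rB, rB1, rK, rKm, rI, rJ, rQ, rO, rSh, rA, rT4, rT2} c c9"
                      using k7 8 9 unfolding keep_def by simp
                    moreover have "reg c9 i = reg c7 i" if "i \<notin> {rA, rT4, rT2}" for i
                      using 8 9 that unfolding keep_def by simp
                    ultimately show "?Q c9" using v7 7 9 by simp
                  qed auto
                qed simp
              qed (use b in auto)
            qed simp
          qed (use kw in auto)
        qed simp
      qed (use b in auto)
    qed simp
  qed simp
qed

text \<open>From \<open>2\<close> on, \<open>w * w\<close> exceeds \<open>2 ^ w\<close> only for
  \<open>w = 3\<close>, by one; the offset covers this exception.\<close>

lemma square_less_exp: "2 \<le> w \<Longrightarrow> w * w < 2 ^ w + (2::nat)"
proof -
  have *: "w * w \<le> 2 ^ w" if "4 \<le> w" for w :: nat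
    using that
  proof (induction w rule: dec_induct)
    case (step w)
    have "2 * w + 1 \<le> w * w" using step(1) mult_le_mono1[of 4 w w] by linarith
    then have "Suc w * Suc w \<le> 2 * (w * w)" by simp
    also have "\<dots> \<le> 2 ^ Suc w" using step.IH by simp
    finally show ?case .
  qed simp
  assume "2 \<le> w"
  then consider "w = 2" | "w = 3" | "4 \<le> w" by linarith
  then show ?thesis by cases (use *[of w] in auto)
qed

text \<open>The largest shift amount is at most \<open>w * w - b\<close>, and
  \<open>2 \<le> b\<close> compensates the offset in \<open>square_less_exp\<close>; so it fits into
  a single word register even for \<open>w = 3\<close>.\<close>

lemma wide_sizes:
  assumes "2 \<le> w" "2 \<le> b" "b \<le> w"
  shows "w * (w div b) * b \<le> w * w" "(w * (w div b) - 1) * b < 2 ^ w" "w * (w div b) < 2 ^ w"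
    "1 \<le> w div b"
proof -
  show q: "1 \<le> w div b" using assms by (simp add: div_greater_zero_iff Suc_le_eq)
  show le: "w * (w div b) * b \<le> w * w" by (simp add: mult.assoc)
  have "w * w < 2 ^ w + 2" using assms(1) by (rule square_less_exp)
  with le have lt: "w * (w div b) * b < 2 ^ w + 2" by (rule le_less_trans)
  have "(w * (w div b) - 1) * b = w * (w div b) * b - b" by (simp add: diff_mult_distrib)
  moreover have "x - b < 2 ^ w" if "x < 2 ^ w + 2" for x
    using that assms(2) zero_less_power[of "2::nat" w] by linarith
  ultimately show "(w * (w div b) - 1) * b < 2 ^ w" using lt by presburger
  have "w * (w div b) * 2 \<le> w * (w div b) * b" using assms(2) by simp
  moreover have "(4::nat) \<le> 2 ^ w" using power_increasing[OF assms(1), of "2::nat"] by simp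
  ultimately show "w * (w div b) < 2 ^ w" using lt by linarith
qed

lemma widen_triple:
  assumes "2 \<le> w" "2 \<le> b" "b \<le> w"
    and c: "reg c rOne = 1" "reg c rI = w - 1" "reg c rJ = w div b" "reg c rQ = w div b"
      "reg c rO = w div b * b" "reg c rSh = (w div b - 1) * b"
  shows "triple w (While rI (Blk [Add rQ rQ rJ, Add rSh rSh rO, Sub rI rI rOne])) (w * 5 + 1) {} {} c
    (\<lambda>c'. keep {rQ, rSh, rI} c c' \<and> reg c' rQ = w * (w div b) \<and> reg c' rSh = (w * (w div b) - 1) * b)"
proof -
  note sz = wide_sizes[OF assms(1-3)]
  define Inv where "Inv = (\<lambda>r c'. r < w \<and> keep {rQ, rSh, rI} c c' \<and> reg c' rI = r \<and>
    reg c' rQ = (w - r) * (w div b) \<and> reg c' rSh = ((w - r) * (w div b) - 1) * b)"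
  have "triple w (While rI (Blk [Add rQ rQ rJ, Add rSh rSh rO, Sub rI rI rOne])) (w * 5 + 1) {} {} c (Inv 0)"
  proof (rule triple_While)
    show "Inv (w - 1) c" using assms by (simp add: Inv_def keep_def)
    fix r c1 assume I: "Inv (Suc r) c1"
    define j where "j = w - Suc r"
    have r: "reg c1 rI = Suc r" "reg c1 rQ = j * (w div b)" "reg c1 rSh = (j * (w div b) - 1) * b"
      "reg c1 rOne = 1" "reg c1 rJ = w div b" "reg c1 rO = w div b * b" "keep {rQ, rSh, rI} c c1"
      "Suc r < w"
      using I c unfolding Inv_def keep_def j_def by simp_all
    have wr: "w - r = Suc j" "1 \<le> j" using r(8) by (auto simp: j_def)
    have "Suc j * (w div b) \<le> w * (w div b)" using wr(1) by (intro mult_le_mono1) simp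
    then have 1: "Suc j * (w div b) < 2 ^ w" "(Suc j * (w div b) - 1) * b < 2 ^ w"
      using sz(2,3) by (meson le_less_trans, meson diff_le_mono le_less_trans mult_le_mono1)
    have "1 \<le> j * (w div b)" using wr(2) sz(4) by (metis mult_le_mono nat_mult_1)
    then have 2: "(j * (w div b) - 1) * b + w div b * b = (Suc j * (w div b) - 1) * b"
      by (simp add: add_mult_distrib[symmetric] add.commute)
    have 3: "Suc r < 2 ^ w" using r(8) less_exp[of w] by linarith
    have "triple w (Blk [Add rQ rQ rJ, Add rSh rSh rO, Sub rI rI rOne]) 3 {} {} c1 (Inv r)"
      unfolding Inv_def using r(1-8) 1 2 3
      by (intro triple_Blk) (simp_all add: wr(1) add_bits_eq sub_bits_eq keep_def add.commute)
    with r(1) show "reg c1 rI \<noteq> 0 \<and> triple w (Blk [Add rQ rQ rJ, Add rSh rSh rO, Sub rI rI rOne]) 3 {} {} c1 (Inv r)"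
      by simp
  qed (auto simp: Inv_def)
  then show ?thesis by (rule triple_mono) (auto simp: Inv_def)
qed

section \<open>Both versions of the complete program\<close>

locale lcs_run =
  fixes w \<sigma> b k :: nat and X Y :: "nat list" and c :: config
  assumes w: "2 \<le> w" and init: "initial_config w \<sigma> X Y c" and \<sigma>: "2 \<le> \<sigma>"
    and XY: "set X \<subseteq> {..<\<sigma>}" "set Y \<subseteq> {..<\<sigma>}" "length X + length Y \<le> 2 ^ w" "X \<noteq> [] \<or> Y \<noteq> []"
    and b: "2 \<le> b" "b \<le> w" "\<sigma> + 1 < 2 ^ b" "2 ^ (b - 1) \<le> \<sigma> + 1"
    and k: "2 ^ k \<le> w" "w < 2 ^ Suc k"
begin

definition "m = length X"

definition "n = length Y"

definition "short = (if m \<le> n then X else Y)"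

definition "long = (if m \<le> n then Y else X)"

definition "sp = (if m \<le> n then 0 else m)"

definition "lp = (if m \<le> n then m else 0)"

definition final :: "nat \<Rightarrow> config \<Rightarrow> bool" where
  "final r c' \<longleftrightarrow> (\<exists>Z. longest_common_subseq Z X Y \<and> reg c' r = length Z)"

definition ready :: "config \<Rightarrow> bool" where
  "ready c' \<longleftrightarrow> mem c' = mem c \<and> reg c' 0 = m \<and> reg c' 1 = n \<and> reg c' rXpad = \<sigma> \<and> reg c' rOne = 1 \<and>
     reg c' rZero = 0 \<and> reg c' rSp = sp \<and> reg c' rSl = length short \<and> reg c' rLp = lp \<and>
     reg c' rLl = length long \<and> reg c' rW = w \<and> reg c' rB = b \<and> reg c' rB1 = b - 1 \<and>
     reg c' rYpad = \<sigma> + 1 \<and> reg c' rK = k \<and> reg c' rKm = mask k \<and> reg c' rQ = w div b \<and>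
     reg c' rO = w div b * b \<and> reg c' rSh = (w div b - 1) * b \<and>
     (reg c' rT2 = 0 \<longleftrightarrow> length short \<le> w div b)"

lemma lengths: "length short = min m n" "length long = max m n" "length short + length long = m + n"
  by (auto simp: short_def long_def m_def n_def)

lemma mn_less: "m < 2 ^ w" "n < 2 ^ w" "\<sigma> < 2 ^ w" "reg c 0 = m" "reg c 1 = n" "reg c 2 = \<sigma>"
proof -
  have "reg c i < 2 ^ w" for i using init by (simp add: initial_config_def wf_config_def)
  from this[of 0] this[of 1] this[of 2]
  show "m < 2 ^ w" "n < 2 ^ w" "\<sigma> < 2 ^ w" "reg c 0 = m" "reg c 1 = n" "reg c 2 = \<sigma>"
    using init by (simp_all add: initial_config_def m_def n_def)
qed

lemma short_long:
  "set short \<subseteq> {..<\<sigma>}" "set long \<subseteq> {..<\<sigma>}" "length short < 2 ^ w" "length long < 2 ^ w"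
  "sp + length short \<le> m + n" "lp + length long \<le> m + n" "long \<noteq> []"
  "i < length short \<Longrightarrow> mem c (sp + i) = short ! i" "j < length long \<Longrightarrow> mem c (lp + j) = long ! j"
  "sp < 2 ^ w" "lp < 2 ^ w"
  using XY mn_less(1,2) init unfolding initial_config_def short_def long_def sp_def lp_def m_def n_def
  by auto

lemma regions:
  "{sp ..< sp + length short} \<union> {lp ..< lp + length long} = {..<m + n}"
  "{lp ..< lp + length long} \<union> {sp ..< sp + length short} = {..<m + n}"
  by (auto simp: sp_def lp_def short_def long_def m_def n_def)

lemma finalI:
  assumes "reg c' r = lcs_tab ((!) short) ((!) long) (length short) (length long) \<or>
    reg c' r = lcs_tab ((!) long) ((!) short) (length long) (length short)"
  shows "final r c'"
proof -
  have sym: "longest_common_subseq Z long short \<longleftrightarrow> longest_common_subseq Z short long" for Z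
    unfolding longest_common_subseq_def common_subseq_def by blast
  have eq: "longest_common_subseq Z short long \<longleftrightarrow> longest_common_subseq Z X Y" for Z
    unfolding short_def long_def longest_common_subseq_def common_subseq_def by auto
  obtain Z Z' where "longest_common_subseq Z X Y" "longest_common_subseq Z' X Y"
    "length Z = lcs_tab ((!) short) ((!) long) (length short) (length long)"
    "length Z' = lcs_tab ((!) long) ((!) short) (length long) (length short)"
    using longest_common_subseq_tab[of short long] longest_common_subseq_tab[of long short]
    unfolding sym eq by blast
  with assms show ?thesis unfolding final_def by (elim disjE) force+
qed

lemma final_less:
  assumes "final r c'"
  shows "reg c' r < 2 ^ w"
proof -
  obtain Z where "subseq Z X" "reg c' r = length Z"
    using assms unfolding final_def longest_common_subseq_def common_subseq_def by blast
  then have "reg c' r \<le> m" unfolding m_def by (simp add: list_emb_length)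
  then show ?thesis using mn_less(1) by (rule le_less_trans)
qed

text \<open>Setup and final copy are common to both versions, so only the pass itself remains to be
  supplied, with cost \<open>K\<close>.\<close>

lemma lcs_com_triple:
  assumes "\<And>c'. ready c' \<Longrightarrow>
    triple w (IfZ rT2 narrow_pass wide_pass) K R W c' (\<lambda>c'. final rCnt c' \<and> reg c' rZero = 0)"
  shows "triple w lcs_com (w * 21 + (m + n) * 12 + K + 50) R W c (final 0)"
  unfolding lcs_com_def
proof (rule triple_Seq)
  have w0: "0 < w" "1 \<le> \<sigma>" using w \<sigma> by simp_all
  note ro = roles_triple[OF w0(1) mn_less(4,5,6,1,2) w0(2) mn_less(3)]
  show "triple w roles (m * 6 + 13) R W c (\<lambda>c'. roles_set m n \<sigma> c c' \<and> reg c' rT = \<sigma> - 1)"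
    by (rule triple_mono[OF ro order_refl empty_subsetI empty_subsetI])
  fix c1 assume "roles_set m n \<sigma> c c1 \<and> reg c1 rT = \<sigma> - 1"
  note 1 = this[unfolded roles_set_def]
  show "triple w (IfZ rT (Blk [Add 0 rSl rZero])
     (parameters ;; IfZ rT2 narrow_pass wide_pass ;; Blk [Add 0 rCnt rZero]))
     (w * 21 + (m + n) * 6 + K + 37) R W c1 (final 0)"
  proof (rule triple_IfZ[where K = "w * 21 + (m + n) * 6 + K + 35"])
    assume "reg c1 rT = 0"
    moreover have "reg c1 rT = \<sigma> - 1" using 1 by blast
    ultimately show "triple w (Blk [Add 0 rSl rZero]) (w * 21 + (m + n) * 6 + K + 35) R W c1 (final 0)"
      using \<sigma> by simp
  next
    have r1: "reg c1 rOne = 1" "reg c1 rZero = 0" "reg c1 rXpad = \<sigma>" "reg c1 rSl = length short"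
      using 1 by (simp_all add: lengths)
    show "triple w (parameters ;; IfZ rT2 narrow_pass wide_pass ;; Blk [Add 0 rCnt rZero])
      (w * 21 + (m + n) * 6 + K + 35) R W c1 (final 0)"
    proof (rule triple_Seq)
      show "triple w parameters (w * 21 + length short * 6 + 23) R W c1 ready"
      proof (rule triple_mono[OF parameters_triple[OF r1 short_long(3) b k]])
        fix c' assume 2: "keep {rT, rW, rYpad, rB, rB1, rK, rKm, rI, rJ, rQ, rO, rSh, rA, rT4, rT2} c1 c' \<and>
          reg c' rW = w \<and> reg c' rB = b \<and> reg c' rB1 = b - 1 \<and> reg c' rYpad = \<sigma> + 1 \<and>
          reg c' rK = k \<and> reg c' rKm = mask k \<and> reg c' rQ = w div b \<and> reg c' rO = w div b * b \<and>
          reg c' rSh = (w div b - 1) * b \<and> (reg c' rT2 = 0 \<longleftrightarrow> length short \<le> w div b)"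
        have "reg c' i = reg c1 i" if "i \<in> {0, 1, rXpad, rOne, rZero, rSp, rSl, rLp, rLl}" for i
        proof -
          have "i \<notin> {rT, rW, rYpad, rB, rB1, rK, rKm, rI, rJ, rQ, rO, rSh, rA, rT4, rT2}"
            using that by auto
          then show ?thesis using 2 unfolding keep_def by blast
        qed
        then have "reg c' 0 = reg c1 0" "reg c' 1 = reg c1 1" "reg c' rXpad = reg c1 rXpad"
          "reg c' rOne = reg c1 rOne" "reg c' rZero = reg c1 rZero" "reg c' rSp = reg c1 rSp"
          "reg c' rSl = reg c1 rSl" "reg c' rLp = reg c1 rLp" "reg c' rLl = reg c1 rLl" by blast+
        moreover have "mem c' = mem c1" using 2 unfolding keep_def by blast
        ultimately show "ready c'" unfolding ready_def sp_def lp_def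
          using 1 2 unfolding lengths by (elim conjE) (intro conjI; (assumption | simp only:))
      qed auto
      fix c2 assume "ready c2"
      then show "triple w (IfZ rT2 narrow_pass wide_pass ;; Blk [Add 0 rCnt rZero]) (K + 1) R W c2 (final 0)"
      proof (rule triple_Seq[OF assms])
        fix c3 assume 3: "final rCnt c3 \<and> reg c3 rZero = 0"
        then have "final 0 (set_reg 0 (reg c3 rCnt) c3)" by (simp add: final_def)
        then show "triple w (Blk [Add 0 rCnt rZero]) 1 R W c3 (final 0)"
          using 3 final_less[of rCnt c3] by (intro triple_Blk) (simp_all add: add_bits_eq)
      qed simp
    qed (simp add: lengths)
  qed simp
qed simp

lemma strips_le_1: "0 < q \<Longrightarrow> l \<le> q \<Longrightarrow> (l + q - 1) div q \<le> (1::nat)"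
  using less_mult_imp_div_less[of "l + q - 1" 2 q] by linarith

lemma narrow_triple:
  assumes s: "length short \<le> w div b"
  shows "triple w lcs_com (110 * w + 80 * (m + n) + 100) {..<m + n} {} c (final 0)"
proof -
  let ?F = "(\<lambda>c'. final rCnt c' \<and> reg c' rZero = 0)"
  let ?q = "w div b"
  have q: "1 \<le> ?q" using b by (simp add: div_greater_zero_iff Suc_le_eq)
  have ww: "w < 2 ^ w" by (rule less_exp)
  have qw: "?q \<le> w" by simp
  have qb: "?q * b \<le> w" by simp
  moreover have "(?q - 1) * b \<le> ?q * b" by (intro mult_le_mono1) simp
  ultimately have qb': "(?q - 1) * b < 2 ^ w" using ww by linarith
  \<comment> \<open>The shorter string is the only strip. A narrow pass has no memory of its own, so
    \<open>M.extra\<close> is empty.\<close>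
  interpret M: lcs_machine False w b ?q k \<sigma> short long sp lp 0
  proof
    show "sp + length short \<le> 2 ^ w" "lp + length long \<le> 2 ^ w"
      using short_long(5,6) XY(3) unfolding m_def n_def by linarith+
    show "?q < 2 ^ w" using qw ww by (rule le_less_trans)
  qed (use w b q qb qb' short_long s in \<open>simp_all add: vlen_def\<close>)
  have ex: "M.extra = {}" "M.input = {..<m + n}"
    using regions(1) by (simp_all add: M.extra_def M.input_def)
  have time: "(length short + ?q - 1) div ?q * (M.strip_time + 2) + 3 \<le> ?q * 88 + length long * 62 + 25"
  proof -
    have "(length short + ?q - 1) div ?q \<le> 1" using q s by (intro strips_le_1) auto
    then have "(length short + ?q - 1) div ?q * (M.strip_time + 2) \<le> 1 * (M.strip_time + 2)"
      by (rule mult_le_mono1)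
    moreover have "M.strip_time + 2 = ?q * 88 + length long * 62 + 22"
      by (simp add: M.strip_time_def algebra_simps)
    moreover have "z + 3 \<le> a + d + 25" if "z \<le> 1 * x" "x = a + d + 22" for z x a d :: nat
      using that by linarith
    ultimately show ?thesis by blast
  qed
  have "triple w lcs_com (w * 21 + (m + n) * 12 + (?q * 88 + length long * 62 + 32) + 50) {..<m + n} {} c (final 0)"
  proof (rule lcs_com_triple)
    fix c1 assume R: "ready c1"
    note R' = R[unfolded ready_def]
    show "triple w (IfZ rT2 narrow_pass wide_pass) (?q * 88 + length long * 62 + 32) {..<m + n} {} c1 ?F"
    proof (rule triple_IfZ[where K = "?q * 88 + length long * 62 + 30"])
      assume "reg c1 rT2 \<noteq> 0"
      with R' s show "triple w wide_pass (?q * 88 + length long * 62 + 30) {..<m + n} {} c1 ?F" by simp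
    next
      show "triple w narrow_pass (?q * 88 + length long * 62 + 30) {..<m + n} {} c1 ?F"
        unfolding narrow_pass_def
      proof (rule triple_Seq)
        show "triple w (Blk [Add rXp rSp rZero, Add rXr rSl rZero, Add rYp0 rLp rZero, Add rYn rLl rZero]) 4
          {..<m + n} {} c1 (\<lambda>c'. M.fixed c' \<and> reg c' rXp = take_bit w sp \<and> reg c' rXr = length short)"
          using R' short_long
          by (intro triple_Blk) (simp_all add: M.fixed_def add_bits_eq take_bit_nat_eq_self)
        fix c2 assume 2: "M.fixed c2 \<and> reg c2 rXp = take_bit w sp \<and> reg c2 rXr = length short"
        have "triple w (pass False) ((length short + ?q - 1) div ?q * (M.strip_time + 2) + 3)
          {..<m + n} {} c2 (\<lambda>c'. reg c' rCnt = lcs_tab ((!) short) ((!) long) (length short) (length long) \<and>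
            M.fixed c')"
          using M.pass_triple 2 unfolding ex by simp
        then show "triple w (pass False) (?q * 88 + length long * 62 + 25) {..<m + n} {} c2 ?F"
        proof (rule triple_mono)
          fix c' assume 3: "reg c' rCnt = lcs_tab ((!) short) ((!) long) (length short) (length long) \<and>
            M.fixed c'"
          then have "reg c' rZero = 0" unfolding M.fixed_def by simp
          with 3 finalI[of c' rCnt] show "final rCnt c' \<and> reg c' rZero = 0" by blast
        qed (use time in auto)
      qed simp
    qed simp
  qed
  then show ?thesis
  proof (rule triple_mono)
    have "length long \<le> m + n" using lengths(3) by linarith
    moreover have "a * 21 + d * 12 + (e * 88 + f * 62 + 32) + 50 \<le> 110 * a + 80 * d + 100"
      if "e \<le> a" "f \<le> d" for a d e f :: nat
      using that by linarith
    ultimately show "w * 21 + (m + n) * 12 + (?q * 88 + length long * 62 + 32) + 50 \<le> 110 * w + 80 * (m + n) + 100"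
      using qw by blast
  qed auto
qed

definition "strips = (length long + w * (w div b) - 1) div (w * (w div b))"

definition "scratch = {m + n .. m + n + 1 + (length short - 1) div 2 ^ k}"

lemma wide_triple:
  assumes s: "w div b < length short" and mem: "m + n + 1 + (length short - 1) div 2 ^ k < 2 ^ w"
  shows "triple w lcs_com (110 * w + 80 * (m + n) + 100 +
      strips * (w * (w div b) * 88 + length short * 62 + 22))
    ({..<m + n} \<union> scratch) scratch c (final 0)"
proof -
  let ?F = "(\<lambda>c'. final rCnt c' \<and> reg c' rZero = 0)"
  let ?d = "w div b"
  let ?q = "w * ?d"
  note sz = wide_sizes[OF w b(1,2)]
  have ww: "w < 2 ^ w" by (rule less_exp)
  \<comment> \<open>The arguments are exchanged, because the boundary array needs one bit per
    streamed symbol; it starts behind the input.\<close>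
  interpret M: lcs_machine True w b ?q k \<sigma> long short lp sp "m + n"
  proof
    show "lp + length long \<le> 2 ^ w" "sp + length short \<le> 2 ^ w"
      using short_long(5,6) XY(3) unfolding m_def n_def by linarith+
    show "short \<noteq> []" using s by auto
  qed (use w b k sz short_long mem in \<open>simp_all add: vlen_def\<close>)
  have ex: "M.extra = scratch" "M.input = {..<m + n}"
    using regions(2) unfolding M.extra_def M.input_def scratch_def by simp_all
  have time: "M.strip_time + 2 = ?q * 88 + length short * 62 + 22"
    by (simp add: M.strip_time_def)
  let ?K = "strips * (?q * 88 + length short * 62 + 22)"
  let ?in = "{..<m + n} \<union> scratch"
  have "triple w lcs_com (w * 21 + (m + n) * 12 + (?K + w * 5 + 16) + 50) ?in scratch c (final 0)"
  proof (rule lcs_com_triple)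
    fix c1 assume R: "ready c1"
    note R' = R[unfolded ready_def]
    show "triple w (IfZ rT2 narrow_pass wide_pass) (?K + w * 5 + 16) ?in scratch c1 ?F"
    proof (rule triple_IfZ[where K = "?K + w * 5 + 14"])
      assume "reg c1 rT2 = 0"
      with R' s show "triple w narrow_pass (?K + w * 5 + 14) ?in scratch c1 ?F" by simp
    next
      define B where "B = (\<lambda>c' :: config. reg c' rOne = 1 \<and> reg c' rZero = 0 \<and> reg c' rB = b \<and> reg c' rB1 = b - 1 \<and>
        reg c' rXpad = \<sigma> \<and> reg c' rYpad = \<sigma> + 1 \<and> reg c' rYp0 = sp \<and> reg c' rYn = length short \<and>
        reg c' rK = k \<and> reg c' rKm = mask k \<and> reg c' rScr = m + n \<and> reg c' rBB = m + n + 1 \<and>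
        mem c' = mem c \<and> reg c' rXp = lp \<and> reg c' rXr = length long)"
      have "?d < 2 ^ w" using ww by (meson div_le_dividend le_less_trans)
      moreover have "m + n < 2 ^ w" "m + n + 1 < 2 ^ w" using mem by simp_all
      ultimately have 1: "triple w (Blk [Add rXp rLp rZero, Add rXr rLl rZero, Add rYp0 rSp rZero, Add rYn rSl rZero,
         Add rScr 0 1, Add rBB rScr rOne, Add rJ rQ rZero, Sub rI rW rOne]) 8 ?in scratch c1
        (\<lambda>c'. B c' \<and> reg c' rOne = 1 \<and> reg c' rI = w - 1 \<and> reg c' rJ = ?d \<and> reg c' rQ = ?d \<and>
           reg c' rO = ?d * b \<and> reg c' rSh = (?d - 1) * b)"
        using R' short_long(3,4,10,11) w ww
        by (intro triple_Blk) (simp_all add: B_def add_bits_eq sub_bits_eq)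
      show "triple w wide_pass (?K + w * 5 + 14) ?in scratch c1 ?F"
        unfolding wide_pass_def
      proof (rule triple_Seq[OF 1])
        fix c2 assume 2: "B c2 \<and> reg c2 rOne = 1 \<and> reg c2 rI = w - 1 \<and> reg c2 rJ = ?d \<and> reg c2 rQ = ?d \<and>
           reg c2 rO = ?d * b \<and> reg c2 rSh = (?d - 1) * b"
        show "triple w (While rI (Blk [Add rQ rQ rJ, Add rSh rSh rO, Sub rI rI rOne]) ;; pass True)
          (?K + w * 5 + 6) ?in scratch c2 ?F"
        proof (rule triple_Seq)
          show "triple w (While rI (Blk [Add rQ rQ rJ, Add rSh rSh rO, Sub rI rI rOne])) (w * 5 + 1) ?in scratch c2
            (\<lambda>c'. M.fixed c' \<and> reg c' rXp = take_bit w lp \<and> reg c' rXr = length long)"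
          proof (rule triple_mono[OF widen_triple[OF w b(1,2), of c2]])
            fix c' assume 3: "keep {rQ, rSh, rI} c2 c' \<and> reg c' rQ = ?q \<and> reg c' rSh = (?q - 1) * b"
            then have "B c'" using 2 unfolding B_def keep_def by simp
            with 3 show "M.fixed c' \<and> reg c' rXp = take_bit w lp \<and> reg c' rXr = length long"
              using short_long unfolding B_def M.fixed_def by (simp add: take_bit_nat_eq_self)
          qed (use 2 in auto)
          fix c3 assume 3: "M.fixed c3 \<and> reg c3 rXp = take_bit w lp \<and> reg c3 rXr = length long"
          have "triple w (pass True) ((length long + ?q - 1) div ?q * (M.strip_time + 2) + 3)
            ?in scratch c3 (\<lambda>c'. reg c' rCnt = lcs_tab ((!) long) ((!) short) (length long) (length short) \<and>
              M.fixed c')"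
            using M.pass_triple 3 unfolding ex by simp
          then show "triple w (pass True) (?K + 3) ?in scratch c3 ?F"
          proof (rule triple_mono)
            fix c' assume 4: "reg c' rCnt = lcs_tab ((!) long) ((!) short) (length long) (length short) \<and>
              M.fixed c'"
            then have "reg c' rZero = 0" unfolding M.fixed_def by simp
            with 4 finalI[of c' rCnt] show "final rCnt c' \<and> reg c' rZero = 0" by blast
          qed (use time in \<open>simp_all add: strips_def\<close>)
        qed simp
      qed simp
    qed simp
  qed
  then show ?thesis by (rule triple_mono) auto
qed

end

text \<open>Both strings repeat the same letter, so the shorter one is a common subsequence. Here
  the word size may be \<open>1\<close>, too small for fields of two bits.\<close>

lemma unary_triple:
  assumes "0 < w" "initial_config w 1 X Y c" "set X \<subseteq> {..<1}" "set Y \<subseteq> {..<1}"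
  shows "triple w lcs_com (length X * 6 + 20) {} {} c
    (\<lambda>c'. \<exists>Z. longest_common_subseq Z X Y \<and> reg c' 0 = length Z)"
proof -
  let ?m = "length X" and ?n = "length Y"
  have r: "?m < 2 ^ w" "?n < 2 ^ w" "1 < (2::nat) ^ w" "reg c 0 = ?m" "reg c 1 = ?n" "reg c 2 = 1"
  proof -
    have "reg c i < 2 ^ w" for i using assms(2) by (simp add: initial_config_def wf_config_def)
    from this[of 0] this[of 1] this[of 2]
    show "?m < 2 ^ w" "?n < 2 ^ w" "1 < (2::nat) ^ w" "reg c 0 = ?m" "reg c 1 = ?n" "reg c 2 = 1"
      using assms(2) by (simp_all add: initial_config_def)
  qed
  have X: "X = replicate ?m 0" "Y = replicate ?n 0"
    using assms(3,4) by (auto intro!: replicate_eqI)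
  have pre: "subseq (replicate (min ?m ?n) 0) (replicate l 0)" if "min ?m ?n \<le> l" for l
    using that by (metis le_add_diff_inverse prefixI prefix_imp_subseq replicate_add)
  have "subseq (replicate (min ?m ?n) 0) X" by (subst X(1)) (rule pre, simp)
  moreover have "subseq (replicate (min ?m ?n) 0) Y" by (subst X(2)) (rule pre, simp)
  ultimately have "longest_common_subseq (replicate (min ?m ?n) 0) X Y"
    unfolding longest_common_subseq_def common_subseq_def by (auto dest: list_emb_length)
  then have lcs: "\<exists>Z. longest_common_subseq Z X Y \<and> min ?m ?n = length Z" by force
  show ?thesis
    unfolding lcs_com_def
  proof (rule triple_Seq[OF roles_triple[OF assms(1) r(4,5,6,1,2) le_refl r(3)]])
    fix c1 assume "roles_set ?m ?n 1 c c1 \<and> reg c1 rT = 1 - 1"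
    note 1 = this[unfolded roles_set_def]
    show "triple w (IfZ rT (Blk [Add 0 rSl rZero])
     (parameters ;; IfZ rT2 narrow_pass wide_pass ;; Blk [Add 0 rCnt rZero])) 7 {} {} c1
      (\<lambda>c'. \<exists>Z. longest_common_subseq Z X Y \<and> reg c' 0 = length Z)"
    proof (rule triple_IfZ)
      show "triple w (Blk [Add 0 rSl rZero]) 1 {} {} c1
        (\<lambda>c'. \<exists>Z. longest_common_subseq Z X Y \<and> reg c' 0 = length Z)"
      proof -
        have "min ?m ?n < 2 ^ w" using r(1) by simp
        moreover have "reg c1 rSl = min ?m ?n" "reg c1 rZero = 0" using 1 by blast+
        ultimately show ?thesis using lcs by (intro triple_Blk) (simp_all add: add_bits_eq)
      qed
    next
      assume "reg c1 rT \<noteq> 0"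
      then show "triple w (parameters ;; IfZ rT2 narrow_pass wide_pass ;; Blk [Add 0 rCnt rZero]) 1 {} {} c1
        (\<lambda>c'. \<exists>Z. longest_common_subseq Z X Y \<and> reg c' 0 = length Z)"
        using 1 by simp
    qed simp
  qed simp
qed

section \<open>From triples to the machine model\<close>

definition lcs_program :: program where
  "lcs_program = compile 0 lcs_com @ [Halt]"

lemma computesI:
  assumes "\<And>c. initial_config w \<sigma> X Y c \<Longrightarrow> \<exists>K E. triple w lcs_com K ({..<length X + length Y} \<union> E) E c
      (\<lambda>c'. \<exists>Z. longest_common_subseq Z X Y \<and> reg c' 0 = length Z) \<and>
      real K \<le> time \<and> finite E \<and> E \<inter> {..<length X + length Y} = {} \<and> real (card E) \<le> space"
  shows "computes_lcs_length w lcs_program \<sigma> X Y time space"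
  unfolding computes_lcs_length_def
proof (intro allI impI)
  fix c assume c: "initial_config w \<sigma> X Y c"
  let ?I = "{..<length X + length Y}"
  from assms[OF c] obtain K E where 1: "triple w lcs_com K (?I \<union> E) E c
      (\<lambda>c'. \<exists>Z. longest_common_subseq Z X Y \<and> reg c' 0 = length Z)"
    "real K \<le> time" "finite E" "E \<inter> ?I = {}" "real (card E) \<le> space" by blast
  have "code_at (Q @ R) 0 Q" for Q R :: program by (simp add: code_at_def nth_append)
  then have code: "code_at lcs_program 0 (compile 0 lcs_com)" unfolding lcs_program_def .
  from 1(1)[unfolded triple_def, rule_format, OF code] obtain t A B c' where 2: "exec w lcs_program (c\<lparr>pc := 0\<rparr>) t A B (c'\<lparr>pc := 0 + clen lcs_com\<rparr>)"
    "t \<le> K" "A \<subseteq> ?I \<union> E" "B \<subseteq> E" "\<exists>Z. longest_common_subseq Z X Y \<and> reg c' 0 = length Z"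
    by blast
  have "pc c = 0" using c unfolding initial_config_def by blast
  then have c0: "c\<lparr>pc := 0\<rparr> = c" by (cases c) simp
  have h: "halted lcs_program (c'\<lparr>pc := 0 + clen lcs_com\<rparr>)"
    unfolding halted_def lcs_program_def by (simp add: nth_append)
  have Z: "\<exists>Z. longest_common_subseq Z X Y \<and> reg (c'\<lparr>pc := 0 + clen lcs_com\<rparr>) 0 = length Z"
    using 2(5) by simp
  have "(A \<union> B) - ?I \<subseteq> E" using 2(3,4) by blast
  then have "card ((A \<union> B) - ?I) \<le> card E" using 1(3) by (rule card_mono[rotated])
  then have "real (card ((A \<union> B) - ?I)) \<le> space" using 1(5) by linarith
  moreover have "real t \<le> time" using 1(2) 2(2) by linarith
  moreover have "B \<inter> ?I = {}" using 1(4) 2(4) by blast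
  ultimately show "\<exists>t A B c'. exec w lcs_program c t A B c' \<and> halted lcs_program c' \<and>
    (\<exists>Z. longest_common_subseq Z X Y \<and> reg c' 0 = length Z) \<and> real t \<le> time \<and>
    B \<inter> ?I = {} \<and> real (card ((A \<union> B) - ?I)) \<le> space"
    using 2(1)[unfolded c0] h Z by blast
qed

section \<open>Time and space bounds\<close>

text \<open>Used to bound \<open>w^2\<close> by a multiple of \<open>m + n\<close>. The constant
  comes from \<open>ln x = 2 * ln (sqrt x) \<le> 2 * sqrt x\<close> and
  \<open>1 / 2 \<le> ln 2\<close>.\<close>

lemma log2_le_sqrt:
  assumes "1 \<le> (x::real)"
  shows "log 2 x \<le> 4 * sqrt x"
proof -
  have "ln x = 2 * ln (sqrt x)" using assms by (simp add: ln_sqrt)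
  also have "ln (sqrt x) \<le> sqrt x" using assms ln_le_minus_one[of "sqrt x"] by simp
  finally have "ln x \<le> 2 * sqrt x" by simp
  moreover have "1 / 2 \<le> ln (2::real)"
  proof -
    have "exp (1 / 2) ^ 2 = exp (1::real)" by (simp add: exp_double[symmetric] power2_eq_square flip: exp_add)
    also have "\<dots> \<le> 2 ^ 2" using exp_le by simp
    finally have "exp (1 / 2) \<le> (2::real)" by (rule power2_le_imp_le) simp
    then show ?thesis by (subst ln_ge_iff) auto
  qed
  moreover have "0 \<le> log 2 x" using assms by simp
  ultimately have "log 2 x * (1 / 2) \<le> 2 * sqrt x"
    using mult_left_mono[of "1 / 2" "ln 2" "log 2 x"] by (simp add: log_def)
  then show ?thesis by simp
qed

lemma bit_length_exists:
  assumes "1 \<le> (x::nat)"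
  obtains b where "1 \<le> b" "x < 2 ^ b" "2 ^ (b - 1) \<le> x"
proof -
  define b where "b = (LEAST b. x < 2 ^ b)"
  have b: "x < 2 ^ b" unfolding b_def by (rule LeastI[of _ x]) (rule less_exp)
  moreover have "1 \<le> b" using b assms by (cases b) auto
  moreover have "2 ^ (b - 1) \<le> x"
    using \<open>1 \<le> b\<close> not_less_Least[of "b - 1" "\<lambda>b. x < 2 ^ b"] unfolding b_def by (simp add: not_less)
  ultimately show ?thesis using that by blast
qed

text \<open>\<open>\<sigma> + 1 \<le> 2 * \<sigma>\<close> gives
  \<open>b \<le> 2 + log 2 \<sigma>\<close>, and the \<open>2\<close> is absorbed since
  \<open>log 2 \<sigma>\<close> is at least \<open>1\<close>.\<close>

lemma field_width_le:
  assumes "2 \<le> \<sigma>" "1 \<le> b" "2 ^ (b - 1) \<le> \<sigma> + 1"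
  shows "real b \<le> 3 * log 2 (real \<sigma>)"
proof -
  have "real (2 ^ (b - 1)) \<le> real (2 * \<sigma>)" using assms(1,3) by (simp only: of_nat_le_iff)
  then have "2 ^ (b - 1) \<le> 2 * real \<sigma>" by simp
  then have "real (b - 1) \<le> log 2 (2 * real \<sigma>)" by (rule le_log_of_power) simp
  also have "\<dots> = 1 + log 2 (real \<sigma>)" using assms(1) by (simp add: log_mult)
  finally have "real b \<le> 2 + log 2 (real \<sigma>)" using assms(2) by simp
  moreover have "1 \<le> log 2 (real \<sigma>)" using assms(1) by (simp add: le_log_iff)
  ultimately show ?thesis by linarith
qed

text \<open>Rounding down loses less than \<open>b\<close>, and at least one field fits, so at most
  half of the word is wasted.\<close>

lemma half_quotient: "0 < b \<Longrightarrow> b \<le> w \<Longrightarrow> w \<le> 2 * (w div b * (b::nat))"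
proof -
  assume a: "0 < b" "b \<le> w"
  then have "b \<le> w div b * b" by (metis div_greater_zero_iff le_add1 mult_Suc Suc_pred)
  moreover have "w mod b < b" using a by simp
  ultimately show ?thesis using div_mult_mod_eq[of w b] by linarith
qed

lemma nat_div_le: "0 < q \<Longrightarrow> real ((l + q - 1) div q) \<le> real l / real q + 1"
proof -
  assume q: "0 < q"
  have "real ((l + q - 1) div q) \<le> real (l + q - 1) / real q" by (rule of_nat_div_le_of_nat)
  also have "\<dots> \<le> real (l + q) / real q" by (intro divide_right_mono) auto
  also have "\<dots> = real l / real q + 1" using q by (simp add: add_divide_distrib)
  finally show ?thesis .
qed

lemma computes_lcs_program:
  fixes X Y :: "nat list" and \<sigma> w :: nat and c2 :: real
  defines "m \<equiv> length X" and "n \<equiv> length Y"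
  assumes \<sigma>: "1 \<le> \<sigma>" "set X \<subseteq> {..<\<sigma>}" "set Y \<subseteq> {..<\<sigma>}" "\<lceil>log 2 (real \<sigma>)\<rceil> \<le> int w - 1"
    and c2: "0 < c2" "real w \<le> c2 * max (log 2 (real n)) (log 2 (real m))"
    and space: "real m + real n + 8 * (real (min n m) / real w * log 2 (real \<sigma>)) \<le> 2 ^ w"
  shows "computes_lcs_length w lcs_program \<sigma> X Y
    (2000 * (1 + 16 * c2\<^sup>2) * (real n * real m / (real w)\<^sup>2 * log 2 (real \<sigma>) + real m + real n))
    (8 * (real (min n m) / real w * log 2 (real \<sigma>)))"
proof -
  define \<Lambda> where "\<Lambda> = log 2 (real \<sigma>)"
  define M where "M = real m + real n"
  define P where "P = real n * real m / (real w)\<^sup>2 * \<Lambda>"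
  \<comment> \<open>\<open>16 * c2\<^sup>2\<close> comes from \<open>ww\<close>; \<open>2000\<close>
    generously exceeds all coefficients that are collected below.\<close>
  define T where "T = 2000 * (1 + 16 * c2\<^sup>2)"
  have \<Lambda>0: "0 \<le> \<Lambda>" using \<sigma>(1) by (simp add: \<Lambda>_def)
  then have "0 \<le> \<lceil>\<Lambda>\<rceil>" by simp
  then have w1: "1 \<le> w" using \<sigma>(4) unfolding \<Lambda>_def by linarith
  have P0: "0 \<le> P" using \<Lambda>0 by (simp add: P_def)
  have log0: "log 2 (0::real) = 0" by (simp add: log_def)
  have M1: "1 \<le> M"
  proof (rule ccontr)
    assume "\<not> 1 \<le> M"
    then have "m = 0" "n = 0" unfolding M_def by linarith+
    \<comment> \<open>For two empty strings the upper bound on \<open>w\<close> is \<open>0\<close>,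
      as \<open>log 2 0\<close> is \<open>0\<close> in HOL.\<close>
    then show False using c2 w1 log0 by simp
  qed
  have "log 2 (real a) \<le> log 2 M" if "real a \<le> M" for a :: nat
  proof (cases "a = 0")
    case True
    then show ?thesis using M1 log0 by simp
  next
    case False
    then show ?thesis using that by simp
  qed
  then have "max (log 2 (real n)) (log 2 (real m)) \<le> log 2 M" by (simp add: M_def)
  also have "\<dots> \<le> 4 * sqrt M" using M1 by (rule log2_le_sqrt)
  finally have "real w \<le> c2 * (4 * sqrt M)"
    using c2 mult_left_mono[of _ "4 * sqrt M" c2] by (meson less_eq_real_def order_trans)
  then have "(real w)\<^sup>2 \<le> (c2 * (4 * sqrt M))\<^sup>2" by (intro power_mono) auto
  also have "\<dots> = 16 * c2\<^sup>2 * M" using M1 by (simp add: power_mult_distrib)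
  \<comment> \<open>This converts the latency \<open>q \<le> w * w\<close> and the setup time into
    time linear in \<open>m + n\<close>.\<close>
  finally have ww: "(real w)\<^sup>2 \<le> 16 * c2\<^sup>2 * M" .
  have w_ww: "real w \<le> (real w)\<^sup>2" using w1 by (simp add: self_le_power)
  have Tbound: "T * (P + real m + real n) = 2000 * P + 2000 * M + 2000 * (16 * c2\<^sup>2 * M) + 2000 * (16 * c2\<^sup>2 * P)"
    by (simp add: T_def M_def algebra_simps)
  have cP: "0 \<le> 16 * c2\<^sup>2 * P" using P0 by simp
  have short_time: "real (110 * w + 80 * (m + n) + 100) \<le> T * (P + real m + real n)"
  proof -
    have "real (110 * w + 80 * (m + n) + 100) = 110 * real w + 80 * M + 100" by (simp add: M_def)
    then show ?thesis using Tbound cP P0 M1 w_ww ww by linarith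
  qed
  show ?thesis
    unfolding \<Lambda>_def[symmetric] P_def[symmetric] T_def[symmetric]
  proof (rule computesI)
    fix c assume c: "initial_config w \<sigma> X Y c"
    let ?Q = "\<lambda>c'. \<exists>Z. longest_common_subseq Z X Y \<and> reg c' 0 = length Z"
    show "\<exists>K E. triple w lcs_com K ({..<length X + length Y} \<union> E) E c ?Q \<and>
      real K \<le> T * (P + real m + real n) \<and> finite E \<and> E \<inter> {..<length X + length Y} = {} \<and>
      real (card E) \<le> 8 * (real (min n m) / real w * \<Lambda>)"
    proof (cases "\<sigma> = 1")
      case True
      have "triple w lcs_com (m * 6 + 20) {} {} c ?Q"
        unfolding m_def using w1 c \<sigma> True by (intro unary_triple) auto
      then have "triple w lcs_com (110 * w + 80 * (m + n) + 100) ({..<length X + length Y} \<union> {}) {} c ?Q"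
        by (rule triple_mono) auto
      then show ?thesis using short_time \<Lambda>0
        by (intro exI[of _ "110 * w + 80 * (m + n) + 100"] exI[of _ "{}"]) simp
    next
      case False
      then have \<sigma>2: "2 \<le> \<sigma>" using \<sigma>(1) by simp
      have "log 2 (real \<sigma>) \<le> of_int \<lceil>log 2 (real \<sigma>)\<rceil>" by (rule le_of_int_ceiling)
      also have "\<dots> \<le> of_int (int w - 1)" using \<sigma>(4) by (simp only: of_int_le_iff)
      also have "\<dots> = real (w - 1)" using w1 by (simp add: of_nat_diff)
      finally have "log 2 (real \<sigma>) \<le> real (w - 1)" .
      then have "real \<sigma> \<le> 2 powr real (w - 1)" using \<sigma>2 by (simp add: log_le_iff)
      then have "real \<sigma> \<le> real (2 ^ (w - 1))" by (simp add: powr_realpow)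
      then have \<sigma>w: "\<sigma> \<le> 2 ^ (w - 1)" by (simp only: of_nat_le_iff)
      have w2: "2 \<le> w"
      proof (rule ccontr)
        assume "\<not> 2 \<le> w"
        then have "w = 1" using w1 by simp
        then show False using \<sigma>w \<sigma>2 by simp
      qed
      obtain b where b: "1 \<le> b" "\<sigma> + 1 < 2 ^ b" "2 ^ (b - 1) \<le> \<sigma> + 1"
        using bit_length_exists[of "\<sigma> + 1"] by auto
      have b2: "2 \<le> b"
      proof (rule ccontr)
        assume "\<not> 2 \<le> b"
        then have "b = 1" using b(1) by simp
        then show False using b(2) \<sigma>2 by simp
      qed
      \<comment> \<open>The alphabet bound leaves one bit of a word free, which is the room for the
        two padding symbols.\<close>
      have "b \<le> w"
      proof -
        have "2 ^ w = 2 * (2::nat) ^ (w - 1)" using w1 by (metis One_nat_def Suc_le_D diff_Suc_1 power_Suc)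
        moreover have "(2::nat) ^ 1 \<le> 2 ^ (w - 1)" using w2 by (intro power_increasing) auto
        ultimately have "(2::nat) ^ (b - 1) < 2 ^ w" using b(3) \<sigma>w by simp
        then have "b - 1 < w" by (rule power_less_imp_less_exp[rotated]) simp
        then show ?thesis by simp
      qed
      obtain k' where k': "1 \<le> k'" "w < 2 ^ k'" "2 ^ (k' - 1) \<le> w" using bit_length_exists[OF w1] .
      define k where "k = k' - 1"
      have k: "2 ^ k \<le> w" "w < 2 ^ Suc k" using k' by (simp_all add: k_def)
      have b3: "real b \<le> 3 * \<Lambda>" unfolding \<Lambda>_def using \<sigma>2 b(1,3) by (rule field_width_le)
      have "0 \<le> 8 * (real (min n m) / real w * \<Lambda>)" using \<Lambda>0 by simp
      then have "real m + real n \<le> 2 ^ w" using space unfolding \<Lambda>_def by linarith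
      then have "real (m + n) \<le> real (2 ^ w)" by simp
      then have mn: "m + n \<le> 2 ^ w" by (simp only: of_nat_le_iff)
      have ne: "X \<noteq> [] \<or> Y \<noteq> []" using M1 unfolding M_def m_def n_def by auto
      interpret R: lcs_run w \<sigma> b k X Y c
        by unfold_locales (use w2 c \<sigma>2 \<sigma> mn ne b2 \<open>b \<le> w\<close> b k in \<open>simp_all add: m_def n_def\<close>)
      have Rmn: "R.m = m" "R.n = n" by (simp_all add: R.m_def R.n_def m_def n_def)
      have fin: "R.final 0 = ?Q" by (rule ext) (simp add: R.final_def)
      have ls: "length R.short = min n m" "length R.long = max n m"
        using R.lengths(1,2) unfolding Rmn by (simp_all add: min.commute max.commute)
      show ?thesis
      proof (cases "length R.short \<le> w div b")
        case True
        from R.narrow_triple[OF this]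
        have "triple w lcs_com (110 * w + 80 * (m + n) + 100) ({..<length X + length Y} \<union> {}) {} c ?Q"
          unfolding Rmn fin by (simp add: m_def n_def)
        then show ?thesis using short_time \<Lambda>0
          by (intro exI[of _ "110 * w + 80 * (m + n) + 100"] exI[of _ "{}"]) simp
      next
        case False
        define s where "s = min n m"
        define l where "l = max n m"
        define q where "q = w * (w div b)"
        have s: "w div b < s" using False unfolding ls s_def by (rule not_le_imp_less)
        have d1: "1 \<le> w div b" using \<open>b \<le> w\<close> b2 by (simp add: div_greater_zero_iff Suc_le_eq)
        have q1: "1 \<le> q" using d1 w1 unfolding q_def by (metis mult_le_mono nat_mult_1)
        have "w < s * b"
        proof -
          have "Suc (w div b) * b \<le> s * b" using s by (intro mult_le_mono1) simp
          moreover have "w < Suc (w div b) * b" using b2 dividend_less_div_times[of b w] by simp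
          ultimately show ?thesis by (rule less_le_trans[rotated])
        qed
        then have "real w \<le> real (s * b)" by (simp only: of_nat_le_iff less_imp_le)
        also have "\<dots> \<le> real s * (3 * \<Lambda>)" using b3 by (simp add: mult_left_mono)
        finally have "real w \<le> 3 * (real s * \<Lambda>)" by simp
        \<comment> \<open>The shorter string does not fit into a word of \<open>b\<close>-bit
          fields, so the quantity in the space bound cannot be small.\<close>
        then have third: "1 \<le> 3 * (real s / real w * \<Lambda>)" using w1 by (simp add: field_simps)
        have \<Lambda>1: "1 \<le> \<Lambda>" unfolding \<Lambda>_def using \<sigma>2 by (simp add: le_log_iff)
        define d where "d = (s - 1) div 2 ^ k"
        \<comment> \<open>More than half of the bits of a word are used, since \<open>2 ^ k\<close>
          exceeds \<open>w / 2\<close>; hence the factor \<open>2\<close>.\<close>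
        have words: "real d \<le> 2 * (real s / real w * \<Lambda>)"
        proof -
          have "real d \<le> real (s - 1) / real (2 ^ k)"
            unfolding d_def by (rule of_nat_div_le_of_nat)
          also have "\<dots> \<le> real s / real (2 ^ k)" by (intro divide_right_mono) auto
          also have "\<dots> \<le> real s / (real w / 2)"
          proof (rule divide_left_mono)
            have "real w \<le> real (2 ^ Suc k)" using k(2) by (simp only: of_nat_le_iff)
            then show "real w / 2 \<le> real (2 ^ k)" by simp
          qed (use w1 in auto)
          also have "\<dots> = 2 * (real s / real w * 1)" by simp
          also have "\<dots> \<le> 2 * (real s / real w * \<Lambda>)" using \<Lambda>1 by (intro mult_left_mono) auto
          finally show ?thesis .
        qed
        \<comment> \<open>The \<open>2\<close> counts the scratch word and the first word of the
          array, which has \<open>d + 1\<close> words.\<close>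
        have card: "card R.scratch = 2 + d"
          by (simp add: R.scratch_def ls s_def d_def)
        \<comment> \<open>With \<open>x = s / w * \<Lambda>\<close>, the two words cost at most
          \<open>6 * x\<close> by \<open>third\<close> and the others at most \<open>2 * x\<close>
          by \<open>words\<close>; this is the origin of the constant \<open>8\<close>.\<close>
        have sp: "real (2 + d) \<le> 8 * (real (min n m) / real w * \<Lambda>)"
        proof -
          have "2 + y \<le> 8 * x" if "y \<le> 2 * x" "1 \<le> 3 * x" for x y :: real using that by linarith
          from this[OF words third] show ?thesis unfolding s_def[symmetric] by simp
        qed
        \<comment> \<open>The input together with the permitted space fits into memory, so all
          scratch addresses are valid.\<close>
        have "real (m + n + 2 + d) \<le> real (2 ^ w)"
        proof -
          have "a + e + 2 + y \<le> z" if "2 + y \<le> x" "a + e + x \<le> z" for a e x y z :: real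
            using that by linarith
          from this[OF sp[unfolded of_nat_add of_nat_numeral] space[folded \<Lambda>_def]] show ?thesis by simp
        qed
        then have "m + n + 2 + d \<le> 2 ^ w" by (simp only: of_nat_le_iff)
        then have mem: "R.m + R.n + 1 + (length R.short - 1) div 2 ^ k < 2 ^ w"
          unfolding Rmn ls s_def[symmetric] d_def[symmetric] by simp
        define K where "K = 110 * w + 80 * (m + n) + 100 + R.strips * (q * 88 + s * 62 + 22)"
        have "triple w lcs_com K ({..<length X + length Y} \<union> R.scratch) R.scratch c ?Q"
          using R.wide_triple[OF _ mem] s unfolding Rmn fin ls s_def[symmetric] q_def[symmetric] K_def
          by (simp add: m_def n_def)
        moreover have "real K \<le> T * (P + real m + real n)"
        proof -
          have strips: "real R.strips \<le> real l / real q + 1"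
            unfolding R.strips_def ls l_def[symmetric] q_def[symmetric] using q1 by (intro nat_div_le) simp
          have slM: "real s + real l = M" "real s * real l = real n * real m"
            by (auto simp: s_def l_def M_def min_def max_def)
          have qw: "real q \<le> (real w)\<^sup>2"
          proof -
            have "q \<le> w * w" unfolding q_def by simp
            then have "real q \<le> real (w * w)" by (simp only: of_nat_le_iff)
            then show ?thesis by (simp add: power2_eq_square)
          qed
          \<comment> \<open>The fields fill at least half of a wide word, and
            \<open>b \<le> 3 * \<Lambda>\<close>; together this gives the factor
            \<open>6\<close>.\<close>
          have "(real w)\<^sup>2 \<le> 6 * (real q * \<Lambda>)"
          proof -
            have "w * w \<le> w * (2 * (w div b * b))"
              using half_quotient[of b w] b(1) \<open>b \<le> w\<close> by (intro mult_le_mono2) simp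
            then have "w * w \<le> 2 * (q * b)" by (simp add: q_def algebra_simps)
            then have "real (w * w) \<le> real (2 * (q * b))" by (simp only: of_nat_le_iff)
            then have "(real w)\<^sup>2 \<le> 2 * (real q * real b)" by (simp add: power2_eq_square)
            also have "\<dots> \<le> 2 * (real q * (3 * \<Lambda>))" using b3 by (intro mult_left_mono) auto
            finally show ?thesis by simp
          qed
          then have "1 / real q \<le> 6 * \<Lambda> / (real w)\<^sup>2" using q1 w1 by (simp add: field_simps)
          then have "real s * real l * (1 / real q) \<le> real s * real l * (6 * \<Lambda> / (real w)\<^sup>2)"
            by (intro mult_left_mono) auto
          then have slq: "real l * real s / real q \<le> 6 * P" unfolding slM(2) P_def using slM(2) by (simp add: mult_ac)
          have lq: "real l / real q \<le> real l" using q1 by (simp add: divide_le_eq mult_left_mono[of 1 "real q" "real l", simplified])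
          have "real (R.strips * (q * 88 + s * 62 + 22)) = real R.strips * (real q * 88 + real s * 62 + 22)"
            by simp
          also have "\<dots> \<le> (real l / real q + 1) * (real q * 88 + real s * 62 + 22)"
            using strips by (intro mult_right_mono) auto
          also have "\<dots> = 88 * real l + 62 * (real l * real s / real q) + 22 * (real l / real q)
              + 88 * real q + 62 * real s + 22"
            using q1 by (simp add: field_simps)
          \<comment> \<open>The summand \<open>88 * real q\<close> stems from rounding up the number
            of strips; it is exchanged for a multiple of \<open>w^2\<close>.\<close>
          also have "\<dots> \<le> 88 * real l + 62 * (6 * P) + 22 * real l + 88 * (real w)\<^sup>2 + 62 * real s + 22"
            using slq lq qw by linarith
          finally have "real (R.strips * (q * 88 + s * 62 + 22)) \<le>
            88 * real l + 62 * (6 * P) + 22 * real l + 88 * (real w)\<^sup>2 + 62 * real s + 22" .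
          moreover have "real K = 110 * real w + 80 * M + 100 + real (R.strips * (q * 88 + s * 62 + 22))"
            unfolding K_def by (simp only: of_nat_add of_nat_mult of_nat_numeral M_def)
          moreover have "0 \<le> real s" "0 \<le> real l" by simp_all
          ultimately show ?thesis using Tbound cP P0 M1 w_ww ww slM(1) by linarith
        qed
        moreover have "finite R.scratch" "R.scratch \<inter> {..<length X + length Y} = {}"
          unfolding R.scratch_def Rmn by (auto simp: m_def n_def)
        moreover have "real (card R.scratch) \<le> 8 * (real (min n m) / real w * \<Lambda>)"
          using sp unfolding card .
        ultimately show ?thesis by blast
      qed
    qed
  qed
qed

theorem theorem2:
  "\<exists>(P :: program) (S :: real). S > 0 \<and>
     (\<forall>(c1 :: real) (c2 :: real). 0 < c1 \<and> 0 < c2 \<longrightarrow>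
       (\<exists>T :: real. T > 0 \<and>
         (\<forall>(w :: nat) (\<sigma> :: nat) (X :: nat list) (Y :: nat list) (m :: nat) (n :: nat).
            length X = m \<and> length Y = n \<and>
            1 \<le> \<sigma> \<and> set X \<subseteq> {..<\<sigma>} \<and> set Y \<subseteq> {..<\<sigma>} \<and>
            \<lceil>log 2 (real \<sigma>)\<rceil> \<le> int w - 1 \<and>
            c1 * max (log 2 (real n)) (log 2 (real m)) \<le> real w \<and>
            real w \<le> c2 * max (log 2 (real n)) (log 2 (real m)) \<and>
            real m + real n + S * (real (min n m) / real w * log 2 (real \<sigma>)) \<le> 2 ^ w
            \<longrightarrow> computes_lcs_length w P \<sigma> X Y
                  (T * (real n * real m / (real w)\<^sup>2 * log 2 (real \<sigma>) + real m + real n))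
                  (S * (real (min n m) / real w * log 2 (real \<sigma>))))))"
proof (rule exI[of _ lcs_program], rule exI[of _ 8], intro conjI allI impI, goal_cases)
  case (2 c1 c2)
  then have "0 < 2000 * (1 + 16 * c2\<^sup>2)" by (simp add: add_pos_nonneg)
  then show ?case
    using 2 computes_lcs_program by (intro exI[of _ "2000 * (1 + 16 * c2\<^sup>2)"]) blast
qed simp

end
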